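(* Let $G$ be a DAG with vertices $V$, let $\mathcal X_V=\mathbb R^{|V|}$ (so $\mathcal X_v=\mathbb R$ for every $v$), and let $\mathrm{BN}_G^{\mathrm{eqb}}$ be the class of equicontinuous and bounded Bayesian networks induced by a tuple $(K,\omega,\mu)$ with $\mu$ the Lebesgue measure. Then the set of faithful Bayesian networks $\{m\in\mathrm{BN}_G^{\mathrm{eqb}}:D(m)\in F_G\}$ is open and dense in $(\mathrm{BN}_G^{\mathrm{eqb}},d_{TV}^\circ)$.
   Context: A DAG $G=(V,E)$ has a finite vertex set $V$ and no directed cycles; $\mathrm{pa}(v)=\{w: w\to v\in E\}$. The ancestors of $v$ are $v$ itself and all $w$ with a directed path from $w$ to $v$; an ancestor of a set $C$ is an ancestor of some element of $C$. A collider on a path is a vertex $v$ with $\cdots\to v\leftarrow\cdots$ on the path; other vertices of the path (including endpoints) are non-colliders. For (not necessarily disjoint) $A,B,C\subseteq V$, $A\perp^d_G B\mid C$ means that every path between some $a\in A$ and some $b\in B$ contains a collider that is not an ancestor of $C$, or a non-collider in $C$; for $a=b$ the trivial path $a$ counts as a path, blocked precisely when $a\in C$. $A\not\perp^d_G B\mid C$ is the negation. $\mathcal X_A=\mathbb R^{|A|}$ carries the Euclidean metric $d$ and Borel $\sigma$-algebra. $X_A\perp\!\!\!\perp_{\mathbb P}X_B\mid X_C$ means $\mathbb P(X_A\in E_A,X_B\in E_B\mid X_C)=\mathbb P(X_A\in E_A\mid X_C)\mathbb P(X_B\in E_B\mid X_C)$ a.s. for all Borel $E_A,E_B$. $M_G$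 is the set of Borel probability measures $\mathbb P$ on $\mathcal X_V$ with $A\perp^d_G B\mid C\Rightarrow X_A\perp\!\!\!\perp_{\mathbb P}X_B\mid X_C$ for all $A,B,C\subseteq V$; $F_G$ is the set of $\mathbb P\in M_G$ such that $A\not\perp^d_G B\mid C$ implies that $X_A\perp\!\!\!\perp_{\mathbb P}X_B\mid X_C$ fails, for all $A,B,C\subseteq V$. $\mathrm{BN}_G$ is the set of tuples $(\mathbb P(X_v\mid X_{\mathrm{pa}(v)}))_{v\in V}$ of Markov kernels $\mathcal X_{\mathrm{pa}(v)}\to\mathcal P(\mathcal X_v)$; the distribution map $D:\mathrm{BN}_G\to M_G$ sends such a tuple to the product of kernels $\bigotimes_{v}\mathbb P(X_v\mid X_{\mathrm{pa}(v)})$. With $d_{TV}(\mathbb P,\mathbb Q)=\sup_E|\mathbb P(E)-\mathbb Q(E)|$ over Borel $E$, $d_{TV}^\circ(m,m')=\sum_{v\in V}\sup_{x_{\mathrm{pa}(v)}}d_{TV}(\mathbb P_m(X_v\mid x_{\mathrm{pa}(v)}),\mathbb P_{m'}(X_v\mid x_{\mathrm{pa}(v)}))$. A modulus of continuity is a nonzero function $\omega:[0,\infty)\to[0,\infty)$ with $\lim_{t\downarrow0}\omega(t)=\omega(0)=0$, throughout assumed concave; $f$ admits the modulus $\omega$ if $|f(x)-f(x')|\le\omega(d(x,x'))$ for all $x,x'$. Given $K>0$ and a modulus $\omega$, the class $\mathrm{BN}_G^{\mathrm{eqb}}\subseteq\mathrm{BN}_G$ induced by $(K,\omega,\mu)$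 consists of the Bayesian networks such that for each $v$ the kernel has a conditional density $(x_v,x_{\mathrm{pa}(v)})\mapsto p(x_v\mid x_{\mathrm{pa}(v)})$ with respect to $\mu_v$ (here Lebesgue measure on $\mathbb R$) that is bounded by $K$ and admits the modulus $\omega$ on $\mathcal X_v\times\mathcal X_{\mathrm{pa}(v)}$. *)

theory Defs
  imports "HOL-Probability.Probability"
begin

section \<open>DAGs and d-separation\<close>

definition dag :: "'v set \<Rightarrow> ('v \<times> 'v) set \<Rightarrow> bool" where
  "dag V E \<longleftrightarrow> finite V \<and> E \<subseteq> V \<times> V \<and> acyclic E"

definition pa :: "('v \<times> 'v) set \<Rightarrow> 'v \<Rightarrow> 'v set" where
  "pa E v = {w. (w, v) \<in> E}"

definition ancestors :: "('v \<times> 'v) set \<Rightarrow> 'v set \<Rightarrow> 'v set" where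
  "ancestors E C = {w. \<exists>c\<in>C. (w, c) \<in> E\<^sup>*}"

text \<open>A path is a nonempty list of pairwise distinct vertices, consecutive ones being joined by
  an edge of either direction; in a DAG at most one of the two edges exists, so the list of
  vertices determines the edges. The only path from a vertex to itself is the trivial one.\<close>

definition dag_path :: "'v set \<Rightarrow> ('v \<times> 'v) set \<Rightarrow> 'v list \<Rightarrow> bool" where
  "dag_path V E p \<longleftrightarrow> p \<noteq> [] \<and> set p \<subseteq> V \<and> distinct p \<and>
     (\<forall>i. Suc i < length p \<longrightarrow> (p ! i, p ! Suc i) \<in> E \<or> (p ! Suc i, p ! i) \<in> E)"

definition collider_at :: "('v \<times> 'v) set \<Rightarrow> 'v list \<Rightarrow> nat \<Rightarrow> bool" where
  "collider_at E p i \<longleftrightarrow> 0 < i \<and> Suc i < length p \<and>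
     (p ! (i - 1), p ! i) \<in> E \<and> (p ! Suc i, p ! i) \<in> E"

definition path_blocked :: "('v \<times> 'v) set \<Rightarrow> 'v set \<Rightarrow> 'v list \<Rightarrow> bool" where
  "path_blocked E C p \<longleftrightarrow> (\<exists>i<length p.
     (collider_at E p i \<and> p ! i \<notin> ancestors E C) \<or> (\<not> collider_at E p i \<and> p ! i \<in> C))"

definition d_separated ::
    "'v set \<Rightarrow> ('v \<times> 'v) set \<Rightarrow> 'v set \<Rightarrow> 'v set \<Rightarrow> 'v set \<Rightarrow> bool" where
  "d_separated V E A B C \<longleftrightarrow>
     (\<forall>p. dag_path V E p \<and> hd p \<in> A \<and> last p \<in> B \<longrightarrow> path_blocked E C p)"


section \<open>Conditional independence, Markov and faithful measures\<close>

text \<open>For finite \<open>A\<close> this is \<open>\<real>\<^bsup>|A|\<^esup>\<close>, realised as extensional functions on \<open>A\<close>; the product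
  \<open>\<sigma>\<close>-algebra is the Borel \<open>\<sigma>\<close>-algebra of the Euclidean metric.\<close>

abbreviation Xsp :: "'v set \<Rightarrow> ('v \<Rightarrow> real) measure" where
  "Xsp A \<equiv> \<Pi>\<^sub>M a\<in>A. borel"

definition euclid_dist :: "'v set \<Rightarrow> ('v \<Rightarrow> real) \<Rightarrow> ('v \<Rightarrow> real) \<Rightarrow> real" where
  "euclid_dist A x y = L2_set (\<lambda>a. x a - y a) A"

definition proj_event :: "('v \<Rightarrow> real) measure \<Rightarrow> 'v set \<Rightarrow> ('v \<Rightarrow> real) set \<Rightarrow> ('v \<Rightarrow> real) set"
where
  "proj_event P A EA = {x \<in> space P. restrict x A \<in> EA}"

definition cond_prob_given ::
    "('v \<Rightarrow> real) measure \<Rightarrow> 'v set \<Rightarrow> ('v \<Rightarrow> real) set \<Rightarrow> ('v \<Rightarrow> real) \<Rightarrow> real" where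
  "cond_prob_given P C S =
     real_cond_exp P (vimage_algebra (space P) (\<lambda>x. restrict x C) (Xsp C)) (indicator S)"

definition cond_indep ::
    "('v \<Rightarrow> real) measure \<Rightarrow> 'v set \<Rightarrow> 'v set \<Rightarrow> 'v set \<Rightarrow> bool" where
  "cond_indep P A B C \<longleftrightarrow> (\<forall>EA\<in>sets (Xsp A). \<forall>EB\<in>sets (Xsp B).
     AE x in P. cond_prob_given P C (proj_event P A EA \<inter> proj_event P B EB) x =
       cond_prob_given P C (proj_event P A EA) x * cond_prob_given P C (proj_event P B EB) x)"

definition markov_measures :: "'v set \<Rightarrow> ('v \<times> 'v) set \<Rightarrow> ('v \<Rightarrow> real) measure set" where
  "markov_measures V E = {P \<in> space (prob_algebra (Xsp V)).
     \<forall>A\<subseteq>V. \<forall>B\<subseteq>V. \<forall>C\<subseteq>V. d_separated V E A B C \<longrightarrow> cond_indep P A B C}"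

definition faithful_measures :: "'v set \<Rightarrow> ('v \<times> 'v) set \<Rightarrow> ('v \<Rightarrow> real) measure set" where
  "faithful_measures V E = {P \<in> markov_measures V E.
     \<forall>A\<subseteq>V. \<forall>B\<subseteq>V. \<forall>C\<subseteq>V. \<not> d_separated V E A B C \<longrightarrow> \<not> cond_indep P A B C}"


section \<open>Bayesian networks\<close>

text \<open>The kernel of \<open>v\<close> maps a parent configuration to a probability measure on the real line.
  Extensionality makes equality of networks coincide with equality of all their kernels.\<close>

type_synonym 'v bayes_net = "'v \<Rightarrow> ('v \<Rightarrow> real) \<Rightarrow> real measure"

definition bayes_nets :: "'v set \<Rightarrow> ('v \<times> 'v) set \<Rightarrow> 'v bayes_net set" where
  "bayes_nets V E = (\<Pi>\<^sub>E v\<in>V. extensional (space (Xsp (pa E v))) \<inter>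
                               measurable (Xsp (pa E v)) (prob_algebra borel))"

definition topological_order :: "'v set \<Rightarrow> ('v \<times> 'v) set \<Rightarrow> 'v list \<Rightarrow> bool" where
  "topological_order V E vs \<longleftrightarrow> distinct vs \<and> set vs = V \<and>
     (\<forall>i<length vs. \<forall>j<length vs. (vs ! i, vs ! j) \<in> E \<longrightarrow> i < j)"

lemma topological_order_exists:
  assumes "finite V" "acyclic E"
  shows "\<exists>vs. topological_order V E vs"
  using assms(1)
proof (induction V rule: finite_psubset_induct)
  case (psubset V)
  show ?case
  proof (cases "V = {}")
    case True
    then show ?thesis by (intro exI[of _ "[]"]) (simp add: topological_order_def)
  next
    case False
    let ?R = "(E \<inter> V \<times> V)\<inverse>"
    have "acyclic (E \<inter> V \<times> V)" using assms(2) by (rule acyclic_subset) simp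
    moreover have "finite (E \<inter> V \<times> V)" using psubset.hyps by simp
    ultimately have "wf ?R" by (intro finite_acyclic_wf_converse)
    moreover obtain u where "u \<in> V" using False by blast
    ultimately obtain v where v: "v \<in> V" and min: "\<And>w. (w, v) \<in> ?R \<Longrightarrow> w \<notin> V"
      by (rule wfE_min) (iprover intro: that)
    have sink: "(v, w) \<notin> E" if "w \<in> V" for w
      using v that min[of w] by auto
    have "V - {v} \<subset> V" using v by auto
    then have "\<exists>vs. topological_order (V - {v}) E vs" by (rule psubset.IH)
    then obtain vs where vs: "topological_order (V - {v}) E vs" ..
    have "topological_order V E (vs @ [v])"
      unfolding topological_order_def
    proof (intro conjI allI impI)
      show "distinct (vs @ [v])"
        using vs by (simp add: topological_order_def)
      show V: "set (vs @ [v]) = V"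
        using vs v by (auto simp: topological_order_def)
      fix i j
      assume i: "i < length (vs @ [v])" and j: "j < length (vs @ [v])"
        and e: "((vs @ [v]) ! i, (vs @ [v]) ! j) \<in> E"
      have "(vs @ [v]) ! j \<in> V"
        using nth_mem[OF j] by (simp only: V)
      then have "(vs @ [v]) ! i \<noteq> v" using sink e by metis
      then have "i \<noteq> length vs" by (metis nth_append_length)
      then have i: "i < length vs" using i by simp
      show "i < j"
      proof (cases "j < length vs")
        case True
        then have "(vs ! i, vs ! j) \<in> E" using e i by (simp add: nth_append)
        then show ?thesis using vs i True unfolding topological_order_def by blast
      qed (use i in simp)
    qed
    then show ?thesis by blast
  qed
qed

text \<open>Product of the kernels along a list in which every vertex comes before its parents: the
  coordinate of the head is drawn last, given the coordinates of the tail.\<close>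

primrec kernel_product ::
    "('v \<times> 'v) set \<Rightarrow> 'v bayes_net \<Rightarrow> 'v list \<Rightarrow> ('v \<Rightarrow> real) measure" where
  "kernel_product E m [] = return (Xsp {}) (\<lambda>_. undefined)"
| "kernel_product E m (v # vs) = kernel_product E m vs \<bind>
     (\<lambda>x. distr (m v (restrict x (pa E v))) (Xsp (set (v # vs))) (\<lambda>y. x(v := y)))"

text \<open>By Fubini the product does not depend on the topological order.\<close>

definition bn_distribution ::
    "'v set \<Rightarrow> ('v \<times> 'v) set \<Rightarrow> 'v bayes_net \<Rightarrow> ('v \<Rightarrow> real) measure" where
  "bn_distribution V E m = kernel_product E m (rev (SOME vs. topological_order V E vs))"


section \<open>The metric on Bayesian networks\<close>

definition tv_dist :: "'a measure \<Rightarrow> 'a measure \<Rightarrow> real" where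
  "tv_dist P Q = (SUP S\<in>sets P. \<bar>measure P S - measure Q S\<bar>)"

text \<open>The value 0 outside the set of networks is a dummy: the locale \<open>Metric_space\<close> wants a
  nonnegative symmetric function on the whole type.\<close>

definition bn_dist :: "'v set \<Rightarrow> ('v \<times> 'v) set \<Rightarrow> 'v bayes_net \<Rightarrow> 'v bayes_net \<Rightarrow> real" where
  "bn_dist V E m m' = (if m \<in> bayes_nets V E \<and> m' \<in> bayes_nets V E
     then \<Sum>v\<in>V. SUP x\<in>space (Xsp (pa E v)). tv_dist (m v x) (m' v x) else 0)"

context
  fixes P Q :: "'a measure" and N :: "'a measure"
  assumes P: "P \<in> space (prob_algebra N)" and Q: "Q \<in> space (prob_algebra N)"
begin

lemma tv_dist_bdd: "bdd_above ((\<lambda>S. \<bar>measure P S - measure Q S\<bar>) ` sets P)"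
  and tv_dist_le_1: "tv_dist P Q \<le> 1"
  and tv_dist_nonneg: "0 \<le> tv_dist P Q"
proof -
  interpret p: prob_space P using P by (simp add: space_prob_algebra)
  interpret q: prob_space Q using Q by (simp add: space_prob_algebra)
  have le: "\<bar>measure P S - measure Q S\<bar> \<le> 1" for S
    using p.prob_le_1[of S] q.prob_le_1[of S] measure_nonneg[of P S] measure_nonneg[of Q S]
    by linarith
  show bdd: "bdd_above ((\<lambda>S. \<bar>measure P S - measure Q S\<bar>) ` sets P)"
    using le by (intro bdd_aboveI[of _ 1]) auto
  show "tv_dist P Q \<le> 1" unfolding tv_dist_def
    using le by (intro cSUP_least) auto
  show "0 \<le> tv_dist P Q" unfolding tv_dist_def
    by (rule cSUP_upper2[OF bdd, of "{}"]) auto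
qed

lemma tv_dist_upper: "S \<in> sets N \<Longrightarrow> \<bar>measure P S - measure Q S\<bar> \<le> tv_dist P Q"
  unfolding tv_dist_def using P by (intro cSUP_upper tv_dist_bdd) (simp add: space_prob_algebra)

lemma tv_dist_commute: "tv_dist P Q = tv_dist Q P"
  using P Q by (simp add: tv_dist_def space_prob_algebra abs_minus_commute)

lemma tv_dist_eq_0_iff: "tv_dist P Q = 0 \<longleftrightarrow> P = Q"
proof
  assume 0: "tv_dist P Q = 0"
  interpret p: prob_space P using P by (simp add: space_prob_algebra)
  interpret q: prob_space Q using Q by (simp add: space_prob_algebra)
  have s: "sets P = sets N" "sets Q = sets N" using P Q by (simp_all add: space_prob_algebra)
  show "P = Q"
  proof (rule measure_eqI)
    fix S assume "S \<in> sets P"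
    then have "measure P S = measure Q S" using tv_dist_upper[of S] 0 s by simp
    then show "emeasure P S = emeasure Q S"
      by (simp add: p.emeasure_eq_measure q.emeasure_eq_measure)
  qed (simp add: s)
next
  assume PQ: "P = Q"
  have "sets Q \<noteq> {}" by (metis sets.empty_sets empty_iff)
  with PQ show "tv_dist P Q = 0" by (simp add: tv_dist_def)
qed

end

lemma tv_dist_triangle:
  assumes P: "P \<in> space (prob_algebra N)" and Q: "Q \<in> space (prob_algebra N)"
    and R: "R \<in> space (prob_algebra N)"
  shows "tv_dist P R \<le> tv_dist P Q + tv_dist Q R"
proof -
  have "\<bar>measure P S - measure R S\<bar> \<le> tv_dist P Q + tv_dist Q R" if "S \<in> sets P" for S
  proof -
    have "S \<in> sets N" using that P by (simp add: space_prob_algebra)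
    then show ?thesis using tv_dist_upper[OF P Q, of S] tv_dist_upper[OF Q R, of S] by linarith
  qed
  then show ?thesis unfolding tv_dist_def[of P R]
    by (intro cSUP_least) (auto intro: sets.empty_sets)
qed

lemma bayes_nets_kernel:
  assumes m: "m \<in> bayes_nets V E" and v: "v \<in> V" and x: "x \<in> space (Xsp (pa E v))"
  shows "m v x \<in> space (prob_algebra borel)"
proof -
  have "m v \<in> extensional (space (Xsp (pa E v))) \<inter> measurable (Xsp (pa E v)) (prob_algebra borel)"
    using m v unfolding bayes_nets_def by (rule PiE_mem)
  then have "m v \<in> measurable (Xsp (pa E v)) (prob_algebra borel)" by (rule IntD2)
  then show ?thesis using x by (rule measurable_space)
qed

lemma Xsp_space_nonempty: "space (Xsp A) \<noteq> {}"
  by (simp add: space_PiM PiE_eq_empty_iff)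

lemma kernel_tv_bdd:
  assumes "m \<in> bayes_nets V E" "m' \<in> bayes_nets V E" "v \<in> V"
  shows "bdd_above ((\<lambda>x. tv_dist (m v x) (m' v x)) ` space (Xsp (pa E v)))"
proof (rule bdd_aboveI2)
  fix x assume x: "x \<in> space (Xsp (pa E v))"
  show "tv_dist (m v x) (m' v x) \<le> 1"
    by (rule tv_dist_le_1[OF bayes_nets_kernel[OF assms(1,3) x] bayes_nets_kernel[OF assms(2,3) x]])
qed

theorem bn_dist_Metric_space:
  assumes "finite V"
  shows "Metric_space (bayes_nets V E) (bn_dist V E)"
proof
  let ?X = "\<lambda>v. space (Xsp (pa E v))"
  let ?s = "\<lambda>m m' v. SUP x\<in>?X v. tv_dist (m v x) (m' v x)"
  have up: "tv_dist (m v x) (m' v x) \<le> ?s m m' v"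
    if "m \<in> bayes_nets V E" "m' \<in> bayes_nets V E" "v \<in> V" "x \<in> ?X v" for m m' v x
    using that by (intro cSUP_upper kernel_tv_bdd)
  have s0: "0 \<le> ?s m m' v"
    if m: "m \<in> bayes_nets V E" "m' \<in> bayes_nets V E" "v \<in> V" for m m' v
  proof -
    obtain x where x: "x \<in> ?X v" using Xsp_space_nonempty by blast
    show ?thesis
      using tv_dist_nonneg[OF bayes_nets_kernel[OF m(1,3) x] bayes_nets_kernel[OF m(2,3) x]]
        up[OF m x] by (rule order_trans)
  qed
  fix m m' m'' :: "'a bayes_net"
  show "0 \<le> bn_dist V E m m'"
    by (auto simp: bn_dist_def intro!: sum_nonneg s0)
  show "bn_dist V E m m' = bn_dist V E m' m"
  proof (cases "m \<in> bayes_nets V E \<and> m' \<in> bayes_nets V E")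
    case True
    then have "?s m m' v = ?s m' m v" if "v \<in> V" for v
      using that by (intro SUP_cong refl tv_dist_commute[OF bayes_nets_kernel bayes_nets_kernel]) auto
    then have "(\<Sum>v\<in>V. ?s m m' v) = (\<Sum>v\<in>V. ?s m' m v)"
      by (rule sum.cong[OF refl])
    with True show ?thesis by (simp only: bn_dist_def conj_commute)
  qed (auto simp: bn_dist_def)
  assume m: "m \<in> bayes_nets V E" and m': "m' \<in> bayes_nets V E"
  show "bn_dist V E m m' = 0 \<longleftrightarrow> m = m'"
  proof
    assume "bn_dist V E m m' = 0"
    then have 0: "?s m m' v = 0" if "v \<in> V" for v
      using that assms m m' s0[OF m m'] by (auto simp: bn_dist_def sum_nonneg_eq_0_iff)
    have eq: "m v x = m' v x" if v: "v \<in> V" and x: "x \<in> ?X v" for v x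
    proof -
      have "tv_dist (m v x) (m' v x) = 0"
        using up[OF m m' v x] 0[OF v]
          tv_dist_nonneg[OF bayes_nets_kernel[OF m v x] bayes_nets_kernel[OF m' v x]] by simp
      then show ?thesis
        using tv_dist_eq_0_iff[OF bayes_nets_kernel[OF m v x] bayes_nets_kernel[OF m' v x]] by simp
    qed
    have "m v = m' v" if v: "v \<in> V" for v
    proof (rule extensionalityI[of _ "?X v"])
      show "m v \<in> extensional (?X v)" "m' v \<in> extensional (?X v)"
        using PiE_mem[OF m[unfolded bayes_nets_def] v] PiE_mem[OF m'[unfolded bayes_nets_def] v]
        by simp_all
    qed (use eq v in blast)
    then show "m = m'"
      using PiE_ext[OF m[unfolded bayes_nets_def] m'[unfolded bayes_nets_def]] by blast
  next
    assume "m = m'"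
    have "?s m' m' v = 0" if v: "v \<in> V" for v
    proof -
      have "(\<lambda>x. tv_dist (m' v x) (m' v x)) ` ?X v = (\<lambda>x. 0) ` ?X v"
        using tv_dist_eq_0_iff[OF bayes_nets_kernel[OF m' v] bayes_nets_kernel[OF m' v]]
        by (intro image_cong) auto
      then show ?thesis by (simp only: cSUP_const[OF Xsp_space_nonempty])
    qed
    then show "bn_dist V E m m' = 0"
      using \<open>m = m'\<close> by (simp add: bn_dist_def)
  qed
  assume m'': "m'' \<in> bayes_nets V E"
  have "?s m m'' v \<le> ?s m m' v + ?s m' m'' v" if v: "v \<in> V" for v
  proof (rule cSUP_least[OF Xsp_space_nonempty])
    fix x assume x: "x \<in> ?X v"
    show "tv_dist (m v x) (m'' v x) \<le> ?s m m' v + ?s m' m'' v"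
      using tv_dist_triangle[OF bayes_nets_kernel[OF m v x] bayes_nets_kernel[OF m' v x]
          bayes_nets_kernel[OF m'' v x]] up[OF m m' v x] up[OF m' m'' v x] by linarith
  qed
  then have "(\<Sum>v\<in>V. ?s m m'' v) \<le> (\<Sum>v\<in>V. ?s m m' v + ?s m' m'' v)"
    by (rule sum_mono)
  then show "bn_dist V E m m'' \<le> bn_dist V E m m' + bn_dist V E m' m''"
    using m m' m'' by (simp add: bn_dist_def sum.distrib)
qed


section \<open>Equicontinuous and bounded Bayesian networks\<close>

text \<open>Only the values on \<open>[0, \<infinity>)\<close> matter.\<close>

definition concave_modulus :: "(real \<Rightarrow> real) \<Rightarrow> bool" where
  "concave_modulus \<omega> \<longleftrightarrow> (\<forall>t\<ge>0. 0 \<le> \<omega> t) \<and> (\<exists>t\<ge>0. \<omega> t \<noteq> 0) \<and>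
     \<omega> 0 = 0 \<and> (\<omega> \<longlongrightarrow> 0) (at_right 0) \<and> concave_on {0..} \<omega>"

definition admits_modulus :: "'v set \<Rightarrow> (real \<Rightarrow> real) \<Rightarrow> (('v \<Rightarrow> real) \<Rightarrow> real) \<Rightarrow> bool" where
  "admits_modulus A \<omega> f \<longleftrightarrow>
     (\<forall>z\<in>space (Xsp A). \<forall>z'\<in>space (Xsp A). \<bar>f z - f z'\<bar> \<le> \<omega> (euclid_dist A z z'))"

text \<open>A conditional density of the kernel of \<open>v\<close> is a function \<open>p\<close> on
  \<open>\<real>\<^bsup>insert v (pa v)\<^esup>\<close>, its value \<open>p (x(v := y))\<close> being \<open>p(y | x)\<close>. Measurability of \<open>p\<close> follows
  from the modulus of continuity.\<close>

definition eqb_bayes_nets ::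
    "'v set \<Rightarrow> ('v \<times> 'v) set \<Rightarrow> real \<Rightarrow> (real \<Rightarrow> real) \<Rightarrow> 'v bayes_net set" where
  "eqb_bayes_nets V E K \<omega> = {m \<in> bayes_nets V E. \<forall>v\<in>V. \<exists>p.
     (\<forall>x\<in>space (Xsp (pa E v)). m v x = density lborel (\<lambda>y. ennreal (p (x(v := y))))) \<and>
     (\<forall>z\<in>space (Xsp (insert v (pa E v))). 0 \<le> p z \<and> p z \<le> K) \<and>
     admits_modulus (insert v (pa E v)) \<omega> p}"

corollary eqb_Metric_space:
  "finite V \<Longrightarrow> Metric_space (eqb_bayes_nets V E K \<omega>) (bn_dist V E)"
  by (rule Metric_space.subspace[OF bn_dist_Metric_space]) (auto simp: eqb_bayes_nets_def)

end

theory Submission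
  imports Defs
begin

text \<open>Faithfulness of \<open>D(m)\<close> means that every separation \<open>A \<perp> B | C\<close> of the graph holds as a conditional
independence and that every other triple \<open>(A, B, C)\<close> is conditionally dependent. The first half holds
for all networks of the class (the global Markov property, \<open>joint_markov\<close>). The second half concerns
finitely many triples, and a finite intersection of open dense sets is open and dense. So it suffices
that for each triple that is not d-separated the networks with the dependence form an open dense set.

\<^emph>\<open>The common tool.\<close> Relative to a product \<open>M\<close> of probability measures on the line, \<open>D(m)\<close> has the
product of the conditional densities as density \<open>f\<close>. Conditional probabilities given \<open>X\<^sub>C\<close> are quotients
of functions obtained from \<open>f\<close> by integrating out the coordinates outside \<open>C\<close>, written \<open>avg (V - C)\<close>.
Hence conditional independence of two events is the pointwise equation
\<open>avg (f 1\<^sub>S 1\<^sub>T) * avg f = avg (f 1\<^sub>S) * avg (f 1\<^sub>T)\<close>, almost everywhere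
(\<open>cond_indep_event_iff\<close>); no division and no choice of versions is left.

\<^emph>\<open>Open.\<close> The joint densities differ in \<open>L\<^sup>1\<close> by at most twice the distance of the networks
(\<open>joint_close\<close>), and the equation is preserved by \<open>L\<^sup>1\<close> limits, because the averages converge almost
everywhere along a subsequence (\<open>ci_eq_closed\<close>).

\<^emph>\<open>Dense.\<close> The class is convex. Along the segment of kernels from \<open>m\<close> to any network \<open>m\<^sub>1\<close> of the class
the joint density, hence the equation at each point, is polynomial in the parameter. If the equation
held for parameters accumulating at \<open>m\<close>, it would hold at \<open>m\<^sub>1\<close> as well (\<open>dependence_dense\<close>). It remains
to find one network of the class with the required dependence.

\<^emph>\<open>One dependent network.\<close> Given an active path from \<open>a\<close> to \<open>b\<close>, every vertex carries a random sign. A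
vertex with a path edge pointing to it, or on a directed path from a collider to \<open>C\<close>, has as its sign
the product of the signs of those predecessors; all other signs are fair coins. Multiplying all these
relations, every vertex outside \<open>C\<close> except \<open>a\<close> and \<open>b\<close> cancels, so the sign of \<open>a\<close> times that of \<open>b\<close>
is a function of \<open>X\<^sub>C\<close>. Flipping the signs of all non-colliders of the path preserves the relations and
\<open>X\<^sub>C\<close> but reverses \<open>a\<close>, so given \<open>X\<^sub>C\<close> the sign of \<open>a\<close> is still a fair coin, and the two signs are
dependent (\<open>parity_dependent\<close>). With Lipschitz densities for the magnitudes, stretched far enough, this
network meets any bound \<open>K\<close> and any modulus \<open>\<omega>\<close>, since a concave modulus dominates some \<open>min b (L t)\<close>.

\<^emph>\<open>The graph theory.\<close> The cancellation needs a path whose vertices are distinct and whose descents from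
colliders to \<open>C\<close> avoid its non-colliders. An active walk with the fewest colliders and, among those, the
fewest edges has both properties (\<open>vertices_distinct\<close>, \<open>chain_avoids\<close>). As such a walk is an unblocked
path, walks may replace paths in the Markov property, too.\<close>

section \<open>Active walks\<close>

abbreviation family :: "('v \<times> 'v) set \<Rightarrow> 'v \<Rightarrow> 'v set" where
  "family E v \<equiv> insert v (pa E v)"

text \<open>A walk is a sequence of states: a vertex together with a flag saying whether the walk has entered it
through an arrow head. The next edge then decides whether the vertex is a collider, so being unblocked
is a condition on single steps. The start has the flag \<open>False\<close>, which makes it a non-collider.\<close>

definition step :: "('v \<times> 'v) set \<Rightarrow> 'v set \<Rightarrow> 'v \<times> bool \<Rightarrow> 'v \<times> bool \<Rightarrow> bool" where
  "step E C s t \<longleftrightarrow> (if snd t then (fst s, fst t) \<in> E \<and> fst s \<notin> C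
     else (fst t, fst s) \<in> E \<and> (if snd s then fst s \<in> ancestors E C else fst s \<notin> C))"

text \<open>The numbers in \<open>walk E C k n s t\<close> count the colliders and the edges.\<close>

inductive walk :: "('v \<times> 'v) set \<Rightarrow> 'v set \<Rightarrow> nat \<Rightarrow> nat \<Rightarrow> 'v \<times> bool \<Rightarrow> 'v \<times> bool \<Rightarrow> bool"
  for E C where
  walk_refl: "walk E C 0 0 s s"
| walk_step: "step E C s t \<Longrightarrow> walk E C k n t u \<Longrightarrow>
    walk E C (of_bool (snd s \<and> \<not> snd t) + k) (Suc n) s u"

lemma walk_trans:
  assumes "walk E C k n s t" "walk E C k' n' t u"
  shows "walk E C (k + k') (n + n') s u"
  using assms
proof (induction rule: walk.induct)
  case (walk_step s t k n u)
  from walk.walk_step[OF walk_step(1) walk_step.IH[OF walk_step.prems]]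
  show ?case by (simp add: add.assoc)
qed simp

lemma walk_single: "step E C s t \<Longrightarrow> walk E C (of_bool (snd s \<and> \<not> snd t)) (Suc 0) s t"
  using walk_step[OF _ walk_refl, of E C s t] by simp

lemma ancestors_edge: "(v, w) \<in> E \<Longrightarrow> w \<in> ancestors E C \<Longrightarrow> v \<in> ancestors E C"
  unfolding ancestors_def by (blast intro: converse_rtrancl_into_rtrancl)

lemma ancestors_self: "c \<in> C \<Longrightarrow> c \<in> ancestors E C"
  unfolding ancestors_def by blast

text \<open>A walk that enters a vertex through an arrow head and finishes with a tail has to turn round at a
collider; up to the first collider all its edges point forward.\<close>

lemma walk_in_out:
  assumes "walk E C k n s t" "snd s" "\<not> snd t"
  shows "1 \<le> k \<and> fst s \<in> ancestors E C"
  using assms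
proof (induction rule: walk.induct)
  case (walk_step s t k n u)
  then show ?case
    by (cases "snd t") (auto simp: step_def intro: ancestors_edge)
qed simp

lemma walk0_in:
  assumes "walk E C k n s t" "k = 0" "snd s"
  shows "(fst s, fst t) \<in> E\<^sup>*"
  using assms
proof (induction rule: walk.induct)
  case (walk_step s t k n u)
  then have "snd t" by (cases "snd t") auto
  with walk_step show ?case
    by (auto simp: step_def intro: converse_rtrancl_into_rtrancl)
qed simp

lemma walk0_out:
  assumes "walk E C k n s t" "k = 0" "\<not> snd t"
  shows "(fst t, fst s) \<in> E\<^sup>*"
  using assms
proof (induction rule: walk.induct)
  case (walk_step s t k n u)
  then have "\<not> snd t" using walk_in_out[OF walk_step(2)] by auto
  with walk_step show ?case
    by (auto simp: step_def intro: rtrancl_into_rtrancl)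
qed simp

abbreviation avoiding :: "('v \<times> 'v) set \<Rightarrow> 'v set \<Rightarrow> ('v \<times> 'v) set" where
  "avoiding E C \<equiv> {(x, y) \<in> E. x \<notin> C}"

lemma avoiding_trancl: "(v, u) \<in> (avoiding E C)\<^sup>+ \<Longrightarrow> (v, u) \<in> E\<^sup>+"
  by (rule trancl_mono) auto

text \<open>A directed path that avoids \<open>C\<close> can be walked in either direction without meeting a collider, except
possibly at its lower end when it is entered there through an arrow head.\<close>

lemma walk_down:
  assumes "(v, u) \<in> (avoiding E C)\<^sup>*"
  shows "\<exists>n. walk E C 0 n (v, True) (u, True)"
  using assms
proof (induction rule: converse_rtrancl_induct)
  case base
  then show ?case by (blast intro: walk_refl)
next
  case (step y z)
  then obtain n where "walk E C 0 n (z, True) (u, True)" by blast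
  then have "walk E C (of_bool (snd (y, True) \<and> \<not> snd (z, True)) + 0) (Suc n) (y, True) (u, True)"
    using step by (intro walk_step) (auto simp: step_def)
  then show ?case by auto
qed

lemma walk_up:
  assumes "(v, u) \<in> (avoiding E C)\<^sup>+" and "if d then u \<in> ancestors E C else u \<notin> C"
  shows "\<exists>n. walk E C (of_bool d) n (u, d) (v, False)"
  using assms(1)
proof (induction rule: converse_trancl_induct)
  case (base y)
  with assms(2) have "step E C (u, d) (y, False)" by (auto simp: step_def)
  from walk_single[OF this] show ?case by auto
next
  case (step y z)
  then obtain n where n: "walk E C (of_bool d) n (u, d) (z, False)" by blast
  from step have "z \<notin> C" by (auto dest: tranclD)
  with step have "step E C (z, False) (y, False)" by (auto simp: step_def)
  from walk_trans[OF n walk_single[OF this]] show ?case by auto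
qed

lemma walk_sequence:
  assumes "walk E C k n s t"
  shows "\<exists>\<sigma>. \<sigma> 0 = s \<and> \<sigma> n = t \<and> (\<forall>i<n. step E C (\<sigma> i) (\<sigma> (Suc i))) \<and>
    k = (\<Sum>i<n. of_bool (snd (\<sigma> i) \<and> \<not> snd (\<sigma> (Suc i))))"
  using assms
proof (induction rule: walk.induct)
  case (walk_refl s)
  then show ?case by (intro exI[of _ "\<lambda>_. s"]) auto
next
  case (walk_step s t k n u)
  then obtain \<sigma> where \<sigma>: "\<sigma> 0 = t" "\<sigma> n = u" "\<And>i. i < n \<Longrightarrow> step E C (\<sigma> i) (\<sigma> (Suc i))"
    "k = (\<Sum>i<n. of_bool (snd (\<sigma> i) \<and> \<not> snd (\<sigma> (Suc i))))" by blast
  show ?case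
  proof (intro exI[of _ "case_nat s \<sigma>"] conjI allI impI)
    fix i assume "i < Suc n"
    then show "step E C (case_nat s \<sigma> i) (case_nat s \<sigma> (Suc i))"
      using \<sigma> walk_step(1) by (cases i) auto
  next
    show "of_bool (snd s \<and> \<not> snd t) + k =
      (\<Sum>i<Suc n. of_bool (snd (case_nat s \<sigma> i) \<and> \<not> snd (case_nat s \<sigma> (Suc i))))"
      unfolding sum.lessThan_Suc_shift by (simp add: \<sigma>)
  qed (use \<sigma> in auto)
qed

lemma sequence_walk:
  assumes "\<And>l. i \<le> l \<Longrightarrow> l < i + n \<Longrightarrow> step E C (\<sigma> l) (\<sigma> (Suc l))"
  shows "walk E C (\<Sum>l\<in>{i..<i + n}. of_bool (snd (\<sigma> l) \<and> \<not> snd (\<sigma> (Suc l)))) n (\<sigma> i) (\<sigma> (i + n))"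
  using assms
proof (induction n)
  case 0
  then show ?case by (simp add: walk_refl)
next
  case (Suc n)
  have w: "walk E C (\<Sum>l\<in>{i..<i + n}. of_bool (snd (\<sigma> l) \<and> \<not> snd (\<sigma> (Suc l)))) n (\<sigma> i) (\<sigma> (i + n))"
    by (intro Suc.IH Suc.prems) auto
  have "step E C (\<sigma> (i + n)) (\<sigma> (Suc (i + n)))" by (intro Suc.prems) auto
  from walk_trans[OF w walk_single[OF this]] show ?case by simp
qed

text \<open>The order of minimization matters: the shortcuts in \<open>chain_avoids\<close> save a collider but may be longer.\<close>

locale minimal_walk =
  fixes E :: "('v \<times> 'v) set" and A B C :: "'v set" and \<sigma> :: "nat \<Rightarrow> 'v \<times> bool" and n :: nat
  assumes acyclic: "acyclic E"
    and start: "fst (\<sigma> 0) \<in> A - C" "\<not> snd (\<sigma> 0)"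
    and finish: "fst (\<sigma> n) \<in> B - C"
    and steps: "\<And>i. i < n \<Longrightarrow> step E C (\<sigma> i) (\<sigma> (Suc i))"
    and minimal: "\<And>a b d k l. a \<in> A - C \<Longrightarrow> b \<in> B - C \<Longrightarrow> walk E C k l (a, False) (b, d) \<Longrightarrow>
      (\<Sum>i<n. of_bool (snd (\<sigma> i) \<and> \<not> snd (\<sigma> (Suc i)))) < k \<or>
      (\<Sum>i<n. of_bool (snd (\<sigma> i) \<and> \<not> snd (\<sigma> (Suc i)))) = k \<and> n \<le> l"

lemma minimal_walk_exists:
  assumes "acyclic E" "a \<in> A - C" "b \<in> B - C" "walk E C k l (a, False) (b, d)"
  shows "\<exists>\<sigma> n. minimal_walk E A B C \<sigma> n"
proof -
  define W where "W = {(k, l). \<exists>a b d. a \<in> A - C \<and> b \<in> B - C \<and> walk E C k l (a, False) (b, d)}"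
  have "(k, l) \<in> W" using assms unfolding W_def by blast
  then obtain m where m: "m \<in> W" "\<And>y. (y, m) \<in> less_than <*lex*> less_than \<Longrightarrow> y \<notin> W"
    using wfE_min[OF wf_lex_prod[OF wf_less_than wf_less_than]] by metis
  obtain k0 l0 where kl: "m = (k0, l0)" by (cases m)
  from m(1) obtain a0 b0 d0 where w: "a0 \<in> A - C" "b0 \<in> B - C" "walk E C k0 l0 (a0, False) (b0, d0)"
    unfolding W_def kl by blast
  from walk_sequence[OF w(3)] obtain \<sigma> where \<sigma>: "\<sigma> 0 = (a0, False)" "\<sigma> l0 = (b0, d0)"
    "\<forall>i<l0. step E C (\<sigma> i) (\<sigma> (Suc i))"
    "k0 = (\<Sum>i<l0. of_bool (snd (\<sigma> i) \<and> \<not> snd (\<sigma> (Suc i))))" by blast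
  have "minimal_walk E A B C \<sigma> l0"
  proof
    fix a b d k l
    assume "a \<in> A - C" "b \<in> B - C" "walk E C k l (a, False) (b, d)"
    then have "(k, l) \<in> W" unfolding W_def by blast
    then have "\<not> (((k, l), m) \<in> less_than <*lex*> less_than)" using m(2) by blast
    then show "(\<Sum>i<l0. of_bool (snd (\<sigma> i) \<and> \<not> snd (\<sigma> (Suc i)))) < k \<or>
      (\<Sum>i<l0. of_bool (snd (\<sigma> i) \<and> \<not> snd (\<sigma> (Suc i)))) = k \<and> l0 \<le> l"
      unfolding \<sigma>(4)[symmetric] kl by auto
  qed (use assms \<sigma> w in auto)
  then show ?thesis by blast
qed

context minimal_walk
begin

definition cols :: "nat \<Rightarrow> nat \<Rightarrow> nat" where
  "cols i j = (\<Sum>l\<in>{i..<j}. of_bool (snd (\<sigma> l) \<and> \<not> snd (\<sigma> (Suc l))))"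

lemma cols_split: "i \<le> j \<Longrightarrow> j \<le> k \<Longrightarrow> cols i k = cols i j + cols j k"
  unfolding cols_def by (rule sum.atLeastLessThan_concat[symmetric])

lemma subwalk: "i \<le> j \<Longrightarrow> j \<le> n \<Longrightarrow> walk E C (cols i j) (j - i) (\<sigma> i) (\<sigma> j)"
  using sequence_walk[of i "j - i" E C \<sigma>] steps by (simp add: cols_def)

lemma no_cheaper_walk:
  assumes "walk E C k l (\<sigma> 0) t" "fst t \<in> B - C"
  shows "cols 0 n < k \<or> cols 0 n = k \<and> n \<le> l"
proof -
  have "(fst (\<sigma> 0), False) = \<sigma> 0" using start by (simp add: prod_eq_iff)
  with minimal[OF start(1) assms(2), of k l "snd t"] assms(1)
  show ?thesis by (simp only: cols_def lessThan_atLeast0 prod.collapse)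
qed

text \<open>Splicing a new initial part onto the walk at position \<open>j\<close> may enter \<open>u\<close> through an arrow head where
the old one did not. At worst this turns \<open>u\<close> into an additional collider.\<close>

lemma continue_in:
  assumes "j \<le> n" "\<sigma> j = (u, d)" "u \<in> ancestors E C"
  shows "\<exists>k l t. walk E C k l (u, True) t \<and> fst t = fst (\<sigma> n) \<and> k \<le> cols j n + of_bool (\<not> d) \<and> l \<le> n - j"
proof (cases "d \<or> j = n")
  case True
  then show ?thesis
  proof (cases d)
    case True
    have "walk E C (cols j n) (n - j) (u, True) (\<sigma> n)"
      using subwalk[OF assms(1) order_refl] assms(2) True by simp
    then show ?thesis
      by (intro exI[of _ "cols j n"] exI[of _ "n - j"] exI[of _ "\<sigma> n"] conjI) auto
  next
    case False
    with True have "j = n" by simp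
    with assms(2) show ?thesis
      by (intro exI[of _ 0] exI[of _ "(u, True)"]) (auto intro: walk_refl)
  qed
next
  case False
  then have j: "j < n" "\<not> d" using assms by auto
  have st: "step E C (u, False) (\<sigma> (Suc j))" using steps[OF j(1)] assms(2) j by simp
  then have st': "step E C (u, True) (\<sigma> (Suc j))"
    using assms(3) by (auto simp: step_def)
  have w: "walk E C (cols (Suc j) n) (n - Suc j) (\<sigma> (Suc j)) (\<sigma> n)" using subwalk j by simp
  have "cols j n = cols (Suc j) n"
    using cols_split[of j "Suc j" n] j assms(2) by (simp add: cols_def)
  moreover have "walk E C (of_bool (\<not> snd (\<sigma> (Suc j))) + cols (Suc j) n) (n - j) (u, True) (\<sigma> n)"
    using walk_trans[OF walk_single[OF st'] w] j(1) by (simp add: Suc_diff_Suc)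
  moreover have "of_bool (\<not> snd (\<sigma> (Suc j))) \<le> (1 :: nat)" by simp
  ultimately show ?thesis using j(2)
    by (intro exI[of _ "of_bool (\<not> snd (\<sigma> (Suc j))) + cols (Suc j) n"] exI[of _ "n - j"]
      exI[of _ "\<sigma> n"] conjI) auto
qed

text \<open>The loop between two visits of the same vertex \<open>u\<close> can be cut out. The only critical case is that \<open>u\<close>
becomes a collider; then the loop leaves \<open>u\<close> through a tail and comes back through a tail, so it has a
collider of its own, which is removed, and which makes \<open>u\<close> an ancestor of \<open>C\<close>.\<close>

lemma vertices_distinct: "inj_on (\<lambda>i. fst (\<sigma> i)) {..n}"
proof (rule linorder_inj_onI)
  show "x \<le> y \<or> y \<le> x" for x y :: nat by linarith
  fix i j assume ij: "i < j" "i \<in> {..n}" "j \<in> {..n}"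
  then have ijn: "i < j" "j \<le> n" by auto
  show "fst (\<sigma> i) \<noteq> fst (\<sigma> j)"
  proof
    assume eq: "fst (\<sigma> i) = fst (\<sigma> j)"
    obtain u d d' where u: "\<sigma> i = (u, d)" "\<sigma> j = (u, d')"
      using eq by (cases "\<sigma> i"; cases "\<sigma> j") auto
    have split: "cols 0 n = cols 0 i + cols i j + cols j n"
      using cols_split[of 0 i n] cols_split[of i j n] ijn by simp
    have w1: "walk E C (cols 0 i) i (\<sigma> 0) (\<sigma> i)" using subwalk[of 0 i] ijn by simp
    have w2: "walk E C (cols i j) (j - i) (\<sigma> i) (\<sigma> j)" using subwalk[of i j] ijn by simp
    have w3: "walk E C (cols j n) (n - j) (\<sigma> j) (\<sigma> n)" using subwalk[of j n] ijn by simp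
    have "\<exists>k l t. walk E C k l (u, d) t \<and> fst t = fst (\<sigma> n) \<and> k \<le> cols i j + cols j n \<and> l \<le> n - j"
    proof (cases "d = d'")
      case True
      with w3 u have "walk E C (cols j n) (n - j) (u, d) (\<sigma> n)" by simp
      then show ?thesis
        by (intro exI[of _ "cols j n"] exI[of _ "n - j"] exI[of _ "\<sigma> n"] conjI) auto
    next
      case False
      show ?thesis
      proof (cases d)
        case True
        with False u have "1 \<le> cols i j \<and> u \<in> ancestors E C"
          using walk_in_out[OF w2] by simp
        moreover from this obtain k l t where "walk E C k l (u, True) t" "fst t = fst (\<sigma> n)"
          "k \<le> cols j n + of_bool (\<not> d')" "l \<le> n - j"
          using continue_in[OF ijn(2) u(2)] by blast
        moreover from calculation have "k \<le> cols i j + cols j n"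
          by (cases d'; simp only: simp_thms of_bool_eq; linarith)
        ultimately show ?thesis using True by (metis (full_types))
      next
        case False
        with \<open>d \<noteq> d'\<close> have d: "\<not> d" "d'" by auto
        show ?thesis
        proof (cases "j = n")
          case True
          then show ?thesis using u
            by (intro exI[of _ 0] exI[of _ "(u, d)"]) (auto intro: walk_refl)
        next
          case False
          then have j: "j < n" using ijn by simp
          have "step E C (u, False) (\<sigma> (Suc i))" using steps[of i] ijn u d by simp
          then have "u \<notin> C" by (auto simp: step_def split: if_splits)
          moreover have "step E C (u, True) (\<sigma> (Suc j))" using steps[OF j] u d by simp
          ultimately have st: "step E C (u, d) (\<sigma> (Suc j))" using d by (auto simp: step_def split:
              if_splits)
          have w: "walk E C (cols (Suc j) n) (n - Suc j) (\<sigma> (Suc j)) (\<sigma> n)" using subwalk j by simp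
          have "cols (Suc j) n \<le> cols j n" using cols_split[of j "Suc j" n] j by simp
          moreover have "walk E C (cols (Suc j) n) (n - j) (u, d) (\<sigma> n)"
            using walk_trans[OF walk_single[OF st] w] j d by (simp add: Suc_diff_Suc)
          ultimately show ?thesis
            by (intro exI[of _ "cols (Suc j) n"] exI[of _ "n - j"] exI[of _ "\<sigma> n"] conjI) auto
        qed
      qed
    qed
    then obtain k l t where w: "walk E C k l (u, d) t" "fst t = fst (\<sigma> n)" "k \<le> cols i j + cols j n"
        "l \<le> n - j"
      by blast
    have "walk E C (cols 0 i + k) (i + l) (\<sigma> 0) t"
      using walk_trans[OF w1[unfolded u] w(1)] .
    from no_cheaper_walk[OF this] w(2) finish
    have "cols 0 n < cols 0 i + k \<or> cols 0 n = cols 0 i + k \<and> n \<le> i + l" by auto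
    with w(3,4) split ijn show False by linarith
  qed
qed

definition collider :: "nat \<Rightarrow> bool" where
  "collider i \<longleftrightarrow> i < n \<and> snd (\<sigma> i) \<and> \<not> snd (\<sigma> (Suc i))"

text \<open>A directed path from a collider \<open>v\<close> that reaches a non-collider \<open>u\<close> of the walk on its way to \<open>C\<close> is a
shortcut between \<open>v\<close> and \<open>u\<close>. It makes \<open>v\<close> a non-collider. If \<open>u\<close> becomes a collider, then another
collider between \<open>v\<close> and \<open>u\<close> disappears: without one, the skipped part would be a directed path from
\<open>u\<close> to \<open>v\<close> and close a cycle.\<close>

lemma chain_avoids:
  assumes i: "collider i" and j: "j \<le> n" "\<not> collider j"
    and chain: "(fst (\<sigma> i), fst (\<sigma> j)) \<in> (avoiding E C)\<^sup>*" and anc: "fst (\<sigma> j) \<in> ancestors E C"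
  shows False
proof -
  obtain u d where u: "\<sigma> j = (u, d)" by (cases "\<sigma> j")
  obtain v where v: "\<sigma> i = (v, True)" using i unfolding collider_def by (metis prod.collapse)
  obtain w where w: "\<sigma> (Suc i) = (w, False)" using i unfolding collider_def by (metis prod.collapse)
  have iN: "i < n" using i by (simp add: collider_def)
  have wv: "(w, v) \<in> E" using steps[OF iN] by (simp add: v w step_def)
  have "i \<noteq> j" using i j by auto
  then have "u \<noteq> v" using vertices_distinct u v iN j(1) unfolding inj_on_def
    by (metis atMost_iff fst_conv less_imp_le)
  with chain u v have chain': "(v, u) \<in> (avoiding E C)\<^sup>+"
    by (simp add: rtrancl_eq_or_trancl)
  then have vu: "(v, u) \<in> E\<^sup>+" by (rule avoiding_trancl)
  have nocycle: "(u, v) \<notin> E\<^sup>*"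
    using vu acyclic unfolding acyclic_def by (meson trancl_rtrancl_trancl)
  have c1: "cols i (Suc i) = 1" using i by (simp add: cols_def collider_def)
  show False
  proof (cases "i < j")
    case True
    obtain m where "walk E C 0 m (v, True) (u, True)" using walk_down[of v u E C] chain u v by auto
    moreover have "walk E C (cols 0 i) i (\<sigma> 0) (v, True)" using subwalk[of 0 i] iN v by simp
    moreover obtain k l t where t: "walk E C k l (u, True) t" "fst t = fst (\<sigma> n)"
      "k \<le> cols j n + of_bool (\<not> d)"
      using continue_in[OF j(1) u] anc u by auto
    ultimately have "walk E C (cols 0 i + (0 + k)) (i + (m + l)) (\<sigma> 0) t"
      by (blast intro: walk_trans)
    from no_cheaper_walk[OF this] t finish have "cols 0 n \<le> cols 0 i + k" by auto
    moreover have "cols 0 n = cols 0 i + 1 + cols (Suc i) j + cols j n"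
      using cols_split[of 0 i n] cols_split[of i "Suc i" n] cols_split[of "Suc i" j n] c1 True j(1) by
          simp
    ultimately have "\<not> d \<and> cols (Suc i) j = 0"
      using t(3) by (cases d; simp only: simp_thms of_bool_eq; linarith)
    with walk0_out[OF subwalk[of "Suc i" j]] True j u w have "(u, w) \<in> E\<^sup>*" by simp
    with wv nocycle show False by (meson rtrancl_into_rtrancl)
  next
    case False
    then have ji: "j < i" using \<open>i \<noteq> j\<close> by simp
    have "v \<notin> C" using chain' by (auto dest: tranclD)
    then have st: "step E C (v, False) (\<sigma> (Suc i))" using wv w by (simp add: step_def)
    have sj: "step E C (u, d) (\<sigma> (Suc j))" using steps[of j] ji iN u by simp
    have "if d then u \<in> ancestors E C else u \<notin> C"
      using anc u sj by (cases d; auto simp: step_def split: if_splits)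
    from walk_up[OF chain' this] obtain m where "walk E C (of_bool d) m (\<sigma> j) (v, False)" using u by auto
    moreover have "walk E C (cols 0 j) j (\<sigma> 0) (\<sigma> j)" using subwalk[of 0 j] j by simp
    moreover have "walk E C 0 (Suc 0) (v, False) (\<sigma> (Suc i))" using walk_single[OF st] by simp
    moreover have "walk E C (cols (Suc i) n) (n - Suc i) (\<sigma> (Suc i)) (\<sigma> n)" using subwalk iN by simp
    ultimately have "walk E C (cols 0 j + (of_bool d + (0 + cols (Suc i) n))) (j + (m + (Suc 0 + (n -
        Suc i)))) (\<sigma> 0) (\<sigma> n)"
      by (blast intro: walk_trans)
    from no_cheaper_walk[OF this] finish have "cols 0 n \<le> cols 0 j + of_bool d + cols (Suc i) n" by auto
    moreover have "cols 0 n = cols 0 j + cols j i + 1 + cols (Suc i) n"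
      using cols_split[of 0 j n] cols_split[of j i n] cols_split[of i "Suc i" n] c1 ji iN by simp
    ultimately have "d \<and> cols j i = 0"
      by (cases d; simp only: simp_thms of_bool_eq; linarith)
    with walk0_in[OF subwalk[of j i]] ji iN u v have "(u, v) \<in> E\<^sup>*" by simp
    with nocycle show False ..
  qed
qed

end

section \<open>Walks and d-separation\<close>

context minimal_walk
begin

lemma edge_cases:
  assumes "i < n"
  shows "if snd (\<sigma> (Suc i)) then (fst (\<sigma> i), fst (\<sigma> (Suc i))) \<in> E else (fst (\<sigma> (Suc i)), fst (\<sigma> i)) \<in> E"
  using steps[OF assms] by (simp add: step_def split: if_splits)

lemma antisym: "(x, y) \<in> E \<Longrightarrow> (y, x) \<notin> E"
  using acyclic unfolding acyclic_def by (blast intro: trancl_trans)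

lemma edge_forward: "i < n \<Longrightarrow> (fst (\<sigma> i), fst (\<sigma> (Suc i))) \<in> E \<longleftrightarrow> snd (\<sigma> (Suc i))"
  and edge_backward: "i < n \<Longrightarrow> (fst (\<sigma> (Suc i)), fst (\<sigma> i)) \<in> E \<longleftrightarrow> \<not> snd (\<sigma> (Suc i))"
  using edge_cases[of i] antisym by (auto split: if_splits)

lemma collider_pos: "collider i \<Longrightarrow> 0 < i"
  using start by (cases i) (auto simp: collider_def)

lemma collider_ancestor: "collider i \<Longrightarrow> fst (\<sigma> i) \<in> ancestors E C"
  using steps[of i] by (simp add: collider_def step_def)

lemma noncollider_notin: "i \<le> n \<Longrightarrow> \<not> collider i \<Longrightarrow> fst (\<sigma> i) \<notin> C"
  using steps[of i] finish by (cases "i = n") (auto simp: collider_def step_def split: if_splits)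

lemma not_d_separated:
  assumes "E \<subseteq> V \<times> V" "A \<subseteq> V"
  shows "\<not> d_separated V E A B C"
proof -
  define p where "p = map (\<lambda>i. fst (\<sigma> i)) [0..<Suc n]"
  have len: "length p = Suc n" and nth: "\<And>i. i \<le> n \<Longrightarrow> p ! i = fst (\<sigma> i)"
    by (simp_all add: p_def del: upt_Suc)
  have inV: "fst (\<sigma> i) \<in> V" if "i \<le> n" for i
    using that
  proof (cases i)
    case 0
    then show ?thesis using start assms by auto
  next
    case (Suc j)
    then show ?thesis using edge_cases[of j] assms that by (auto split: if_splits)
  qed
  have col: "collider_at E p i \<longleftrightarrow> collider i" if "i \<le> n" for i
  proof (cases "0 < i \<and> i < n")
    case True
    then obtain j where "i = Suc j" by (cases i) auto
    with True show ?thesis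
      using edge_forward[of j] edge_backward[of i]
      by (simp add: collider_at_def collider_def len nth)
  next
    case False
    then show ?thesis using collider_pos[of i] by (auto simp: collider_at_def collider_def len)
  qed
  have "dag_path V E p"
    unfolding dag_path_def
  proof (intro conjI allI impI)
    show "p \<noteq> []" using len by auto
    show "set p \<subseteq> V" using inV by (auto simp: p_def)
    show "distinct p"
      using vertices_distinct by (simp add: p_def distinct_map inj_on_def del: upt_Suc)
    show "(p ! i, p ! Suc i) \<in> E \<or> (p ! Suc i, p ! i) \<in> E" if "Suc i < length p" for i
      using that edge_cases[of i] by (auto simp: len nth split: if_splits)
  qed
  moreover have "p \<noteq> []" using len by auto
  then have "hd p \<in> A" "last p \<in> B"
    using start finish len nth by (simp_all add: hd_conv_nth last_conv_nth)
  moreover have "\<not> path_blocked E C p"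
  proof
    assume "path_blocked E C p"
    then obtain i where i: "i \<le> n"
      "collider_at E p i \<and> p ! i \<notin> ancestors E C \<or> \<not> collider_at E p i \<and> p ! i \<in> C"
      unfolding path_blocked_def len by (auto simp: less_Suc_eq_le)
    then show False using collider_ancestor[of i] noncollider_notin[of i] by (auto simp: col nth)
  qed
  ultimately show ?thesis unfolding d_separated_def by blast
qed

end

lemma connected_walk_not_d_separated:
  assumes "dag V E" "A \<subseteq> V" "a \<in> A - C" "b \<in> B - C" "walk E C k l (a, False) (b, d)"
  shows "\<not> d_separated V E A B C"
proof -
  obtain \<sigma> n where "minimal_walk E A B C \<sigma> n"
    using minimal_walk_exists[OF _ assms(3,4,5)] assms(1) by (auto simp: dag_def)
  then interpret minimal_walk E A B C \<sigma> n .
  show ?thesis using not_d_separated assms by (simp add: dag_def)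
qed

lemma not_d_separated_minimal_walk:
  assumes "dag V E" "\<not> d_separated V E A B C"
  shows "\<exists>\<sigma> n. minimal_walk E A B C \<sigma> n"
proof -
  have acyclic: "acyclic E" using assms by (simp add: dag_def)
  then have asym: "(y, x) \<notin> E" if "(x, y) \<in> E" for x y
    using that unfolding acyclic_def by (blast intro: trancl_trans)
  obtain p where p: "dag_path V E p" "hd p \<in> A" "last p \<in> B" "\<not> path_blocked E C p"
    using assms(2) unfolding d_separated_def by blast
  then obtain n where n: "length p = Suc n" by (cases p) (auto simp: dag_path_def)
  define \<sigma> where "\<sigma> i = (p ! i, 0 < i \<and> (p ! (i - 1), p ! i) \<in> E)" for i
  have act: "collider_at E p i \<Longrightarrow> p ! i \<in> ancestors E C" "\<not> collider_at E p i \<Longrightarrow> p ! i \<notin> C"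
    if "i \<le> n" for i
    using p(4) that unfolding path_blocked_def n by (auto simp: less_Suc_eq_le)
  have st: "step E C (\<sigma> i) (\<sigma> (Suc i))" if i: "i < n" for i
  proof -
    have adj: "(p ! i, p ! Suc i) \<in> E \<or> (p ! Suc i, p ! i) \<in> E"
      using p(1) i n by (auto simp: dag_path_def)
    show ?thesis
    proof (cases "(p ! i, p ! Suc i) \<in> E")
      case True
      then have "\<not> collider_at E p i" using asym by (auto simp: collider_at_def)
      with act[of i] True i show ?thesis by (simp add: step_def \<sigma>_def)
    next
      case False
      with adj have e: "(p ! Suc i, p ! i) \<in> E" by simp
      have "collider_at E p i \<longleftrightarrow> snd (\<sigma> i)" using e i n by (auto simp: collider_at_def \<sigma>_def)
      with act[of i] e False i show ?thesis by (auto simp: step_def \<sigma>_def)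
    qed
  qed
  have w: "walk E C (\<Sum>l\<in>{0..<0 + n}. of_bool (snd (\<sigma> l) \<and> \<not> snd (\<sigma> (Suc l)))) n (\<sigma> 0) (\<sigma> (0 + n))"
    using st by (intro sequence_walk) auto
  have "p \<noteq> []" using p by (simp add: dag_path_def)
  then have "p ! 0 \<in> A" "p ! n \<in> B" using p(2,3) n by (simp_all add: hd_conv_nth last_conv_nth)
  moreover have "p ! 0 \<notin> C" "p ! n \<notin> C"
    using act[of 0] act[of n] n by (auto simp: collider_at_def)
  moreover have "walk E C (\<Sum>l\<in>{0..<0 + n}. of_bool (snd (\<sigma> l) \<and> \<not> snd (\<sigma> (Suc l)))) n
      (p ! 0, False) (p ! n, 0 < n \<and> (p ! (n - 1), p ! n) \<in> E)"
    using w by (simp add: \<sigma>_def)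
  ultimately show ?thesis using minimal_walk_exists[OF acyclic] by blast
qed

lemma avoiding_of_not_ancestor:
  assumes "(v, w) \<in> E\<^sup>*" "v \<notin> ancestors E C"
  shows "(v, w) \<in> (avoiding E C)\<^sup>* \<and> w \<notin> C"
  using assms
proof (induction rule: converse_rtrancl_induct)
  case base
  then show ?case using ancestors_self[of w C E] by auto
next
  case (step y z)
  then have "z \<notin> ancestors E C" "y \<notin> C" 
    using ancestors_edge[of y z E C] ancestors_self[of y C E] by auto
  with step show ?case by (auto intro: converse_rtrancl_into_rtrancl)
qed

text \<open>The set \<open>R\<close> consists of the vertices that active walks from \<open>A\<close> reach. If such a walk meets one vertex of
a family, it can move on to the others: through \<open>v\<close> as a non-collider, or as a collider if \<open>v\<close> is an
ancestor of \<open>C\<close>. Otherwise \<open>v\<close> has a descendant in \<open>A\<close> or \<open>B\<close>. If it lies in \<open>A\<close>, a new walk starts there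
and climbs up to \<open>v\<close>; if it lies in \<open>B\<close>, the old walk descends to it, against the separation.\<close>

lemma d_separated_split:
  assumes dag: "dag V E" and sub: "A \<subseteq> V" "B \<subseteq> V" "C \<subseteq> V" and sep: "d_separated V E A B C"
  obtains R where "A \<subseteq> R \<union> C" "R \<inter> C = {}" "B \<inter> R = {}"
    "\<And>v. v \<in> ancestors E (A \<union> B \<union> C) \<Longrightarrow>
      family E v \<subseteq> R \<union> C \<or> family E v \<inter> R = {}"
proof -
  define reach where "reach w d \<longleftrightarrow> (\<exists>a\<in>A - C. \<exists>k l. walk E C k l (a, False) (w, d))" for w d
  define R where "R = {w. w \<notin> C \<and> (\<exists>d. reach w d)}"
  have ext: "reach w' d'" if "reach w d" "step E C (w, d) (w', d')" for w d w' d'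
    using that walk_trans[OF _ walk_single[OF that(2)]] unfolding reach_def by blast
  have start: "reach a False" if "a \<in> A - C" for a
    using that walk_refl unfolding reach_def by blast
  have not_B: "b \<notin> B" if "reach b d" "b \<notin> C" for b d
    using connected_walk_not_d_separated[OF dag sub(1)] that sep unfolding reach_def by blast
  have parent: "reach w' False" if v: "reach v d" "v \<in> ancestors E (A \<union> B \<union> C)"
    and ok: "d \<or> v \<notin> C" and w': "(w', v) \<in> E" for v d w'
  proof (cases "d \<and> v \<notin> ancestors E C")
    case False
    with ok have "step E C (v, d) (w', False)"
      using w' by (auto simp: step_def)
    with v show ?thesis by (blast intro: ext)
  next
    case True
    then have d: "d" and va: "v \<notin> ancestors E C" by auto
    with v(2) obtain x where x: "x \<in> A \<union> B" "(v, x) \<in> E\<^sup>*"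
      unfolding ancestors_def by blast
    have av: "(v, x) \<in> (avoiding E C)\<^sup>*" "x \<notin> C"
      using avoiding_of_not_ancestor[OF x(2) va] by auto
    obtain m where "walk E C 0 m (v, True) (x, True)" using walk_down[OF av(1)] by blast
    with v(1) d have "reach x True" unfolding reach_def using walk_trans by fastforce
    then have "x \<in> A - C" using not_B[of x True] av x by auto
    have "reach v False"
    proof (cases "v = x")
      case True
      then show ?thesis using start \<open>x \<in> A - C\<close> by simp
    next
      case False
      with av have "(v, x) \<in> (avoiding E C)\<^sup>+" by (simp add: rtrancl_eq_or_trancl)
      from walk_up[OF this, of False] av obtain m where "walk E C 0 m (x, False) (v, False)" by auto
      with \<open>x \<in> A - C\<close> show ?thesis unfolding reach_def by blast
    qed
    moreover have "v \<notin> C" using va ancestors_self[of v C E] by auto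
    then have "step E C (v, False) (w', False)" using w' by (simp add: step_def)
    ultimately show ?thesis by (rule ext)
  qed
  have child: "reach v True" if w: "w \<in> R" "(w, v) \<in> E" for v w
  proof -
    obtain d where "reach w d" "w \<notin> C" using w unfolding R_def by blast
    moreover from this w have "step E C (w, d) (v, True)" by (simp add: step_def)
    ultimately show ?thesis by (blast intro: ext)
  qed
  show ?thesis
  proof
    show "A \<subseteq> R \<union> C" using start unfolding R_def by blast
    show "R \<inter> C = {}" unfolding R_def by blast
    show "B \<inter> R = {}" using not_B unfolding R_def by blast
    fix v assume v: "v \<in> ancestors E (A \<union> B \<union> C)"
    have "family E v \<subseteq> R \<union> C" if "family E v \<inter> R \<noteq> {}"
    proof -
      obtain d where d: "reach v d" "d \<or> v \<notin> C"
      proof (cases "v \<in> R")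
        case True
        then show ?thesis using that unfolding R_def by blast
      next
        case False
        then obtain w where "w \<in> R" "(w, v) \<in> E" using \<open>family E v \<inter> R \<noteq> {}\<close> by (auto simp: pa_def)
        then show ?thesis using child that by blast
      qed
      then show ?thesis using parent[OF d(1) v d(2)] unfolding R_def pa_def by blast
    qed
    then show "family E v \<subseteq> R \<union> C \<or> family E v \<inter> R = {}" by blast
  qed
qed

section \<open>Parity relations along a minimal walk\<close>

context minimal_walk
begin

definition toward :: "'v \<Rightarrow> 'v" where
  "toward x = (SOME y. (x, y) \<in> E \<and> y \<in> ancestors E C)"

text \<open>The directed paths from the colliders to \<open>C\<close>, without their end points in \<open>C\<close>. The choice of the next
vertex depends on the current one only, so paths that meet merge, and every vertex has one successor.\<close>

inductive_set descent where
  descent_collider: "collider i \<Longrightarrow> fst (\<sigma> i) \<notin> C \<Longrightarrow> fst (\<sigma> i) \<in> descent"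
| descent_toward: "x \<in> descent \<Longrightarrow> toward x \<notin> C \<Longrightarrow> toward x \<in> descent"

lemma toward:
  assumes "x \<in> ancestors E C" "x \<notin> C"
  shows "(x, toward x) \<in> E" "toward x \<in> ancestors E C"
proof -
  obtain c where "(x, c) \<in> E\<^sup>*" "c \<in> C" using assms unfolding ancestors_def by blast
  then obtain y where "(x, y) \<in> E" "(y, c) \<in> E\<^sup>*"
    using assms by (metis converse_rtranclE)
  with \<open>c \<in> C\<close> have "\<exists>y. (x, y) \<in> E \<and> y \<in> ancestors E C" unfolding ancestors_def by blast
  from someI_ex[OF this] show "(x, toward x) \<in> E" "toward x \<in> ancestors E C"
    unfolding toward_def by blast+
qed

lemma descent:
  assumes "x \<in> descent"
  shows "x \<notin> C \<and> x \<in> ancestors E C \<and> (\<exists>i. collider i \<and> (fst (\<sigma> i), x) \<in> (avoiding E C)\<^sup>*)"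
  using assms
proof induction
  case (descent_collider i)
  then show ?case using collider_ancestor by blast
next
  case (descent_toward x)
  then have "(x, toward x) \<in> avoiding E C" "toward x \<in> ancestors E C" using toward[of x] by auto
  with descent_toward show ?case by (blast intro: rtrancl_into_rtrancl)
qed

definition noncolliders :: "'v set" where
  "noncolliders = {fst (\<sigma> i) | i. i \<le> n \<and> \<not> collider i}"

lemma descent_not_noncolliders: "x \<in> descent \<Longrightarrow> x \<notin> noncolliders"
  using descent[of x] chain_avoids unfolding noncolliders_def by blast

definition path_parents :: "'v \<Rightarrow> 'v set" where
  "path_parents v = {w. \<exists>i<n. (w = fst (\<sigma> i) \<and> v = fst (\<sigma> (Suc i)) \<and> snd (\<sigma> (Suc i))) \<or>
     (w = fst (\<sigma> (Suc i)) \<and> v = fst (\<sigma> i) \<and> \<not> snd (\<sigma> (Suc i)))}"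

text \<open>The vertices whose signs are to multiply to the sign of \<open>v\<close>.\<close>

definition parity_parents :: "'v \<Rightarrow> 'v set" where
  "parity_parents v = path_parents v \<union> {d \<in> descent. toward d = v}"

lemma vertex_eq: "i \<le> n \<Longrightarrow> j \<le> n \<Longrightarrow> fst (\<sigma> i) = fst (\<sigma> j) \<longleftrightarrow> i = j"
  using vertices_distinct unfolding inj_on_def by auto

lemma path_parents_at:
  assumes "i \<le> n"
  shows "path_parents (fst (\<sigma> i)) = (if snd (\<sigma> i) then {fst (\<sigma> (i - 1))} else {}) \<union>
    (if i < n \<and> \<not> snd (\<sigma> (Suc i)) then {fst (\<sigma> (Suc i))} else {})" (is "_ = ?R")
proof (intro set_eqI iffI)
  fix w assume "w \<in> path_parents (fst (\<sigma> i))"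
  then show "w \<in> ?R" using assms vertex_eq unfolding path_parents_def by fastforce
next
  fix w assume w: "w \<in> ?R"
  show "w \<in> path_parents (fst (\<sigma> i))"
  proof (cases "snd (\<sigma> i) \<and> w = fst (\<sigma> (i - 1))")
    case True
    then have "i \<noteq> 0" using start by (metis)
    with True assms show ?thesis unfolding path_parents_def
      by (intro CollectI exI[of _ "i - 1"]) auto
  next
    case False
    with w show ?thesis unfolding path_parents_def by (auto split: if_splits)
  qed
qed

lemma path_children_at:
  assumes "i \<le> n"
  shows "{v. fst (\<sigma> i) \<in> path_parents v} = (if 0 < i \<and> \<not> snd (\<sigma> i) then {fst (\<sigma> (i - 1))} else {}) \<union>
    (if i < n \<and> snd (\<sigma> (Suc i)) then {fst (\<sigma> (Suc i))} else {})" (is "_ = ?R")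
proof (intro set_eqI iffI)
  fix w assume "w \<in> {v. fst (\<sigma> i) \<in> path_parents v}"
  then show "w \<in> ?R" using assms vertex_eq unfolding path_parents_def by fastforce
next
  fix w assume w: "w \<in> ?R"
  have "fst (\<sigma> i) \<in> path_parents w"
  proof (cases "0 < i \<and> \<not> snd (\<sigma> i) \<and> w = fst (\<sigma> (i - 1))")
    case True
    with assms show ?thesis unfolding path_parents_def
      by (intro CollectI exI[of _ "i - 1"]) auto
  next
    case False
    with w show ?thesis unfolding path_parents_def by (auto split: if_splits)
  qed
  then show "w \<in> {v. fst (\<sigma> i) \<in> path_parents v}" by simp
qed

lemma path_parents_vertex:
  assumes "w \<in> path_parents v"
  shows "\<exists>i\<le>n. v = fst (\<sigma> i)"
proof -
  obtain i where "i < n" "v = fst (\<sigma> (Suc i)) \<or> v = fst (\<sigma> i)"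
    using assms unfolding path_parents_def by blast
  then show ?thesis using less_imp_le[of i n] Suc_leI[of i n] by blast
qed

lemma path_parents_noncolliders: "path_parents v \<subseteq> noncolliders"
proof
  fix w assume "w \<in> path_parents v"
  then obtain i where i: "i < n"
    "(w = fst (\<sigma> i) \<and> snd (\<sigma> (Suc i))) \<or> (w = fst (\<sigma> (Suc i)) \<and> \<not> snd (\<sigma> (Suc i)))"
    unfolding path_parents_def by blast
  then have "(w = fst (\<sigma> i) \<and> \<not> collider i) \<or> (w = fst (\<sigma> (Suc i)) \<and> \<not> collider (Suc i))"
    by (auto simp: collider_def)
  with i(1) show "w \<in> noncolliders" using less_imp_le[of i n] Suc_leI[of i n] unfolding
      noncolliders_def by blast
qed

lemma path_parents_edge: "w \<in> path_parents v \<Longrightarrow> (w, v) \<in> E"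
  unfolding path_parents_def using edge_forward edge_backward by blast

lemma noncolliders_notin: "noncolliders \<inter> C = {}"
  using noncollider_notin unfolding noncolliders_def by blast

lemma toward_descent: "d \<in> descent \<Longrightarrow> toward d \<in> C \<or> toward d \<in> descent"
  using descent_toward by blast

lemma parity_parents_pa: "parity_parents v \<subseteq> pa E v"
  using path_parents_edge toward(1) descent unfolding parity_parents_def pa_def by blast

text \<open>Of the flipped vertices, the relation of a collider contains its two neighbours on the walk, that of a
non-collider the vertex itself and one neighbour; vertices on the descents lie off the flipped set by \<open>chain_avoids\<close>.\<close>

lemma parity_even:
  assumes "parity_parents v \<noteq> {}"
  shows "even (card (noncolliders \<inter> insert v (parity_parents v)))"
proof -
  have eq: "noncolliders \<inter> insert v (parity_parents v) = (noncolliders \<inter> {v}) \<union> path_parents v"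
    using path_parents_noncolliders descent_not_noncolliders unfolding parity_parents_def by blast
  show ?thesis
  proof (cases "\<exists>i\<le>n. v = fst (\<sigma> i)")
    case False
    then have "path_parents v = {}" "noncolliders \<inter> {v} = {}"
      using path_parents_vertex unfolding noncolliders_def by blast+
    then show ?thesis by (simp add: eq)
  next
    case True
    then obtain i where i: "i \<le> n" "v = fst (\<sigma> i)" by blast
    show ?thesis
    proof (cases "collider i")
      case True
      then have "v \<notin> noncolliders" using i vertex_eq unfolding noncolliders_def by auto
      moreover have "path_parents v = {fst (\<sigma> (i - 1)), fst (\<sigma> (Suc i))}"
        using path_parents_at[OF i(1)] True i by (auto simp: collider_def)
      moreover have "fst (\<sigma> (i - 1)) \<noteq> fst (\<sigma> (Suc i))"
        proof -
        have "i < n" using True by (simp add: collider_def)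
        then have "i - 1 \<le> n" "Suc i \<le> n" "i - 1 \<noteq> Suc i" by arith+
        then show ?thesis by (simp only: vertex_eq not_False_eq_True)
      qed
      ultimately show ?thesis by (simp add: eq)
    next
      case False
      then have v: "v \<in> noncolliders" using i unfolding noncolliders_def by blast
      then have "v \<notin> C" "v \<notin> descent" using noncolliders_notin descent_not_noncolliders by blast+
      then have "parity_parents v = path_parents v"
        using toward_descent unfolding parity_parents_def by blast
      with assms have "path_parents v \<noteq> {}" by simp
      then obtain x where x: "path_parents v = {x}"
        using path_parents_at[OF i(1)] False i(2) by (auto simp: collider_def split: if_splits)
      moreover have "x \<noteq> v" using path_parents_edge[of x v] x antisym by blast
      ultimately show ?thesis using v by (simp add: eq)
    qed
  qed
qed

text \<open>The number counts the relations that contain \<open>w\<close>, and \<open>w\<close> being an end point. A non-collider has a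
relation for each of its walk edges, and an end point has one edge less. A vertex on a descent occurs in
its own relation and in that of its successor.\<close>

lemma parity_degree:
  assumes "E \<subseteq> V \<times> V" "w \<in> V - C"
  shows "even (of_bool (parity_parents w \<noteq> {}) + card {v \<in> V. w \<in> parity_parents v} +
    of_bool (w = fst (\<sigma> 0)) + of_bool (w = fst (\<sigma> n)) :: nat)"
proof -
  have children: "{v \<in> V. w \<in> parity_parents v} =
      {v. w \<in> path_parents v} \<union> (if w \<in> descent then {toward w} else {})"
    using assms(1) path_parents_edge toward(1) descent unfolding parity_parents_def
    by (auto; blast)
  have nc: "\<not> collider 0" "\<not> collider n"
    using collider_pos by (blast, simp add: collider_def)
  show ?thesis
  proof (cases "w \<in> descent")
    case True
    then have "w \<notin> noncolliders" by (rule descent_not_noncolliders)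
    then have "{v. w \<in> path_parents v} = {}" using path_parents_noncolliders by blast
    moreover have "w \<noteq> fst (\<sigma> 0)" "w \<noteq> fst (\<sigma> n)"
      using \<open>w \<notin> noncolliders\<close> nc unfolding noncolliders_def by auto
    moreover have "parity_parents w \<noteq> {}"
      using True
    proof cases
      case (descent_collider i)
      then have "path_parents w \<noteq> {}" using path_parents_at[of i] by (auto simp: collider_def)
      then show ?thesis unfolding parity_parents_def by blast
    next
      case (descent_toward x)
      then show ?thesis unfolding parity_parents_def by blast
    qed
    ultimately show ?thesis using True by (simp add: children)
  next
    case nd: False
    have pp: "parity_parents w = path_parents w"
      using toward_descent nd assms(2) unfolding parity_parents_def by blast
    show ?thesis
    proof (cases "w \<in> noncolliders")
      case True
      then obtain i where i: "i \<le> n" "w = fst (\<sigma> i)" "\<not> collider i" unfolding noncolliders_def by blast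
      have ne: "fst (\<sigma> (i - 1)) \<noteq> fst (\<sigma> (Suc i))" if "i < n"
        proof -
        have "i - 1 \<le> n" "Suc i \<le> n" "i - 1 \<noteq> Suc i" using that by arith+
        then show ?thesis by (simp only: vertex_eq not_False_eq_True)
      qed
      have e: "w = fst (\<sigma> 0) \<longleftrightarrow> i = 0" "w = fst (\<sigma> n) \<longleftrightarrow> i = n"
        using i vertex_eq[of i 0] vertex_eq[of i n] by auto
      have deg: "card {v \<in> V. w \<in> parity_parents v} =
          of_bool (0 < i \<and> \<not> snd (\<sigma> i)) + of_bool (i < n \<and> snd (\<sigma> (Suc i)))"
      proof -
        have "{v \<in> V. w \<in> parity_parents v} = {v. fst (\<sigma> i) \<in> path_parents v}"
          using nd by (simp add: children i(2)[symmetric])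
        then show ?thesis using path_children_at[OF i(1)] ne by auto
      qed
      have par: "parity_parents w \<noteq> {} \<longleftrightarrow> snd (\<sigma> i) \<or> (i < n \<and> \<not> snd (\<sigma> (Suc i)))"
        using path_parents_at[OF i(1)] by (simp add: i(2)[symmetric] pp)
      have "i = 0 \<longrightarrow> \<not> snd (\<sigma> i)" "i = n \<or> i < n" "\<not> (i < n \<and> snd (\<sigma> i) \<and> \<not> snd (\<sigma> (Suc i)))"
        using start i by (auto simp: collider_def)
      then show ?thesis unfolding deg par e
        by (cases "i = 0"; cases "i = n"; cases "snd (\<sigma> i)"; cases "snd (\<sigma> (Suc i))"; simp)
    next
      case False
      have "\<not> (\<exists>i\<le>n. w = fst (\<sigma> i))"
        using False nd assms(2) descent_collider unfolding noncolliders_def by blast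
      then have "path_parents w = {}" using path_parents_vertex by blast
      moreover have "{v. w \<in> path_parents v} = {}" using False path_parents_noncolliders by blast
      moreover have "w \<noteq> fst (\<sigma> 0)" "w \<noteq> fst (\<sigma> n)"
        using False nc unfolding noncolliders_def by auto
      ultimately show ?thesis using nd by (simp add: children pp)
    qed
  qed
qed

end

lemma parity_structure:
  assumes "dag V E" "\<not> d_separated V E A B C"
  obtains a b S F where "a \<in> A" "b \<in> B" "a \<in> F" "F \<inter> C = {}"
    "\<And>v. S v \<subseteq> pa E v"
    "\<And>v. S v \<noteq> {} \<Longrightarrow> even (card (F \<inter> insert v (S v)))"
    "\<And>w. w \<in> V - C \<Longrightarrow> even (of_bool (S w \<noteq> {}) + card {v \<in> V. w \<in> S v} +
      of_bool (w = a) + of_bool (w = b) :: nat)"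
proof -
  obtain \<sigma> n where "minimal_walk E A B C \<sigma> n"
    using not_d_separated_minimal_walk[OF assms] by blast
  then interpret minimal_walk E A B C \<sigma> n .
  have "\<not> collider 0" using collider_pos by blast
  then have "fst (\<sigma> 0) \<in> noncolliders" unfolding noncolliders_def by blast
  with start finish noncolliders_notin parity_parents_pa parity_even parity_degree[of V] assms(1)
  show ?thesis by (intro that[of "fst (\<sigma> 0)" "fst (\<sigma> n)" noncolliders parity_parents]) (auto simp:
      dag_def)
qed

section \<open>Integrating out coordinates of a product measure\<close>

locale product_reference = prob_space \<nu> for \<nu> :: "real measure" +
  fixes V :: "'v set"
  assumes finite_V: "finite V" and sets_nu [simp, measurable_cong]: "sets \<nu> = sets borel"
begin

lemma space_nu [simp]: "space \<nu> = UNIV"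
  using sets_eq_imp_space_eq[OF sets_nu] by simp

lemma emeasure_nu_UNIV [simp]: "emeasure \<nu> UNIV = 1"
  using emeasure_space_1 by simp

definition M :: "('v \<Rightarrow> real) measure" where
  "M = (\<Pi>\<^sub>M i\<in>V. \<nu>)"

sublocale product_prob_space "\<lambda>_. \<nu>" V
  by unfold_locales

sublocale M: prob_space M
  unfolding M_def by (rule prob_space_PiM) unfold_locales

lemma sets_M: "sets M = sets (Xsp V)"
  unfolding M_def by (rule sets_PiM_cong) auto

lemma measurable_M: "measurable M N = measurable (Xsp V) N"
  by (rule measurable_cong_sets[OF sets_M refl])

lemma space_M: "space M = extensional V"
  unfolding M_def space_PiM by (simp add: PiE_UNIV_domain PiE_def)

text \<open>Resampling the coordinates in \<open>D\<close>. Keeping the dimension fixed, instead of passing to the product over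
\<open>V - D\<close>, lets averages over different sets be composed and multiplied on one space.\<close>

definition mix :: "'v set \<Rightarrow> ('v \<Rightarrow> real) \<Rightarrow> ('v \<Rightarrow> real) \<Rightarrow> 'v \<Rightarrow> real" where
  "mix D x y = (\<lambda>i\<in>V. if i \<in> D then y i else x i)"

lemma mix_in [simp]: "mix D x y \<in> space M"
  by (simp add: mix_def space_M)

lemma component_M [measurable]: "i \<in> V \<Longrightarrow> (\<lambda>x. x i) \<in> borel_measurable M"
  unfolding M_def by (rule measurable_component_singleton[of i V "\<lambda>_. \<nu>", unfolded
      measurable_cong_sets[OF refl sets_nu]])

lemma measurable_mix: "(\<lambda>z. mix D (fst z) (snd z)) \<in> M \<Otimes>\<^sub>M M \<rightarrow>\<^sub>M M"
proof -
  have "(\<lambda>z. if i \<in> D then snd z i else fst z i) \<in> M \<Otimes>\<^sub>M M \<rightarrow>\<^sub>M \<nu>" if "i \<in> V" for i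
    using measurable_compose[OF measurable_fst component_M[OF that]]
      measurable_compose[OF measurable_snd component_M[OF that]]
    by (cases "i \<in> D") (simp_all add: measurable_cong_sets[OF refl sets_nu])
  then show ?thesis unfolding mix_def M_def by (intro measurable_restrict) auto
qed

lemma measurable_mix1 [measurable]: "x \<in> space M \<Longrightarrow> mix D x \<in> M \<rightarrow>\<^sub>M M"
  using measurable_compose[OF measurable_Pair1' measurable_mix[of D], of x] by simp

sublocale MM: pair_prob_space M M ..

lemma distr_mix: "distr (M \<Otimes>\<^sub>M M) M (\<lambda>z. mix D (fst z) (snd z)) = M"
proof -
  have "distr (M \<Otimes>\<^sub>M M) M (\<lambda>z. mix D (fst z) (snd z)) = (\<Pi>\<^sub>M i\<in>V. \<nu>)"
  proof (rule PiM_eqI)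
    show "sets (distr (M \<Otimes>\<^sub>M M) M (\<lambda>z. mix D (fst z) (snd z))) = sets (\<Pi>\<^sub>M i\<in>V. \<nu>)"
      by (simp add: M_def)
    fix A :: "'v \<Rightarrow> real set" assume A: "\<And>i. i \<in> V \<Longrightarrow> A i \<in> sets \<nu>"
    let ?B = "\<Pi>\<^sub>E i\<in>V. if i \<in> D then UNIV else A i" and ?B' = "\<Pi>\<^sub>E i\<in>V. if i \<in> D then A i else UNIV"
    have sB: "?B \<in> sets M" "?B' \<in> sets M"
      unfolding M_def using A finite_V by (auto intro!: sets_PiM_I_finite)
    have "(\<lambda>z. mix D (fst z) (snd z)) -` Pi\<^sub>E V A \<inter> space (M \<Otimes>\<^sub>M M) = ?B \<times> ?B'"
      by (auto simp: mix_def space_pair_measure space_M PiE_iff extensional_def split: if_splits)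
    then have "emeasure (distr (M \<Otimes>\<^sub>M M) M (\<lambda>z. mix D (fst z) (snd z))) (Pi\<^sub>E V A) = emeasure (M \<Otimes>\<^sub>M
        M) (?B \<times> ?B')"
      using A finite_V by (subst emeasure_distr[OF measurable_mix]) (auto simp: M_def intro!:
          sets_PiM_I_finite)
    also have "\<dots> = emeasure M ?B * emeasure M ?B'"
      using sB by (simp add: M.emeasure_pair_measure_Times)
    also have "emeasure M ?B = (\<Prod>i\<in>V. emeasure \<nu> (if i \<in> D then UNIV else A i))"
      unfolding M_def using A finite_V by (intro emeasure_PiM) auto
    also have "emeasure M ?B' = (\<Prod>i\<in>V. emeasure \<nu> (if i \<in> D then A i else UNIV))"
      unfolding M_def using A finite_V by (intro emeasure_PiM) auto
    also have "(\<Prod>i\<in>V. emeasure \<nu> (if i \<in> D then UNIV else A i)) * \<dots> = (\<Prod>i\<in>V. emeasure \<nu> (A i))"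
      by (simp add: prod.distrib[symmetric]) (intro prod.cong, auto)
    finally show "emeasure (distr (M \<Otimes>\<^sub>M M) M (\<lambda>z. mix D (fst z) (snd z))) (Pi\<^sub>E V A) = (\<Prod>i\<in>V.
        emeasure \<nu> (A i))" .
  qed (fact finite_V)
  then show ?thesis by (simp add: M_def)
qed

definition avg :: "'v set \<Rightarrow> (('v \<Rightarrow> real) \<Rightarrow> ennreal) \<Rightarrow> ('v \<Rightarrow> real) \<Rightarrow> ennreal" where
  "avg D u x = (\<integral>\<^sup>+ y. u (mix D x y) \<partial>M)"

lemma measurable_avg [measurable]:
  assumes u: "u \<in> borel_measurable M"
  shows "avg D u \<in> borel_measurable M"
  unfolding avg_def
  using measurable_compose[OF measurable_mix[of D] u]
  by (intro M.borel_measurable_nn_integral) (simp add: case_prod_beta')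

lemma nn_integral_avg:
  assumes u: "u \<in> borel_measurable M"
  shows "(\<integral>\<^sup>+ x. avg D u x \<partial>M) = (\<integral>\<^sup>+ x. u x \<partial>M)"
proof -
  have m: "(\<lambda>z. u (mix D (fst z) (snd z))) \<in> borel_measurable (M \<Otimes>\<^sub>M M)"
    using measurable_compose[OF measurable_mix[of D] u] .
  have "(\<integral>\<^sup>+ x. avg D u x \<partial>M) = (\<integral>\<^sup>+ z. u (mix D (fst z) (snd z)) \<partial>(M \<Otimes>\<^sub>M M))"
    unfolding avg_def using M.nn_integral_fst[OF m] by simp
  also have "\<dots> = (\<integral>\<^sup>+ x. u x \<partial>distr (M \<Otimes>\<^sub>M M) M (\<lambda>z. mix D (fst z) (snd z)))"
    using u by (intro nn_integral_distr[symmetric] measurable_mix) (simp add: distr_mix)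
  finally show ?thesis by (simp add: distr_mix)
qed

definition ignores :: "'v set \<Rightarrow> (('v \<Rightarrow> real) \<Rightarrow> 'b) \<Rightarrow> bool" where
  "ignores D u \<longleftrightarrow> (\<forall>x\<in>space M. \<forall>y\<in>space M. u (mix D x y) = u x)"

lemma ignoresD: "ignores D u \<Longrightarrow> x \<in> space M \<Longrightarrow> y \<in> space M \<Longrightarrow> u (mix D x y) = u x"
  by (simp add: ignores_def)

lemma mix_mix: "mix D' (mix D x y) z = mix (D \<union> D') x (mix D' y z)"
  and mix_swap: "mix D' (mix D x y) z = mix D (mix D' x z) (mix D' y z)"
  by (auto simp: mix_def)

lemma avg_pull:
  assumes "ignores D w" "u \<in> borel_measurable M" "x \<in> space M"
  shows "avg D (\<lambda>x. w x * u x) x = w x * avg D u x"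
proof -
  have "avg D (\<lambda>x. w x * u x) x = (\<integral>\<^sup>+ y. w x * u (mix D x y) \<partial>M)"
    unfolding avg_def using assms by (intro nn_integral_cong) (simp add: ignoresD)
  also have "\<dots> = w x * avg D u x"
    unfolding avg_def using assms(2,3) by (intro nn_integral_cmult) simp
  finally show ?thesis .
qed

lemma avg_avg:
  assumes u: "u \<in> borel_measurable M" and x: "x \<in> space M"
  shows "avg D (avg D' u) x = avg (D \<union> D') u x"
proof -
  have "avg D (avg D' u) x = (\<integral>\<^sup>+ y. avg D' (\<lambda>w. u (mix (D \<union> D') x w)) y \<partial>M)"
    unfolding avg_def by (simp add: mix_mix)
  also have "\<dots> = avg (D \<union> D') u x"
    using u x by (subst nn_integral_avg) (simp_all add: avg_def)
  finally show ?thesis .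
qed

lemma avg_ignores: "ignores D u \<Longrightarrow> x \<in> space M \<Longrightarrow> avg D u x = u x"
  using M.emeasure_space_1 by (simp add: avg_def ignoresD cong: nn_integral_cong)

lemma ignores_avg:
  assumes "ignores D u" shows "ignores D (avg D' u)"
  unfolding ignores_def avg_def
  by (intro ballI nn_integral_cong) (simp add: mix_swap[of D' D] ignoresD[OF assms])

lemma ignores_avg_self: "ignores D (avg D u)"
  unfolding ignores_def avg_def by (intro ballI nn_integral_cong arg_cong[of _ _ u]) (auto simp: mix_def)

lemma avg_cong: "(\<And>x. x \<in> space M \<Longrightarrow> u x = u' x) \<Longrightarrow> avg D u x = avg D u' x"
  unfolding avg_def by (intro nn_integral_cong) simp

lemma avg_mono: "(\<And>x. x \<in> space M \<Longrightarrow> u x \<le> u' x) \<Longrightarrow> avg D u x \<le> avg D u' x"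
  unfolding avg_def by (intro nn_integral_mono) simp

text \<open>Under a product measure, functions with disjoint sets of averaged coordinates are independent.\<close>

lemma avg_mult:
  assumes [measurable]: "u \<in> borel_measurable M" "v \<in> borel_measurable M"
    and ig: "ignores D' u" "ignores D v" and x: "x \<in> space M"
  shows "avg (D \<union> D') (\<lambda>x. u x * v x) x = avg (D \<union> D') u x * avg (D \<union> D') v x"
proof -
  have "avg (D \<union> D') (\<lambda>x. u x * v x) x = avg D (avg D' (\<lambda>x. u x * v x)) x"
    using x by (intro avg_avg[symmetric]) auto
  also have "\<dots> = avg D (\<lambda>x. avg D' v x * u x) x"
    by (intro avg_cong) (simp add: avg_pull[OF ig(1)] mult.commute)
  also have "\<dots> = avg D' v x * avg D u x"
    using x by (intro avg_pull ignores_avg ig) auto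
  also have "avg D u x = avg D (avg D' u) x"
    by (intro avg_cong) (simp add: avg_ignores ig)
  also have "\<dots> = avg (D \<union> D') u x" using x by (intro avg_avg) auto
  also have "avg D' v x = avg D' (avg D v) x"
    by (intro avg_cong) (simp add: avg_ignores ig)
  also have "\<dots> = avg (D \<union> D') v x" using x by (subst avg_avg) (auto simp: Un_commute)
  finally show ?thesis by (simp add: mult.commute)
qed

lemma ignores_const: "ignores D (\<lambda>_. c)"
  by (simp add: ignores_def)

lemma ignores_mult: "ignores D u \<Longrightarrow> ignores D v \<Longrightarrow> ignores D (\<lambda>x. u x * (v x :: ennreal))"
  by (simp add: ignores_def)

lemma ignores_prod: "(\<And>i. i \<in> J \<Longrightarrow> ignores D (u i)) \<Longrightarrow> ignores D (\<lambda>x. \<Prod>i\<in>J. u i x :: ennreal)"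
  by (simp add: ignores_def)

lemma ignores_mono: "ignores D u \<Longrightarrow> D' \<subseteq> D \<Longrightarrow> ignores D' u"
proof -
  assume u: "ignores D u" and D: "D' \<subseteq> D"
  have "u (mix D' x y) = u x" if "x \<in> space M" "y \<in> space M" for x y
  proof -
    have "u (mix D' x y) = u (mix D (mix D' x y) y)" using u that by (simp add: ignoresD)
    also have "mix D (mix D' x y) y = mix D x y" using D by (auto simp: mix_def fun_eq_iff)
    finally show ?thesis using u that by (simp add: ignoresD)
  qed
  then show "ignores D' u" by (simp add: ignores_def)
qed

lemma restrict_mix:
  assumes "T \<subseteq> V" "T \<inter> D = {}" shows "restrict (mix D x y) T = restrict x T"
  using assms by (auto simp: mix_def restrict_def fun_eq_iff)

lemma ignores_restrict:
  assumes "T \<subseteq> V" "T \<inter> D = {}" shows "ignores D (\<lambda>x. g (restrict x T))"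
  using restrict_mix[OF assms] by (simp add: ignores_def)

end

section \<open>Conditional independence in terms of a density\<close>

context product_reference
begin

lemma space_Xsp: "space (Xsp A) = extensional A"
  unfolding space_PiM by (simp add: PiE_UNIV_domain PiE_def)

lemma restrict_measurable_M: "A \<subseteq> V \<Longrightarrow> (\<lambda>x. restrict x A) \<in> M \<rightarrow>\<^sub>M Xsp A"
  unfolding measurable_M by (rule measurable_restrict_subset)

abbreviation sub_algebra :: "'v set \<Rightarrow> ('v \<Rightarrow> real) measure" where
  "sub_algebra C \<equiv> vimage_algebra (space M) (\<lambda>x. restrict x C) (Xsp C)"

lemma measurable_sub_algebra:
  assumes C: "C \<subseteq> V" and h: "h \<in> borel_measurable M" "ignores (V - C) h"
  shows "h \<in> borel_measurable (sub_algebra C)"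
proof -
  obtain y where y: "y \<in> space M" using M.not_empty by blast
  have "(\<lambda>z. \<lambda>i\<in>V. if i \<in> C then z i else y i) \<in> Xsp C \<rightarrow>\<^sub>M Xsp V"
  proof (intro measurable_restrict)
    fix i assume "i \<in> V"
    show "(\<lambda>z. if i \<in> C then z i else y i) \<in> borel_measurable (Xsp C)"
      by (cases "i \<in> C") auto
  qed
  then have "(\<lambda>z. h (\<lambda>i\<in>V. if i \<in> C then z i else y i)) \<in> borel_measurable (Xsp C)"
    using h(1) unfolding measurable_M by (rule measurable_compose)
  moreover have "(\<lambda>x. restrict x C) \<in> sub_algebra C \<rightarrow>\<^sub>M Xsp C"
    by (intro measurable_vimage_algebra1) (auto simp: space_Xsp)
  ultimately have "(\<lambda>x. h (\<lambda>i\<in>V. if i \<in> C then restrict x C i else y i)) \<in> borel_measurable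
      (sub_algebra C)"
    by (rule measurable_compose[rotated])
  moreover have "h (\<lambda>i\<in>V. if i \<in> C then restrict x C i else y i) = h x" if "x \<in> space M" for x
  proof -
    have "(\<lambda>i\<in>V. if i \<in> C then restrict x C i else y i) = mix (V - C) x y"
      by (auto simp: mix_def fun_eq_iff)
    then show ?thesis using h(2) that y by (simp add: ignoresD)
  qed
  ultimately show ?thesis by (subst measurable_cong[where g = "\<lambda>x. h (\<lambda>i\<in>V. if i \<in> C then restrict x C
      i else y i)"]) auto
qed

lemma sets_sub_algebra:
  assumes C: "C \<subseteq> V" and H: "H \<in> sets (sub_algebra C)"
  shows "H \<in> sets M" "ignores (V - C) (indicator H :: _ \<Rightarrow> ennreal)"
proof -
  have "sets (sub_algebra C) = {(\<lambda>x. restrict x C) -` A \<inter> space M | A. A \<in> sets (Xsp C)}"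
    by (intro sets_vimage_algebra2) (auto simp: space_Xsp)
  with H obtain A where A: "A \<in> sets (Xsp C)" "H = (\<lambda>x. restrict x C) -` A \<inter> space M" by blast
  show "H \<in> sets M" unfolding A(2) by (rule measurable_sets[OF restrict_measurable_M[OF C] A(1)])
  have "restrict (mix (V - C) x y) C = restrict x C" for x y
    using C by (intro restrict_mix) auto
  then show "ignores (V - C) (indicator H :: _ \<Rightarrow> ennreal)"
    unfolding ignores_def A(2) by (simp add: indicator_def)
qed

lemma subalgebra_sub_algebra: "C \<subseteq> V \<Longrightarrow> subalgebra M (sub_algebra C)"
  unfolding subalgebra_def using sets_sub_algebra by auto

context
  fixes f :: "('v \<Rightarrow> real) \<Rightarrow> ennreal"
  assumes f [measurable]: "f \<in> borel_measurable M" and f1: "(\<integral>\<^sup>+ x. f x \<partial>M) = 1"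
begin

lemma prob_density: "prob_space (density M f)"
  by (rule prob_spaceI) (simp add: emeasure_density f1 cong: nn_integral_cong)

lemma avg_finite: "AE x in M. avg D f x < \<infinity>"
proof -
  have "AE x in M. avg D f x \<noteq> \<infinity>"
    using f1 by (intro nn_integral_noteq_infinite) (simp_all add: nn_integral_avg)
  then show ?thesis by (simp add: less_top)
qed

lemma avg_indicator_le: "avg D (\<lambda>x. f x * indicator S x) x \<le> avg D f x"
  by (intro avg_mono) (simp add: indicator_def)

lemma divide_mult_avg:
  assumes "avg D f x < \<infinity>"
  shows "avg D (\<lambda>x. f x * indicator S x) x / avg D f x * avg D f x = avg D (\<lambda>x. f x * indicator S x) x"
proof (cases "avg D f x = 0")
  case True
  then show ?thesis using avg_indicator_le[of D S x] by simp
next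
  case False
  with assms have "avg D (\<lambda>x. f x * indicator S x) x * avg D f x / avg D f x =
      avg D (\<lambda>x. f x * indicator S x) x"
    by (intro ennreal_mult_divide_eq) (auto simp: less_top)
  then show ?thesis by (simp add: ennreal_times_divide mult.commute)
qed

text \<open>The quotient is measurable with respect to \<open>X\<^sub>C\<close>, and integrating out the coordinates outside \<open>C\<close> does
not change its integrals over events in \<open>X\<^sub>C\<close>, which characterizes the conditional probability.\<close>

lemma cond_prob_eq:
  assumes C: "C \<subseteq> V" and S [measurable]: "S \<in> sets M"
  shows "AE x in density M f. cond_prob_given (density M f) C S x =
    enn2real (avg (V - C) (\<lambda>x. f x * indicator S x) x / avg (V - C) f x)"
proof -
  let ?P = "density M f" and ?D = "V - C" and ?F = "sub_algebra C"
  let ?g = "\<lambda>x. avg ?D (\<lambda>x. f x * indicator S x) x / avg ?D f x"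
  interpret dens: prob_space ?P by (rule prob_density)
  have sub: "subalgebra ?P ?F" using subalgebra_sub_algebra[OF C] by (simp add: subalgebra_def)
  interpret F: finite_measure_subalgebra ?P ?F by unfold_locales (rule sub)
  interpret F: sigma_finite_subalgebra ?P ?F
    by (rule finite_measure_subalgebra_is_sigma_finite) unfold_locales
  have g_ig: "ignores ?D ?g"
    using ignores_avg_self by (simp add: ignores_def)
  have g_F [measurable]: "?g \<in> borel_measurable ?F"
    by (rule measurable_sub_algebra[OF C _ g_ig]) measurable
  have "AE x in ?P. ?g x = nn_cond_exp ?P ?F (\<lambda>x. ennreal (indicator S x)) x"
  proof (rule F.nn_cond_exp_charact)
    fix H assume H: "H \<in> sets ?F"
    note HM [measurable] = sets_sub_algebra(1)[OF C H] and Hig = sets_sub_algebra(2)[OF C H]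
    have "(\<integral>\<^sup>+ x \<in> H. ennreal (indicator S x) \<partial>?P) = (\<integral>\<^sup>+ x. f x * (ennreal (indicator S x) *
        indicator H x) \<partial>M)"
      by (subst nn_integral_density) auto
    also have "\<dots> = (\<integral>\<^sup>+ x. indicator H x * (f x * indicator S x) \<partial>M)"
      by (intro nn_integral_cong) (auto simp: indicator_def)
    also have "\<dots> = (\<integral>\<^sup>+ x. avg ?D (\<lambda>x. indicator H x * (f x * indicator S x)) x \<partial>M)"
      by (rule nn_integral_avg[symmetric]) measurable
    also have "\<dots> = (\<integral>\<^sup>+ x. indicator H x * avg ?D (\<lambda>x. f x * indicator S x) x \<partial>M)"
      by (intro nn_integral_cong avg_pull Hig) auto
    also have "\<dots> = (\<integral>\<^sup>+ x. (?g x * indicator H x) * avg ?D f x \<partial>M)"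
    proof (rule nn_integral_cong_AE, use avg_finite[of ?D] in eventually_elim)
      case (elim x)
      then show ?case by (cases "x \<in> H") (simp_all add: divide_mult_avg)
    qed
    also have "\<dots> = (\<integral>\<^sup>+ x. avg ?D (\<lambda>x. (?g x * indicator H x) * f x) x \<partial>M)"
      by (intro nn_integral_cong avg_pull[symmetric] ignores_mult g_ig Hig) auto
    also have "\<dots> = (\<integral>\<^sup>+ x. (?g x * indicator H x) * f x \<partial>M)"
      by (rule nn_integral_avg) measurable
    also have "\<dots> = (\<integral>\<^sup>+ x. f x * (?g x * indicator H x) \<partial>M)"
      by (simp add: mult.commute)
    also have "\<dots> = (\<integral>\<^sup>+ x \<in> H. ?g x \<partial>?P)"
      by (subst nn_integral_density) auto
    finally show "(\<integral>\<^sup>+ x \<in> H. ennreal (indicator S x) \<partial>?P) = (\<integral>\<^sup>+ x \<in> H. ?g x \<partial>?P)" .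
  qed measurable
  moreover have "AE x in ?P. 0 = nn_cond_exp ?P ?F (\<lambda>x. ennreal (- indicator S x)) x"
    by (rule F.nn_cond_exp_charact) (auto simp: ennreal_neg)
  ultimately show ?thesis
    unfolding cond_prob_given_def real_cond_exp_def by eventually_elim (simp)
qed

text \<open>Clearing denominators. Where the denominator vanishes, all the averages do, so that the equation can be
stated almost everywhere for the reference measure in place of the measure under study.\<close>

lemma cond_indep_event_iff:
  assumes C: "C \<subseteq> V" and S: "S \<in> sets M" "T \<in> sets M"
  shows "(AE x in density M f. cond_prob_given (density M f) C (S \<inter> T) x =
      cond_prob_given (density M f) C S x * cond_prob_given (density M f) C T x) \<longleftrightarrow>
    (AE x in M. avg (V - C) (\<lambda>x. f x * indicator (S \<inter> T) x) x * avg (V - C) f x =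
      avg (V - C) (\<lambda>x. f x * indicator S x) x * avg (V - C) (\<lambda>x. f x * indicator T x) x)"
    (is "?L \<longleftrightarrow> ?R")
proof -
  let ?P = "density M f" and ?D = "V - C"
  let ?g = "\<lambda>S x. avg ?D (\<lambda>x. f x * indicator S x) x"
  let ?Q = "\<lambda>x. ?g (S \<inter> T) x * avg ?D f x = ?g S x * ?g T x"
  have ST: "S \<inter> T \<in> sets M" using S by auto
  note S [measurable] ST [measurable]
  have "?L \<longleftrightarrow> (AE x in ?P. enn2real (?g (S \<inter> T) x / avg ?D f x) =
      enn2real (?g S x / avg ?D f x) * enn2real (?g T x / avg ?D f x))"
    by (rule eventually_subst, use cond_prob_eq[OF C ST] cond_prob_eq[OF C S(1)] cond_prob_eq[OF C S(2)]
      in eventually_elim) simp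
  also have "\<dots> \<longleftrightarrow> (AE x in ?P. ?Q x)"
  proof -
    have fin: "AE x in ?P. avg ?D f x < \<infinity>"
      using avg_finite[of ?D] by (auto simp: AE_density elim: eventually_mono)
    have pos: "AE x in ?P. avg ?D f x \<noteq> 0"
    proof -
      have "(\<integral>\<^sup>+ x. f x * indicator {x \<in> space M. avg ?D f x = 0} x \<partial>M) = 0"
      proof -
        let ?H = "{x \<in> space M. avg ?D f x = 0}"
        have H: "ignores ?D (indicator ?H :: _ \<Rightarrow> ennreal)"
          using ignores_avg_self by (simp add: ignores_def indicator_def)
        have "(\<integral>\<^sup>+ x. f x * indicator ?H x \<partial>M) = (\<integral>\<^sup>+ x. avg ?D (\<lambda>x. indicator ?H x * f x) x \<partial>M)"
          by (subst nn_integral_avg) (auto simp: mult.commute)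
        also have "\<dots> = (\<integral>\<^sup>+ x. indicator ?H x * avg ?D f x \<partial>M)"
          by (intro nn_integral_cong avg_pull H) auto
        also have "\<dots> = (\<integral>\<^sup>+ x. 0 \<partial>M)"
          by (intro nn_integral_cong) (auto simp: indicator_def)
        finally show ?thesis by simp
      qed
      then have "AE x in M. f x * indicator {x \<in> space M. avg ?D f x = 0} x = 0"
        by (subst (asm) nn_integral_0_iff_AE) auto
      then show ?thesis
        using AE_space by (subst AE_density) (auto simp: indicator_def)
    qed
    have eq: "enn2real (?g (S \<inter> T) x / avg ?D f x) =
        enn2real (?g S x / avg ?D f x) * enn2real (?g T x / avg ?D f x) \<longleftrightarrow> ?Q x"
      if "avg ?D f x < \<infinity>" "avg ?D f x \<noteq> 0" for x
    proof -
      define a where "a = enn2real (avg ?D f x)"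
      have a: "avg ?D f x = ennreal a" "0 < a"
        using that by (auto simp: a_def enn2real_positive_iff less_top zero_less_iff_neq_zero)
      have g: "\<exists>r\<ge>0. ?g U x = ennreal r" for U
        using avg_indicator_le[of ?D U x] that(1)
        by (metis ennreal_enn2real enn2real_nonneg infinity_ennreal_def order_le_less_trans)
      obtain s t u where r: "0 \<le> s" "?g S x = ennreal s" "0 \<le> t" "?g T x = ennreal t"
        "0 \<le> u" "?g (S \<inter> T) x = ennreal u" using g by metis
      show ?thesis using a r
        by (simp add: divide_ennreal ennreal_mult[symmetric] field_simps power2_eq_square)
    qed
    show ?thesis by (rule eventually_subst, use fin pos in eventually_elim) (rule eq)
  qed
  also have "\<dots> \<longleftrightarrow> ?R"
  proof
    assume "AE x in ?P. ?Q x"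
    then have AE: "AE x in M. 0 < f x \<longrightarrow> ?Q x" by (simp add: AE_density)
    let ?H = "{x \<in> space M. \<not> ?Q x}"
    have "{x \<in> space M. ?Q x} \<in> sets M" by (rule measurable_equality_set) measurable
    then have "space M - {x \<in> space M. ?Q x} \<in> sets M" by (rule sets.compl_sets)
    also have "space M - {x \<in> space M. ?Q x} = ?H" by blast
    finally have Hm [measurable]: "?H \<in> sets M" .
    have H: "ignores ?D (indicator ?H :: _ \<Rightarrow> ennreal)"
      using ignores_avg_self by (simp add: ignores_def indicator_def)
    have "(\<integral>\<^sup>+ x. indicator ?H x * avg ?D f x \<partial>M) = (\<integral>\<^sup>+ x. avg ?D (\<lambda>x. indicator ?H x * f x) x \<partial>M)"
      by (intro nn_integral_cong avg_pull[symmetric] H) auto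
    also have "\<dots> = (\<integral>\<^sup>+ x. indicator ?H x * f x \<partial>M)"
      by (rule nn_integral_avg) measurable
    also have "\<dots> = (\<integral>\<^sup>+ x. 0 \<partial>M)"
      using AE by (intro nn_integral_cong_AE) (auto elim!: eventually_mono simp: indicator_def
          zero_less_iff_neq_zero)
    finally have "(\<integral>\<^sup>+ x. indicator ?H x * avg ?D f x \<partial>M) = 0" by simp
    moreover have "(\<lambda>x. indicator ?H x * avg ?D f x) \<in> borel_measurable M" by measurable
    ultimately have "AE x in M. indicator ?H x * avg ?D f x = 0"
      by (simp only: nn_integral_0_iff_AE)
    then show ?R
      using AE_space
    proof eventually_elim
      case (elim x)
      show ?case
      proof (cases "?Q x")
        case False
        with elim have "avg ?D f x = 0" by (simp add: indicator_def)
        then show ?thesis using avg_indicator_le[of ?D S x] by simp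
      qed
    qed
  next
    assume ?R
    then show "AE x in ?P. ?Q x" by (auto simp: AE_density elim: eventually_mono)
  qed
  finally show ?thesis .
qed

end

lemma proj_event_density: "proj_event (density M f) A EA = {x \<in> space M. restrict x A \<in> EA}"
  by (simp add: proj_event_def)

lemma proj_event_sets: "A \<subseteq> V \<Longrightarrow> EA \<in> sets (Xsp A) \<Longrightarrow> {x \<in> space M. restrict x A \<in> EA} \<in> sets M"
  using measurable_sets[OF restrict_measurable_M[of A], of EA] by (simp add: vimage_def Int_def
      conj_commute)

end

section \<open>Products of conditional densities and the global Markov property\<close>

locale factorized_density = product_reference \<nu> V for \<nu> and V :: "'v set" +
  fixes E :: "('v \<times> 'v) set" and r :: "'v \<Rightarrow> ('v \<Rightarrow> real) \<Rightarrow> ennreal"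
  assumes dag: "dag V E"
    and measurable_r: "\<And>v. v \<in> V \<Longrightarrow> r v \<in> borel_measurable (Xsp (family E v))"
    and r_one: "\<And>v x. v \<in> V \<Longrightarrow> x \<in> space (Xsp (pa E v)) \<Longrightarrow> (\<integral>\<^sup>+ y. r v (x(v := y)) \<partial>\<nu>) = 1"
begin

definition factor :: "'v \<Rightarrow> ('v \<Rightarrow> real) \<Rightarrow> ennreal" where
  "factor v x = r v (restrict x (family E v))"

definition joint :: "'v set \<Rightarrow> ('v \<Rightarrow> real) \<Rightarrow> ennreal" where
  "joint W x = (\<Prod>v\<in>W. factor v x)"

lemma pa_subset: "pa E v \<subseteq> V"
  using dag by (auto simp: pa_def dag_def)

lemma not_in_pa: "v \<notin> pa E v"
  using dag by (auto simp: pa_def dag_def acyclic_def)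

lemma measurable_factor_Xsp:
  "v \<in> V \<Longrightarrow> family E v \<subseteq> W \<Longrightarrow> factor v \<in> borel_measurable (Xsp W)"
  unfolding factor_def by (rule measurable_compose[OF measurable_restrict_subset measurable_r])

lemma measurable_factor [measurable]: "v \<in> V \<Longrightarrow> factor v \<in> borel_measurable M"
  unfolding measurable_M using pa_subset by (intro measurable_factor_Xsp) auto

lemma measurable_joint [measurable]: "W \<subseteq> V \<Longrightarrow> joint W \<in> borel_measurable M"
  unfolding joint_def[abs_def] by (intro borel_measurable_prod_ennreal measurable_factor) auto

lemma ignores_factor: "v \<in> V \<Longrightarrow> family E v \<inter> D = {} \<Longrightarrow> ignores D (factor v)"
  unfolding factor_def using pa_subset by (intro ignores_restrict) auto

lemma ignores_joint:
  "W \<subseteq> V \<Longrightarrow> (\<And>v. v \<in> W \<Longrightarrow> family E v \<inter> D = {}) \<Longrightarrow> ignores D (joint W)"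
  unfolding joint_def by (intro ignores_prod ignores_factor) auto

lemma avg_local:
  assumes v: "v \<in> V" and x: "x \<in> space M" and h: "h \<in> borel_measurable (Xsp (family E v))"
  shows "avg {v} (\<lambda>x. h (restrict x (family E v))) x =
    (\<integral>\<^sup>+ t. h ((restrict x (pa E v))(v := t)) \<partial>\<nu>)"
proof -
  have eq: "restrict (mix {v} x y) (family E v) = (restrict x (pa E v))(v := y v)" for y
    using v pa_subset not_in_pa by (auto simp: mix_def fun_eq_iff restrict_def)
  have m: "(\<lambda>t. h ((restrict x (pa E v))(v := t))) \<in> borel_measurable \<nu>"
  proof -
    have "(\<lambda>t. (restrict x (pa E v))(v := t)) \<in> borel \<rightarrow>\<^sub>M Xsp (family E v)"
      using measurable_compose[OF measurable_Pair1'[of "restrict x (pa E v)" "Xsp (pa E v)" borel]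
        measurable_add_dim[of v "pa E v" "\<lambda>_. borel"]] by (simp add: space_Xsp)
    from measurable_compose[OF this h] show ?thesis
      by (simp add: measurable_cong_sets[OF sets_nu refl])
  qed
  have "avg {v} (\<lambda>x. h (restrict x (family E v))) x = (\<integral>\<^sup>+ y. h ((restrict x (pa E v))(v := y v)) \<partial>M)"
    by (simp add: avg_def eq)
  also have "\<dots> = (\<integral>\<^sup>+ t. h ((restrict x (pa E v))(v := t)) \<partial>distr M \<nu> (\<lambda>y. y v))"
    using m v by (intro nn_integral_distr[symmetric]) (simp_all add: measurable_cong_sets[OF refl
        sets_nu])
  also have "distr M \<nu> (\<lambda>y. y v) = \<nu>"
    unfolding M_def using v by (rule PiM_component)
  finally show ?thesis .
qed

lemma avg_factor:
  assumes v: "v \<in> V" and x: "x \<in> space M"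
  shows "avg {v} (factor v) x = 1"
  using avg_local[OF v x measurable_r[OF v]] r_one[OF v, of "restrict x (pa E v)"]
  by (simp add: factor_def[abs_def] space_Xsp)

definition ancestral :: "'v set \<Rightarrow> bool" where
  "ancestral W \<longleftrightarrow> W \<subseteq> V \<and> (\<forall>v\<in>W. pa E v \<subseteq> W)"

lemma sink_exists:
  assumes "Q \<subseteq> V" "Q \<noteq> {}"
  shows "\<exists>v\<in>Q. \<forall>w\<in>Q. (v, w) \<notin> E"
proof -
  have "finite E" using dag unfolding dag_def by (meson finite_SigmaI finite_subset)
  then have "wf (E\<inverse>)" using dag by (intro finite_acyclic_wf_converse) (auto simp: dag_def)
  then obtain v where "v \<in> Q" "\<And>w. (w, v) \<in> E\<inverse> \<Longrightarrow> w \<notin> Q"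
    using assms(2) by (metis all_not_in_conv wf_eq_minimal)
  then show ?thesis by blast
qed

text \<open>A vertex without children occurs only in its own factor, which integrates to 1; removing such vertices
one after the other leaves the factors of an ancestral set.\<close>

lemma avg_joint:
  assumes "ancestral N" "ancestral W" "N \<subseteq> W" "x \<in> space M"
  shows "avg (W - N) (joint W) x = joint N x"
  using assms(2-4)
proof (induction "card (W - N)" arbitrary: W x)
  case 0
  then have "finite (W - N)" using finite_V by (auto simp: ancestral_def intro: finite_subset)
  with 0 have "W = N" by auto
  then show ?case using 0 by (simp add: avg_ignores ignores_def mix_def space_M extensional_restrict)
next
  case (Suc k)
  have WV: "W \<subseteq> V" using Suc by (simp add: ancestral_def)
  have fin: "finite W" using finite_V WV by (rule finite_subset[rotated])
  from Suc have "W - N \<noteq> {}" by auto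
  then obtain v where v: "v \<in> W - N" "\<And>w. w \<in> W - N \<Longrightarrow> (v, w) \<notin> E"
    using sink_exists[of "W - N"] WV by blast
  then have child: "v \<notin> pa E w" if "w \<in> W" for w
    using that assms(1) by (auto simp: pa_def ancestral_def)
  define W' where "W' = W - {v}"
  have W': "ancestral W'" "N \<subseteq> W'" "W' \<subseteq> V"
    using Suc.prems v child by (auto simp: ancestral_def W'_def)
  have k: "k = card (W' - N)"
  proof -
    have "W' - N = (W - N) - {v}" by (auto simp: W'_def)
    then show ?thesis using Suc.hyps(2) v fin by (simp add: card_Diff_singleton)
  qed
  have ig: "ignores {v} (joint W')"
    using W' child by (intro ignores_joint) (auto simp: W'_def)
  have "W - N = (W' - N) \<union> {v}" using v by (auto simp: W'_def)
  then have "avg (W - N) (joint W) x = avg (W' - N) (avg {v} (joint W)) x"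
    using Suc.prems WV by (simp add: avg_avg)
  also have "\<dots> = avg (W' - N) (joint W') x"
  proof (rule avg_cong)
    fix x assume x: "x \<in> space M"
    have "joint W = (\<lambda>x. joint W' x * factor v x)"
      using fin v by (auto simp: joint_def W'_def prod.remove[of W v] mult.commute)
    then have "avg {v} (joint W) x = joint W' x * avg {v} (factor v) x"
      using avg_pull[OF ig, of "factor v" x] v WV x by auto
    then show "avg {v} (joint W) x = joint W' x" using avg_factor v WV x by auto
  qed
  also have "\<dots> = joint N x" using Suc.hyps(1)[OF k W'(1,2) Suc.prems(3)] .
  finally show ?case .
qed

lemma nn_integral_joint:
  assumes "ancestral W"
  shows "(\<integral>\<^sup>+ x. joint W x \<partial>M) = 1"
proof -
  have "W \<subseteq> V" using assms by (simp add: ancestral_def)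
  then have "(\<integral>\<^sup>+ x. joint W x \<partial>M) = (\<integral>\<^sup>+ x. avg (W - {}) (joint W) x \<partial>M)"
    by (simp add: nn_integral_avg)
  also have "\<dots> = (\<integral>\<^sup>+ x. joint {} x \<partial>M)"
    using assms by (intro nn_integral_cong avg_joint) (auto simp: ancestral_def)
  finally show ?thesis using M.emeasure_space_1 by (simp add: joint_def)
qed

lemma ancestral_V: "ancestral V"
  using pa_subset by (simp add: ancestral_def)

text \<open>After integrating out all but the ancestors of \<open>A \<union> B \<union> C\<close>, every factor lives either on \<open>R \<union> C\<close> or off
\<open>R\<close>, for the set \<open>R\<close> of \<open>d_separated_split\<close>. So the density is a product of two functions whose averaged
coordinates are disjoint, one of which absorbs the event for \<open>A\<close> and the other the event for \<open>B\<close>.\<close>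

lemma joint_markov:
  assumes sub: "A \<subseteq> V" "B \<subseteq> V" "C \<subseteq> V" and sep: "d_separated V E A B C"
  shows "cond_indep (density M (joint V)) A B C"
  unfolding cond_indep_def proj_event_density
proof (intro ballI)
  fix EA EB assume EA: "EA \<in> sets (Xsp A)" and EB: "EB \<in> sets (Xsp B)"
  define S where "S = {x \<in> space M. restrict x A \<in> EA}"
  define T where "T = {x \<in> space M. restrict x B \<in> EB}"
  have ST [measurable]: "S \<in> sets M" "T \<in> sets M"
    unfolding S_def T_def using proj_event_sets sub EA EB by auto
  obtain R where R: "A \<subseteq> R \<union> C" "R \<inter> C = {}" "B \<inter> R = {}"
    "\<And>v. v \<in> ancestors E (A \<union> B \<union> C) \<Longrightarrow>
      family E v \<subseteq> R \<union> C \<or> family E v \<inter> R = {}"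
    using d_separated_split[OF dag sub sep] by blast
  define N where "N = ancestors E (A \<union> B \<union> C)"
  have "w \<in> V" if "(w, c) \<in> E\<^sup>*" "c \<in> V" for w c
    using that dag by (induction rule: converse_rtrancl_induct) (auto simp: dag_def)
  then have NV: "N \<subseteq> V" using sub unfolding N_def ancestors_def by blast
  have paN: "pa E v \<subseteq> N" if "v \<in> N" for v
    using that unfolding N_def pa_def by (auto intro: ancestors_edge)
  have ABC: "A \<subseteq> N" "B \<subseteq> N" "C \<subseteq> N" unfolding N_def by (auto intro: ancestors_self)
  define N1 where "N1 = {v \<in> N. family E v \<subseteq> R \<union> C}"
  define N2 where "N2 = N - N1"
  define Da where "Da = R \<inter> N"
  define Db where "Db = N - C - R"
  have ig: "ignores Db (joint N1)" "ignores Da (joint N2)"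
    using NV R(4) by (auto intro!: ignores_joint simp: N1_def N2_def Da_def Db_def N_def[symmetric])
  have igS: "ignores (V - N) (indicator S :: _ \<Rightarrow> ennreal)" "ignores Db (indicator S :: _ \<Rightarrow> ennreal)"
    and igT: "ignores (V - N) (indicator T :: _ \<Rightarrow> ennreal)" "ignores Da (indicator T :: _ \<Rightarrow> ennreal)"
  proof -
    have *: "ignores D (indicator {x \<in> space M. restrict x Y \<in> EY} :: _ \<Rightarrow> ennreal)"
      if "Y \<subseteq> V" "Y \<inter> D = {}" for D Y EY
      using restrict_mix[OF that] by (simp add: ignores_def indicator_def)
    show "ignores (V - N) (indicator S :: _ \<Rightarrow> ennreal)" "ignores Db (indicator S :: _ \<Rightarrow> ennreal)"
      "ignores (V - N) (indicator T :: _ \<Rightarrow> ennreal)" "ignores Da (indicator T :: _ \<Rightarrow> ennreal)"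
      unfolding S_def T_def using sub ABC R(1,3) by (intro *; auto simp: Da_def Db_def)+
  qed
  have N12: "joint N x = joint N1 x * joint N2 x" for x
  proof -
    have "N = N1 \<union> N2" "N1 \<inter> N2 = {}" by (auto simp: N1_def N2_def)
    moreover have "finite N" using NV finite_V by (rule finite_subset)
    ultimately show ?thesis unfolding joint_def by (metis finite_Un prod.union_disjoint)
  qed
  have sub12: "N1 \<subseteq> V" "N2 \<subseteq> V" using NV by (auto simp: N1_def N2_def)
  note m12 [measurable] = measurable_joint[OF sub12(1)] measurable_joint[OF sub12(2)]
  have split: "avg (V - C) (\<lambda>x. joint V x * (u x * v x)) x =
      avg (Da \<union> Db) (\<lambda>x. joint N1 x * u x) x * avg (Da \<union> Db) (\<lambda>x. joint N2 x * v x) x"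
    if [measurable]: "u \<in> borel_measurable M" "v \<in> borel_measurable M"
      and uv: "ignores (V - N) u" "ignores Db u" "ignores (V - N) v" "ignores Da v"
      and x: "x \<in> space M" for u v x
  proof -
    have VC: "V - C = (Da \<union> Db) \<union> (V - N)"
      using NV ABC R(2) by (auto simp: Da_def Db_def)
    have [measurable]: "joint V \<in> borel_measurable M" "joint N \<in> borel_measurable M"
      using NV by auto
    have "avg (V - C) (\<lambda>x. joint V x * (u x * v x)) x =
        avg (Da \<union> Db) (avg (V - N) (\<lambda>x. joint V x * (u x * v x))) x"
      unfolding VC by (intro avg_avg[symmetric] x) measurable
    also have "\<dots> = avg (Da \<union> Db) (\<lambda>x. (joint N1 x * u x) * (joint N2 x * v x)) x"
    proof (rule avg_cong)
      fix x assume x: "x \<in> space M"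
      have "avg (V - N) (\<lambda>x. joint V x * (u x * v x)) x = avg (V - N) (\<lambda>x. (u x * v x) * joint V x) x"
        by (simp add: mult.commute)
      also have "\<dots> = u x * v x * avg (V - N) (joint V) x"
        using x by (intro avg_pull ignores_mult uv) auto
      also have "avg (V - N) (joint V) x = joint N x"
        using x NV paN pa_subset by (intro avg_joint) (auto simp: ancestral_def)
      finally show "avg (V - N) (\<lambda>x. joint V x * (u x * v x)) x = (joint N1 x * u x) * (joint N2 x * v x)"
        by (simp add: N12 mult_ac)
    qed
    also have "\<dots> = avg (Da \<union> Db) (\<lambda>x. joint N1 x * u x) x * avg (Da \<union> Db) (\<lambda>x. joint N2 x * v x) x"
      by (intro avg_mult ignores_mult ig uv x) measurable
    finally show ?thesis .
  qed
  let ?S = "indicator S :: _ \<Rightarrow> ennreal" and ?T = "indicator T :: _ \<Rightarrow> ennreal" and ?one = "\<lambda>_. 1 ::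
      ennreal"
  have "AE x in M. avg (V - C) (\<lambda>x. joint V x * indicator (S \<inter> T) x) x * avg (V - C) (joint V) x =
    avg (V - C) (\<lambda>x. joint V x * indicator S x) x * avg (V - C) (\<lambda>x. joint V x * indicator T x) x"
  proof (rule AE_I2)
    fix x assume x: "x \<in> space M"
    note s = split[of ?S ?T x] split[of ?S ?one x] split[of ?one ?T x] split[of ?one ?one x]
    show "avg (V - C) (\<lambda>x. joint V x * indicator (S \<inter> T) x) x * avg (V - C) (joint V) x =
      avg (V - C) (\<lambda>x. joint V x * indicator S x) x * avg (V - C) (\<lambda>x. joint V x * indicator T x) x"
      using s igS igT x by (simp add: ignores_const indicator_inter_arith mult_ac)
  qed
  then show "AE x in density M (joint V). cond_prob_given (density M (joint V)) C (S \<inter> T) x =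
      cond_prob_given (density M (joint V)) C S x * cond_prob_given (density M (joint V)) C T x"
    using cond_indep_event_iff[OF measurable_joint[OF order_refl] nn_integral_joint[OF ancestral_V]
        sub(3) ST] by simp
qed

end

section \<open>The density of the distribution of a network\<close>

context factorized_density
begin

text \<open>The list runs against the edges, so the head is drawn last: Fubini for the coordinate of the head turns
composition of kernels into multiplication of densities.\<close>

lemma kernel_product_density:
  assumes m: "m \<in> bayes_nets V E"
    and kernel: "\<And>v x. v \<in> V \<Longrightarrow> x \<in> space (Xsp (pa E v)) \<Longrightarrow> m v x = density \<nu> (\<lambda>y. r v (x(v := y)))"
    and vs: "distinct vs" "set vs \<subseteq> V" "\<And>i. i < length vs \<Longrightarrow> pa E (vs ! i) \<subseteq> set (drop (Suc i) vs)"
  shows "kernel_product E m vs = density (\<Pi>\<^sub>M i\<in>set vs. \<nu>) (joint (set vs))"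
  using vs
proof (induction vs)
  case Nil
  have "density (count_space {\<lambda>_. undefined}) (joint {}) = return (count_space {\<lambda>_. undefined}) (\<lambda>_.
      undefined)"
  proof (rule measure_eqI)
    fix A assume "A \<in> sets (density (count_space {\<lambda>_. undefined}) (joint {}))"
    then have "A = {} \<or> A = {\<lambda>_. undefined}" by (simp add: subset_singleton_iff)
    then show "emeasure (density (count_space {\<lambda>_. undefined}) (joint {})) A =
        emeasure (return (count_space {\<lambda>_. undefined}) (\<lambda>_. undefined)) A"
      by (elim disjE) (simp_all add: emeasure_density joint_def nn_integral_count_space_finite)
  qed simp
  then show ?case by (simp only: kernel_product.simps list.set PiM_empty)
next
  case (Cons v vs)
  let ?K = "kernel_product E m vs" and ?X = "Xsp (set (v # vs))"
  let ?N = "\<lambda>W. \<Pi>\<^sub>M i\<in>W. \<nu>"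
  have v: "v \<in> V" "v \<notin> set vs" "distinct vs" "set vs \<subseteq> V" using Cons.prems by auto
  have pav: "pa E v \<subseteq> set vs" using Cons.prems(3)[of 0] by simp
  have IH: "?K = density (?N (set vs)) (joint (set vs))"
    using Cons.prems(3)[of "Suc _"] v by (intro Cons.IH) auto
  have setsN: "sets (?N W) = sets (Xsp W)" for W :: "'v set" by (rule sets_PiM_cong) auto
  have pa_closed: "pa E w \<subseteq> set vs" if "w \<in> set vs" for w
  proof -
    obtain i where i: "i < length vs" "w = vs ! i" 
      using \<open>w \<in> set vs\<close> unfolding in_set_conv_nth by blast
    then show ?thesis using Cons.prems(3)[of "Suc i"] by (auto dest: in_set_dropD)
  qed
  have mJ: "joint W \<in> borel_measurable (?N W')" if "W \<subseteq> W'" "W' \<subseteq> V" "\<And>w. w \<in> W \<Longrightarrow> pa E w \<subseteq> W'" for W W'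
    unfolding joint_def[abs_def] measurable_cong_sets[OF setsN refl]
    using that by (intro borel_measurable_prod_ennreal measurable_factor_Xsp) auto
  have mJvs: "joint (set vs) \<in> borel_measurable (?N (set vs))"
    using v pa_closed by (intro mJ) auto
  have mJv: "joint (set (v # vs)) \<in> borel_measurable (?N (set (v # vs)))"
    using v pa_closed pav by (intro mJ) auto
  have mfv: "factor v \<in> borel_measurable (?N (insert v (set vs)))"
    unfolding measurable_cong_sets[OF setsN refl] using pav v by (intro measurable_factor_Xsp) auto
  have mvs: "(\<lambda>x. restrict x (pa E v)) \<in> ?N (set vs) \<rightarrow>\<^sub>M Xsp (pa E v)"
    unfolding measurable_cong_sets[OF setsN refl] by (rule measurable_restrict_subset[OF pav])
  have "m v \<in> Xsp (pa E v) \<rightarrow>\<^sub>M prob_algebra borel"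
    using m v(1) by (auto simp: bayes_nets_def dest!: PiE_mem)
  then have mK: "(\<lambda>x. m v (restrict x (pa E v))) \<in> ?N (set vs) \<rightarrow>\<^sub>M subprob_algebra borel"
    using measurable_prob_algebraD measurable_compose[OF mvs] by blast
  have upd: "(\<lambda>(x, y). x(v := y)) \<in> ?N (set vs) \<Otimes>\<^sub>M borel \<rightarrow>\<^sub>M ?X"
    unfolding measurable_cong_sets[OF sets_pair_measure_cong[OF setsN refl] refl]
    using measurable_add_dim[of v "set vs" "\<lambda>_. borel"] by simp
  have step: "(\<lambda>x. distr (m v (restrict x (pa E v))) ?X (\<lambda>y. x(v := y))) \<in> ?K \<rightarrow>\<^sub>M subprob_algebra ?X"
    unfolding IH measurable_density_eq2 measurable_cong_sets[OF sets_density refl]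
    by (rule measurable_distr2[OF upd mK])
  have spK: "space ?K = extensional (set vs)"
    unfolding IH by (simp add: space_PiM PiE_UNIV_domain PiE_def)
  show ?case
  proof (rule measure_eqI)
    have "sets (kernel_product E m (v # vs)) = sets ?X"
      unfolding kernel_product.simps
      using spK by (intro sets_bind[OF sets_kernel[OF step]]) auto
    then show "sets (kernel_product E m (v # vs)) = sets (density (?N (set (v # vs))) (joint (set (v #
        vs))))"
      using setsN[of "set (v # vs)"] by simp
    fix A assume "A \<in> sets (kernel_product E m (v # vs))"
    then have A: "A \<in> sets ?X" using \<open>sets (kernel_product E m (v # vs)) = sets ?X\<close> by simp
    then have A' [measurable]: "A \<in> sets (?N (insert v (set vs)))" using setsN[of "set (v # vs)"] by simp
    have "emeasure (kernel_product E m (v # vs)) A =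
        (\<integral>\<^sup>+ x. emeasure (distr (m v (restrict x (pa E v))) ?X (\<lambda>y. x(v := y))) A \<partial>?K)"
      unfolding kernel_product.simps using spK by (intro emeasure_bind[OF _ step A]) auto
    also have "\<dots> = (\<integral>\<^sup>+ x. (\<integral>\<^sup>+ y. factor v (x(v := y)) * indicator A (x(v := y)) \<partial>\<nu>) \<partial>?K)"
    proof (rule nn_integral_cong)
      fix x assume "x \<in> space ?K"
      then have x: "x \<in> extensional (set vs)" by (simp add: spK)
      have px: "restrict x (pa E v) \<in> space (Xsp (pa E v))" by (auto simp: space_Xsp)
      have up: "(\<lambda>y. x(v := y)) \<in> borel \<rightarrow>\<^sub>M ?X"
        using measurable_compose[OF measurable_Pair1'[of x "Xsp (set vs)" borel]
          measurable_add_dim[of v "set vs" "\<lambda>_. borel"]] x by (simp add: space_Xsp)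
      have up': "(\<lambda>y. x(v := y)) \<in> \<nu> \<rightarrow>\<^sub>M ?N (insert v (set vs))"
        using up by (simp add: measurable_cong_sets[OF sets_nu setsN])
      have fe: "r v ((restrict x (pa E v))(v := y)) = factor v (x(v := y))" for y
        unfolding factor_def by (intro arg_cong[of _ _ "r v"]) (use not_in_pa in \<open>auto simp:
            fun_eq_iff restrict_def\<close>)
      have mr: "(\<lambda>y. factor v (x(v := y))) \<in> borel_measurable \<nu>"
        by (rule measurable_compose[OF up' mfv])
      have up2: "(\<lambda>y. x(v := y)) \<in> density \<nu> (\<lambda>y. factor v (x(v := y))) \<rightarrow>\<^sub>M ?X"
        using up by (simp add: measurable_cong_sets[OF sets_nu refl])
      have "emeasure (distr (m v (restrict x (pa E v))) ?X (\<lambda>y. x(v := y))) A =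
          emeasure (density \<nu> (\<lambda>y. factor v (x(v := y)))) ((\<lambda>y. x(v := y)) -` A \<inter> space \<nu>)"
        unfolding kernel[OF v(1) px] fe using up2 A by (simp add: emeasure_distr)
      also have "\<dots> = (\<integral>\<^sup>+ y. factor v (x(v := y)) * indicator ((\<lambda>y. x(v := y)) -` A \<inter> space \<nu>) y \<partial>\<nu>)"
        by (rule emeasure_density[OF mr measurable_sets[OF up' A']])
      also have "\<dots> = (\<integral>\<^sup>+ y. factor v (x(v := y)) * indicator A (x(v := y)) \<partial>\<nu>)"
        by (intro nn_integral_cong) (auto simp: indicator_def)
      finally show "emeasure (distr (m v (restrict x (pa E v))) ?X (\<lambda>y. x(v := y))) A =
          (\<integral>\<^sup>+ y. factor v (x(v := y)) * indicator A (x(v := y)) \<partial>\<nu>)" .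
    qed
    also have "\<dots> = (\<integral>\<^sup>+ x. joint (set vs) x * (\<integral>\<^sup>+ y. factor v (x(v := y)) * indicator A (x(v := y))
        \<partial>\<nu>) \<partial>?N (set vs))"
    proof -
      have "(\<lambda>z. (fst z)(v := snd z)) \<in> ?N (set vs) \<Otimes>\<^sub>M \<nu> \<rightarrow>\<^sub>M ?N (insert v (set vs))"
        using measurable_add_dim[of v "set vs" "\<lambda>_. \<nu>"] by (simp add: case_prod_beta')
      then have "(\<lambda>z. factor v ((fst z)(v := snd z)) * indicator A ((fst z)(v := snd z))) \<in>
          borel_measurable (?N (set vs) \<Otimes>\<^sub>M \<nu>)"
        by (intro borel_measurable_times_ennreal measurable_compose[OF _ mfv]
          measurable_compose[OF _ borel_measurable_indicator[OF A']])
      then have "(\<lambda>x. \<integral>\<^sup>+ y. factor v (x(v := y)) * indicator A (x(v := y)) \<partial>\<nu>) \<in> borel_measurable (?N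
          (set vs))"
        by (intro sigma_finite_measure.borel_measurable_nn_integral[OF sigma_finite_measures])
          (simp add: case_prod_beta')
      then show ?thesis unfolding IH by (rule nn_integral_density[OF mJvs])
    qed
    also have "\<dots> = (\<integral>\<^sup>+ x. (\<integral>\<^sup>+ y. joint (set (v # vs)) (x(v := y)) * indicator A (x(v := y)) \<partial>\<nu>) \<partial>?N
        (set vs))"
    proof (rule nn_integral_cong)
      fix x assume "x \<in> space (?N (set vs))"
      then have x: "x \<in> space (Xsp (set vs))" by (simp add: sets_eq_imp_space_eq[OF setsN])
      have up': "(\<lambda>y. x(v := y)) \<in> \<nu> \<rightarrow>\<^sub>M ?N (insert v (set vs))"
        using measurable_compose[OF measurable_Pair1'[of x "Xsp (set vs)" borel]
          measurable_add_dim[of v "set vs" "\<lambda>_. borel"]] x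
        by (simp add: measurable_cong_sets[OF sets_nu setsN])
      have "joint (set (v # vs)) (x(v := y)) = joint (set vs) x * factor v (x(v := y))" for y
      proof -
        have "factor w (x(v := y)) = factor w x" if "w \<in> set vs" for w
          unfolding factor_def
          by (intro arg_cong[of _ _ "r w"]) (use that v(2) pa_closed[OF that] in \<open>auto simp:
              fun_eq_iff restrict_def\<close>)
        then show ?thesis using v(2) by (simp add: joint_def mult.commute cong: prod.cong)
      qed
      then show "joint (set vs) x * (\<integral>\<^sup>+ y. factor v (x(v := y)) * indicator A (x(v := y)) \<partial>\<nu>) =
          (\<integral>\<^sup>+ y. joint (set (v # vs)) (x(v := y)) * indicator A (x(v := y)) \<partial>\<nu>)"
        using measurable_compose[OF up' mfv] measurable_compose[OF up' borel_measurable_indicator[OF A']]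
        by (subst nn_integral_cmult[symmetric]) (auto simp: mult.assoc intro!:
            borel_measurable_times_ennreal)
    qed
    also have "\<dots> = (\<integral>\<^sup>+ x. joint (set (v # vs)) x * indicator A x \<partial>?N (insert v (set vs)))"
      using mJv by (intro product_nn_integral_insert[symmetric] v finite_set) auto
    also have "\<dots> = emeasure (density (?N (set (v # vs))) (joint (set (v # vs)))) A"
      using mJv by (subst emeasure_density) auto
    finally show "emeasure (kernel_product E m (v # vs)) A =
      emeasure (density (?N (set (v # vs))) (joint (set (v # vs)))) A" .
  qed
qed

lemma bn_distribution_density:
  assumes "m \<in> bayes_nets V E"
    and "\<And>v x. v \<in> V \<Longrightarrow> x \<in> space (Xsp (pa E v)) \<Longrightarrow> m v x = density \<nu> (\<lambda>y. r v (x(v := y)))"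
  shows "bn_distribution V E m = density M (joint V)"
proof -
  define us where "us = (SOME vs. topological_order V E vs)"
  have us: "topological_order V E us"
    unfolding us_def by (rule someI_ex, rule topological_order_exists) (use dag in \<open>auto simp: dag_def\<close>)
  then have order: "distinct us" "set us = V"
    "\<And>i j. i < length us \<Longrightarrow> j < length us \<Longrightarrow> (us ! i, us ! j) \<in> E \<Longrightarrow> i < j"
    unfolding topological_order_def by blast+
  have parents: "pa E (rev us ! i) \<subseteq> set (drop (Suc i) (rev us))" if i: "i < length (rev us)" for i
  proof
    fix w assume w: "w \<in> pa E (rev us ! i)"
    then have e: "(w, us ! (length us - Suc i)) \<in> E" using i by (simp add: pa_def rev_nth)
    have "w \<in> set us" using w pa_subset order(2) by blast
    then obtain j where j: "j < length us" "w = us ! j" unfolding in_set_conv_nth by blast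
    then have "j < length us - Suc i" using e i order(3)[of j "length us - Suc i"] by simp
    then have "w \<in> set (take (length us - Suc i) us)" using j by (auto simp: in_set_conv_nth)
    then show "w \<in> set (drop (Suc i) (rev us))" by (simp add: drop_rev)
  qed
  have "kernel_product E m (rev us) = density (\<Pi>\<^sub>M i\<in>set (rev us). \<nu>) (joint (set (rev us)))"
    using order by (intro kernel_product_density assms parents) auto
  then show ?thesis by (simp add: bn_distribution_def us_def[symmetric] order(2) M_def)
qed

end

section \<open>Limits and polynomial families of densities\<close>

context product_reference
begin

definition ci_eq :: "(('v \<Rightarrow> real) \<Rightarrow> ennreal) \<Rightarrow> 'v set \<Rightarrow> ('v \<Rightarrow> real) set \<Rightarrow> ('v \<Rightarrow> real) set \<Rightarrow> ('v \<Rightarrow>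
    real) \<Rightarrow> bool"
where
  "ci_eq f C S T x \<longleftrightarrow> avg (V - C) (\<lambda>x. f x * indicator (S \<inter> T) x) x * avg (V - C) f x =
      avg (V - C) (\<lambda>x. f x * indicator S x) x * avg (V - C) (\<lambda>x. f x * indicator T x) x"

lemma cond_indep_iff_ci_eq:
  assumes "f \<in> borel_measurable M" "(\<integral>\<^sup>+ x. f x \<partial>M) = 1" "A \<subseteq> V" "B \<subseteq> V" "C \<subseteq> V"
  shows "cond_indep (density M f) A B C \<longleftrightarrow> (\<forall>EA\<in>sets (Xsp A). \<forall>EB\<in>sets (Xsp B).
    AE x in M. ci_eq f C {x \<in> space M. restrict x A \<in> EA} {x \<in> space M. restrict x B \<in> EB} x)"
  unfolding cond_indep_def proj_event_density ci_eq_def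
  using assms by (intro ball_cong refl cond_indep_event_iff proj_event_sets)

lemma enn2real_close:
  assumes "a \<le> b + h" "b \<le> a + h" "b < \<infinity>" "h < \<infinity>"
  shows "\<bar>enn2real a - enn2real b\<bar> \<le> enn2real h"
proof -
  have "a < \<infinity>" using assms by (metis ennreal_add_less_top infinity_ennreal_def order_le_less_trans)
  then obtain x y z where "a = ennreal x" "b = ennreal y" "h = ennreal z" "0 \<le> x" "0 \<le> y" "0 \<le> z"
    using assms by (metis enn2real_nonneg ennreal_enn2real infinity_ennreal_def)
  with assms show ?thesis by (simp add: ennreal_plus[symmetric] del: ennreal_plus)
qed

text \<open>The averages of the \<open>e n\<close> tend to 0 in mean, hence almost everywhere along a subsequence, and they bound
the differences of all averages that occur in the equation. Working with majorants \<open>e n\<close> avoids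
absolute differences of extended nonnegative functions.\<close>

lemma ci_eq_closed:
  assumes f [measurable]: "f \<in> borel_measurable M" and f1: "(\<integral>\<^sup>+ x. f x \<partial>M) = 1"
    and g [measurable]: "\<And>n. g n \<in> borel_measurable M"
    and e [measurable]: "\<And>n. e n \<in> borel_measurable M" and e_fin: "\<And>n. (\<integral>\<^sup>+ x. e n x \<partial>M) < \<infinity>"
    and e_lim: "(\<lambda>n. \<integral>\<^sup>+ x. e n x \<partial>M) \<longlonglongrightarrow> 0"
    and close: "\<And>n x. x \<in> space M \<Longrightarrow> g n x \<le> f x + e n x" "\<And>n x. x \<in> space M \<Longrightarrow> f x \<le> g n x + e n x"
    and S [measurable]: "S \<in> sets M" "T \<in> sets M"
    and ci: "\<And>n. AE x in M. ci_eq (g n) C S T x"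
  shows "AE x in M. ci_eq f C S T x"
proof -
  let ?D = "V - C"
  define h where "h n = avg ?D (e n)" for n
  have h_meas [measurable]: "h n \<in> borel_measurable M" for n unfolding h_def by measurable
  have h_int: "(\<integral>\<^sup>+ x. h n x \<partial>M) = (\<integral>\<^sup>+ x. e n x \<partial>M)" for n
    unfolding h_def by (rule nn_integral_avg) measurable
  have h_fin: "AE x in M. h n x < \<infinity>" for n
    using nn_integral_noteq_infinite[of "h n" M] e_fin[of n] by (simp add: h_int less_top)
  define u where "u n x = enn2real (h n x)" for n x
  have u_int: "(\<integral>\<^sup>+ x. ennreal (u n x) \<partial>M) = (\<integral>\<^sup>+ x. e n x \<partial>M)" for n
    unfolding h_int[symmetric] u_def using h_fin[of n]
    by (intro nn_integral_cong_AE) (auto elim!: eventually_mono)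
  have u_meas [measurable]: "u n \<in> borel_measurable M" for n unfolding u_def by measurable
  have u_integrable: "integrable M (u n)" for n
  proof (rule integrableI_nonneg)
    show "AE x in M. 0 \<le> u n x" by (simp add: u_def)
    show "(\<integral>\<^sup>+ x. ennreal (u n x) \<partial>M) < \<infinity>" using e_fin[of n] by (simp only: u_int)
  qed measurable
  have "(\<lambda>n. enn2real (\<integral>\<^sup>+ x. e n x \<partial>M)) \<longlonglongrightarrow> 0"
    using e_lim by (intro tendsto_enn2real) auto
  moreover have "enn2real (\<integral>\<^sup>+ x. e n x \<partial>M) = (LINT x|M. norm (u n x))" for n
  proof -
    have "(LINT x|M. norm (u n x)) = (LINT x|M. u n x)" by (simp add: u_def)
    also have "\<dots> = enn2real (\<integral>\<^sup>+ x. ennreal (u n x) \<partial>M)"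
      by (intro integral_eq_nn_integral) (auto simp: u_def)
    finally show ?thesis by (simp add: u_int)
  qed
  ultimately have "(\<lambda>n. LINT x|M. norm (u n x)) \<longlonglongrightarrow> 0" by simp
  then obtain \<rho> where \<rho>: "strict_mono \<rho>" "AE x in M. (\<lambda>n. u (\<rho> n) x) \<longlonglongrightarrow> 0"
    using tendsto_L1_AE_subseq[of M u] u_integrable by blast
  have all_fin: "AE x in M. \<forall>n. h n x < \<infinity>" using h_fin by (simp add: AE_all_countable)
  have all_ci: "AE x in M. \<forall>n. ci_eq (g n) C S T x" using ci by (simp add: AE_all_countable)
  show ?thesis
    using avg_finite[OF f f1, of ?D] all_fin all_ci \<rho>(2) AE_space
  proof eventually_elim
    case (elim x)
    note x = elim(5)
    have f_fin: "avg ?D (\<lambda>x. f x * indicator U x) x < \<infinity>" for U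
      using avg_indicator_le[OF f f1, of ?D U x] elim(1) by (rule order_le_less_trans)
    have lim: "(\<lambda>n. enn2real (avg ?D (\<lambda>x. g (\<rho> n) x * indicator U x) x)) \<longlonglongrightarrow>
        enn2real (avg ?D (\<lambda>x. f x * indicator U x) x)" if [measurable]: "U \<in> sets M" for U
    proof -
      have "\<bar>enn2real (avg ?D (\<lambda>x. g n x * indicator U x) x) - enn2real (avg ?D (\<lambda>x. f x * indicator U
          x) x)\<bar> \<le> u n x" for n
        unfolding u_def
      proof (rule enn2real_close[OF _ _ f_fin])
        show "h n x < \<infinity>" using elim(2) by blast
        have add: "avg ?D (\<lambda>x. k x * indicator U x) x + h n x = avg ?D (\<lambda>x. k x * indicator U x + e n
            x) x"
          if [measurable]: "k \<in> borel_measurable M" for k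
          unfolding avg_def h_def
          using measurable_compose[OF measurable_mix1[OF x]] x
          by (intro nn_integral_add[symmetric]) (auto intro!: borel_measurable_times_ennreal)
        show "avg ?D (\<lambda>x. g n x * indicator U x) x \<le> avg ?D (\<lambda>x. f x * indicator U x) x + h n x"
          unfolding add[OF f] using close(1) by (intro avg_mono) (simp add: indicator_def)
        show "avg ?D (\<lambda>x. f x * indicator U x) x \<le> avg ?D (\<lambda>x. g n x * indicator U x) x + h n x"
          unfolding add[OF g] using close(2) by (intro avg_mono) (simp add: indicator_def)
      qed
      then show ?thesis
        by (intro LIM_zero_cancel[OF tendsto_rabs_zero_cancel[OF tendsto_sandwich[OF _ _ tendsto_const
            elim(4)]]]) auto
    qed
    have one: "avg ?D k x = avg ?D (\<lambda>x. k x * indicator (space M) x) x" for k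
      by (intro avg_cong) simp
    have ciR: "enn2real (avg ?D (\<lambda>x. g (\<rho> n) x * indicator (S \<inter> T) x) x) *
          enn2real (avg ?D (\<lambda>x. g (\<rho> n) x * indicator (space M) x) x) =
        enn2real (avg ?D (\<lambda>x. g (\<rho> n) x * indicator S x) x) *
          enn2real (avg ?D (\<lambda>x. g (\<rho> n) x * indicator T x) x)" for n
      using elim(3) by (simp add: ci_eq_def one[symmetric] enn2real_mult[symmetric])
    have "S \<inter> T \<in> sets M" using S by auto
    have "enn2real (avg ?D (\<lambda>x. f x * indicator (S \<inter> T) x) x) *
          enn2real (avg ?D (\<lambda>x. f x * indicator (space M) x) x) =
        enn2real (avg ?D (\<lambda>x. f x * indicator S x) x) *
          enn2real (avg ?D (\<lambda>x. f x * indicator T x) x)"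
      by (rule LIMSEQ_unique[OF tendsto_mult[OF lim[OF \<open>S \<inter> T \<in> sets M\<close>] lim[OF sets.top]]])
        (unfold ciR, rule tendsto_mult[OF lim[OF S(1)] lim[OF S(2)]])
    then have "ennreal (enn2real (avg ?D (\<lambda>x. f x * indicator (S \<inter> T) x) x) * enn2real (avg ?D f x)) =
        ennreal (enn2real (avg ?D (\<lambda>x. f x * indicator S x) x) * enn2real (avg ?D (\<lambda>x. f x * indicator
            T x) x))"
      by (simp add: one[symmetric])
    then show ?case using f_fin elim(1) unfolding ci_eq_def
      by (simp add: ennreal_mult)
  qed
qed

text \<open>At almost every point the averages are polynomials in the parameter, so the equation says that some
polynomial vanishes. One with infinitely many roots is zero.\<close>

lemma ci_eq_polynomial:
  fixes p :: "'j \<Rightarrow> real poly"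
  assumes J: "finite J" and F [measurable]: "\<And>j. j \<in> J \<Longrightarrow> F j \<in> borel_measurable M"
    and F1: "\<And>j. j \<in> J \<Longrightarrow> (\<integral>\<^sup>+ x. F j x \<partial>M) = 1"
    and p: "\<And>j t. j \<in> J \<Longrightarrow> 0 \<le> t \<Longrightarrow> t \<le> 1 \<Longrightarrow> 0 \<le> poly (p j) t"
    and f: "\<And>t x. x \<in> space M \<Longrightarrow> f t x = (\<Sum>j\<in>J. ennreal (poly (p j) t) * F j x)"
    and t: "inj t" "\<And>k :: nat. 0 \<le> t k \<and> t k \<le> 1" and s: "0 \<le> s" "s \<le> 1"
    and S [measurable]: "S \<in> sets M" "T \<in> sets M"
    and ci: "\<And>k. AE x in M. ci_eq (f (t k)) C S T x"
  shows "AE x in M. ci_eq (f s) C S T x"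
proof -
  let ?D = "V - C"
  have fin: "AE x in M. \<forall>j\<in>J. avg ?D (F j) x < \<infinity>"
    using avg_finite[OF F F1, of _ ?D] J by (simp add: AE_finite_all)
  have all: "AE x in M. \<forall>k. ci_eq (f (t k)) C S T x" using ci by (simp add: AE_all_countable)
  show ?thesis using fin all AE_space
  proof eventually_elim
    case (elim x)
    define c where "c U j = enn2real (avg ?D (\<lambda>x. F j x * indicator U x) x)" for U j
    define P where "P U = (\<Sum>j\<in>J. smult (c U j) (p j))" for U
    have val: "avg ?D (\<lambda>x. f t x * indicator U x) x = ennreal (poly (P U) t)"
      and nonneg: "0 \<le> poly (P U) t"
      if t: "0 \<le> t" "t \<le> 1" and [measurable]: "U \<in> sets M" for t U
    proof -
      have "avg ?D (\<lambda>x. f t x * indicator U x) x =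
          (\<integral>\<^sup>+ y. (\<Sum>j\<in>J. ennreal (poly (p j) t) * (F j (mix ?D x y) * indicator U (mix ?D x y))) \<partial>M)"
        unfolding avg_def by (intro nn_integral_cong) (simp add: f sum_distrib_right mult.assoc)
      also have "\<dots> = (\<Sum>j\<in>J. ennreal (poly (p j) t) * avg ?D (\<lambda>x. F j x * indicator U x) x)"
      proof -
        have "(\<lambda>y. F j (mix ?D x y) * indicator U (mix ?D x y)) \<in> borel_measurable M" if "j \<in> J" for j
          using measurable_compose[OF measurable_mix1[OF elim(3)] F[OF that]]
            measurable_compose[OF measurable_mix1[OF elim(3)] borel_measurable_indicator[OF \<open>U \<in> sets M\<close>]]
          by (rule borel_measurable_times_ennreal)
        then show ?thesis unfolding avg_def
          by (subst nn_integral_sum) (auto intro!: sum.cong nn_integral_cmult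
            borel_measurable_times_ennreal[OF borel_measurable_const])
      qed
      also have "\<dots> = (\<Sum>j\<in>J. ennreal (poly (p j) t * c U j))"
      proof (rule sum.cong[OF refl])
        fix j assume j: "j \<in> J"
        have "avg ?D (\<lambda>x. F j x * indicator U x) x < \<infinity>"
          using avg_indicator_le[OF F[OF j] F1[OF j], of ?D U x] elim(1) j by (auto intro:
              order_le_less_trans)
        then have "avg ?D (\<lambda>x. F j x * indicator U x) x = ennreal (c U j)" by (simp add: c_def)
        then show "ennreal (poly (p j) t) * avg ?D (\<lambda>x. F j x * indicator U x) x = ennreal (poly (p j)
            t * c U j)"
          using p[OF j t] by (simp add: ennreal_mult c_def)
      qed
      also have "\<dots> = ennreal (\<Sum>j\<in>J. poly (p j) t * c U j)"
        using p t by (intro sum_ennreal) (auto simp: c_def)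
      finally show "avg ?D (\<lambda>x. f t x * indicator U x) x = ennreal (poly (P U) t)"
        by (simp add: P_def poly_sum mult.commute)
      show "0 \<le> poly (P U) t" using p t by (auto simp: P_def poly_sum c_def intro!: sum_nonneg)
    qed
    have ST: "S \<inter> T \<in> sets M" using S by auto
    have one: "avg ?D k x = avg ?D (\<lambda>x. k x * indicator (space M) x) x" for k
      by (intro avg_cong) simp
    define Q where "Q = P (S \<inter> T) * P (space M) - P S * P T"
    have iff: "ci_eq (f t) C S T x \<longleftrightarrow> poly Q t = 0" if t: "0 \<le> t" "t \<le> 1" for t
    proof -
      have "ci_eq (f t) C S T x \<longleftrightarrow> ennreal (poly (P (S \<inter> T)) t * poly (P (space M)) t) = ennreal (poly
          (P S) t * poly (P T) t)"
        unfolding ci_eq_def one[of "f t"] using t ST S nonneg by (simp add: val ennreal_mult)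
      also have "\<dots> \<longleftrightarrow> poly (P (S \<inter> T)) t * poly (P (space M)) t = poly (P S) t * poly (P T) t"
        using t ST S nonneg by (intro ennreal_inj mult_nonneg_nonneg) auto
      finally show ?thesis by (simp add: Q_def)
    qed
    have "range t \<subseteq> {z. poly Q z = 0}" using elim(2) iff t(2) by auto
    then have "infinite {z. poly Q z = 0}"
      using t(1) by (meson finite_subset range_inj_infinite)
    then have "Q = 0" using poly_roots_finite by blast
    then show ?case using iff[OF s] by simp
  qed
qed

end

section \<open>Densities with a modulus of continuity\<close>

lemma euclid_dist_component:
  assumes "finite A" "a \<in> A"
  shows "\<bar>x a - y a\<bar> \<le> euclid_dist A x y"
  using member_le_L2_set[OF assms, of "\<lambda>a. \<bar>x a - y a\<bar>"] unfolding euclid_dist_def L2_set_def by simp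

text \<open>Concavity puts \<open>\<omega>\<close> above its chord from 0 to a point where it is positive, and nonnegativity keeps it from
decreasing afterwards. Hence functions with a small bound and a small Lipschitz constant admit \<open>\<omega>\<close>.\<close>

lemma modulus_lower_bound:
  assumes "concave_modulus \<omega>"
  obtains b L where "0 < b" "0 < L" "\<And>t. 0 \<le> t \<Longrightarrow> min b (L * t) \<le> \<omega> t"
proof -
  have nn: "0 \<le> \<omega> t" if "0 \<le> t" for t using assms that by (simp add: concave_modulus_def)
  have z: "\<omega> 0 = 0" and conc: "concave_on {0..} \<omega>" using assms by (simp_all add: concave_modulus_def)
  have cD: "(1 - l) * \<omega> x + l * \<omega> y \<le> \<omega> ((1 - l) * x + l * y)" if "0 \<le> l" "l \<le> 1" "0 \<le> x" "0 \<le> y" for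
      l x y
    using concave_onD[OF conc, of l x y] that by simp
  obtain t0 where t0: "0 \<le> t0" "\<omega> t0 \<noteq> 0" using assms unfolding concave_modulus_def by blast
  then have pos: "0 < t0" "0 < \<omega> t0" using z nn[of t0] by (auto simp: order_le_less)
  show ?thesis
  proof
    show "0 < \<omega> t0" "0 < \<omega> t0 / t0" using pos by simp_all
    fix t :: real assume t: "0 \<le> t"
    show "min (\<omega> t0) (\<omega> t0 / t0 * t) \<le> \<omega> t"
    proof (cases "t \<le> t0")
      case True
      then have "t / t0 * \<omega> t0 \<le> \<omega> t" using cD[of "t / t0" 0 t0] t pos z by simp
      then show ?thesis by (simp add: min.coboundedI2 mult.commute)
    next
      case False
      have "\<omega> t0 \<le> \<omega> t"
      proof (rule ccontr)
        assume "\<not> \<omega> t0 \<le> \<omega> t"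
        \<comment> \<open>extrapolating the descent from \<open>t0\<close> to \<open>t\<close> would make \<open>\<omega>\<close> negative\<close>
        define l where "l = (\<omega> t0 - \<omega> t) / (2 * \<omega> t0)"
        have l: "0 < l" "l < 1" using \<open>\<not> \<omega> t0 \<le> \<omega> t\<close> pos nn[OF t] by (auto simp: l_def divide_less_eq)
        define T where "T = t0 + (t - t0) / l"
        have "0 \<le> T" using False pos l by (simp add: T_def)
        have "(1 - l) * t0 + l * T = t" using l by (simp add: T_def field_simps)
        with cD[of l t0 T] l pos \<open>0 \<le> T\<close> have "(1 - l) * \<omega> t0 + l * \<omega> T \<le> \<omega> t" by simp
        moreover have "0 \<le> l * \<omega> T" using l nn[OF \<open>0 \<le> T\<close>] by simp
        moreover have "(1 - l) * \<omega> t0 = \<omega> t0 - (\<omega> t0 - \<omega> t) / 2" using pos by (simp add: l_def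
            field_simps)
        ultimately show False using \<open>\<not> \<omega> t0 \<le> \<omega> t\<close> by (simp add: field_simps)
      qed
      then show ?thesis by simp
    qed
  qed
qed

text \<open>A function with a modulus is continuous. The index type need not be countable, so the coordinates are
renumbered by natural numbers, where the product topology has the product \<open>\<sigma>\<close>-algebra as its Borel sets.\<close>

lemma admits_modulus_measurable:
  assumes A: "finite A" and \<omega>: "concave_modulus \<omega>" and p: "admits_modulus A \<omega> p"
  shows "p \<in> borel_measurable (Xsp A)"
proof -
  obtain e where e: "bij_betw e {0..<card A} A" using ex_bij_betw_nat_finite[OF A] by blast
  define idx where "idx = the_inv_into {0..<card A} e"
  have idx: "e (idx a) = a" if "a \<in> A" for a
    using that e unfolding idx_def by (intro f_the_inv_into_f_bij_betw) auto
  define c :: "(nat \<Rightarrow> real) \<Rightarrow> _" where "c y = (\<lambda>a\<in>A. y (idx a))" for y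
  have "continuous_on UNIV (\<lambda>y. p (c y))"
    unfolding continuous_on_def
  proof
    fix y0 :: "nat \<Rightarrow> real"
    have coord: "((\<lambda>y. y i) \<longlongrightarrow> y0 i) (at y0)" for i
      using continuous_on_product_coordinates[of i] unfolding continuous_on_def by auto
    have "((\<lambda>y. L2_set (\<lambda>a. y (idx a) - y0 (idx a)) A) \<longlongrightarrow> L2_set (\<lambda>a. y0 (idx a) - y0 (idx a)) A) (at y0)"
      unfolding L2_set_def by (intro tendsto_intros coord)
    then have d: "((\<lambda>y. euclid_dist A (c y) (c y0)) \<longlongrightarrow> 0) (at y0)"
      by (simp add: euclid_dist_def c_def L2_set_def cong: sum.cong)
    have lim: "((\<lambda>y. \<omega> (euclid_dist A (c y) (c y0))) \<longlongrightarrow> 0) (at y0)"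
    proof (rule tendstoI)
      fix \<epsilon> :: real assume "0 < \<epsilon>"
      have "(\<omega> \<longlongrightarrow> 0) (at_right 0)" using \<omega> by (simp add: concave_modulus_def)
      from tendstoD[OF this \<open>0 < \<epsilon>\<close>] obtain \<delta> where \<delta>: "0 < \<delta>" "\<And>t. 0 < t \<Longrightarrow> t < \<delta> \<Longrightarrow> dist (\<omega> t) 0 < \<epsilon>"
        unfolding eventually_at_right_field by auto
      have "\<omega> 0 = 0" using \<omega> by (simp add: concave_modulus_def)
      have "eventually (\<lambda>y. euclid_dist A (c y) (c y0) < \<delta>) (at y0)"
        using order_tendstoD(2)[OF d \<delta>(1)] .
      then show "eventually (\<lambda>y. dist (\<omega> (euclid_dist A (c y) (c y0))) 0 < \<epsilon>) (at y0)"
      proof eventually_elim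
        case (elim y)
        have "0 \<le> euclid_dist A (c y) (c y0)" by (simp add: euclid_dist_def)
        then show ?case using elim \<delta>(2) \<open>\<omega> 0 = 0\<close> \<open>0 < \<epsilon>\<close>
          by (cases "euclid_dist A (c y) (c y0) = 0") auto
      qed
    qed
    have le: "\<bar>p (c y) - p (c y0)\<bar> \<le> \<omega> (euclid_dist A (c y) (c y0))" for y
      using p unfolding admits_modulus_def by (simp add: c_def space_PiM)
    have "((\<lambda>y. \<bar>p (c y) - p (c y0)\<bar>) \<longlongrightarrow> 0) (at y0)"
      by (rule tendsto_sandwich[OF _ _ tendsto_const lim]) (simp_all add: le)
    then have "((\<lambda>y. p (c y)) \<longlongrightarrow> p (c y0)) (at y0)"
      by (rule LIM_zero_cancel[OF tendsto_rabs_zero_cancel])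
    then show "((\<lambda>y. p (c y)) \<longlongrightarrow> p (c y0)) (at y0 within UNIV)" by simp
  qed
  then have "(\<lambda>y. p (c y)) \<in> borel_measurable borel" by (rule borel_measurable_continuous_onI)
  then have m: "(\<lambda>y. p (c y)) \<in> borel_measurable (\<Pi>\<^sub>M i\<in>UNIV. borel)"
    by (subst measurable_cong_sets[OF sets_PiM_equal_borel refl])
  have "(\<lambda>x i. if i < card A then x (e i) else 0) \<in> Xsp A \<rightarrow>\<^sub>M (\<Pi>\<^sub>M i\<in>UNIV. borel)"
  proof (rule measurable_PiM_single')
    fix i :: nat
    show "(\<lambda>x. if i < card A then x (e i) else 0) \<in> borel_measurable (Xsp A)"
      using bij_betw_apply[OF e, of i]
      by (cases "i < card A") (auto intro!: measurable_component_singleton)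
  qed auto
  from measurable_compose[OF this m]
  have "(\<lambda>x. p (c (\<lambda>i. if i < card A then x (e i) else 0))) \<in> borel_measurable (Xsp A)" .
  moreover have "c (\<lambda>i. if i < card A then x (e i) else 0) = x" if "x \<in> space (Xsp A)" for x
  proof -
    have "idx a < card A" if "a \<in> A" for a
      using that e the_inv_into_into[of e "{0..<card A}" a "{0..<card A}"]
      by (auto simp: idx_def bij_betw_def)
    then show ?thesis using that idx by (auto simp: c_def space_PiM PiE_def extensional_def fun_eq_iff)
  qed
  ultimately show ?thesis by (subst measurable_cong[where g = "\<lambda>x. p (c (\<lambda>i. if i < card A then x (e
      i) else 0))"]) auto
qed

lemma pa_finite: "dag V E \<Longrightarrow> finite (family E v)"
  by (rule finite_subset[of _ "insert v V"]) (auto simp: dag_def pa_def)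

lemma update_in_Xsp: "x \<in> space (Xsp A) \<Longrightarrow> x(v := y) \<in> space (Xsp (insert v A))"
  by (auto simp: space_PiM PiE_def extensional_def)

definition density_net :: "'v set \<Rightarrow> ('v \<times> 'v) set \<Rightarrow> ('v \<Rightarrow> ('v \<Rightarrow> real) \<Rightarrow> real) \<Rightarrow> 'v bayes_net" where
  "density_net V E p = (\<lambda>v\<in>V. \<lambda>x\<in>space (Xsp (pa E v)). density lborel (\<lambda>y. ennreal (p v (x(v := y)))))"

lemma density_net_eqb:
  assumes dag: "dag V E" and \<omega>: "concave_modulus \<omega>"
    and bound: "\<And>v z. v \<in> V \<Longrightarrow> z \<in> space (Xsp (family E v)) \<Longrightarrow> 0 \<le> p v z \<and> p v z \<le> K"
    and modulus: "\<And>v. v \<in> V \<Longrightarrow> admits_modulus (family E v) \<omega> (p v)"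
    and one: "\<And>v x. v \<in> V \<Longrightarrow> x \<in> space (Xsp (pa E v)) \<Longrightarrow> (\<integral>\<^sup>+ y. ennreal (p v (x(v := y))) \<partial>lborel) = 1"
  shows "density_net V E p \<in> eqb_bayes_nets V E K \<omega>"
proof -
  have "density_net V E p v \<in> extensional (space (Xsp (pa E v))) \<inter> measurable (Xsp (pa E v))
      (prob_algebra borel)"
    if v: "v \<in> V" for v
  proof
    show "density_net V E p v \<in> extensional (space (Xsp (pa E v)))"
      using v by (simp add: density_net_def)
    have pm: "p v \<in> borel_measurable (Xsp (family E v))"
      using pa_finite[OF dag] \<omega> modulus[OF v] by (rule admits_modulus_measurable)
    have up: "(\<lambda>z. (fst z)(v := snd z)) \<in> Xsp (pa E v) \<Otimes>\<^sub>M borel \<rightarrow>\<^sub>M Xsp (family E v)"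
      using measurable_add_dim[of v "pa E v" "\<lambda>_. borel"] by (simp add: case_prod_beta')
    have up1: "(\<lambda>y. x(v := y)) \<in> borel \<rightarrow>\<^sub>M Xsp (family E v)" if "x \<in> space (Xsp (pa E v))" for x
      using measurable_compose[OF measurable_Pair1'[OF that] up] by simp
    have m1: "(\<lambda>y. ennreal (p v (x(v := y)))) \<in> borel_measurable lborel" if "x \<in> space (Xsp (pa E v))"
        for x
      using measurable_compose[OF measurable_compose[OF up1[OF that] pm] measurable_ennreal] by simp
    have "(\<lambda>x. density lborel (\<lambda>y. ennreal (p v (x(v := y))))) \<in> Xsp (pa E v) \<rightarrow>\<^sub>M prob_algebra borel"
    proof (rule measurable_prob_algebraI)
      show ps: "prob_space (density lborel (\<lambda>y. ennreal (p v (x(v := y)))))" if "x \<in> space (Xsp (pa E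
          v))" for x
        using m1[OF that] one[OF v that]
        by (intro prob_spaceI) (simp add: emeasure_density cong: nn_integral_cong)
      show "(\<lambda>x. density lborel (\<lambda>y. ennreal (p v (x(v := y))))) \<in> Xsp (pa E v) \<rightarrow>\<^sub>M subprob_algebra borel"
      proof (rule measurable_subprob_algebra)
        fix S :: "real set" assume S: "S \<in> sets borel"
        have "(\<lambda>z. ennreal (p v ((fst z)(v := snd z))) * indicator S (snd z)) \<in> borel_measurable (Xsp
            (pa E v) \<Otimes>\<^sub>M borel)"
          using measurable_compose[OF measurable_compose[OF up pm] measurable_ennreal]
            measurable_compose[OF measurable_snd borel_measurable_indicator[OF S]]
          by (rule borel_measurable_times_ennreal)
        then have "(\<lambda>z. ennreal (p v ((fst z)(v := snd z))) * indicator S (snd z)) \<in> borel_measurable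
            (Xsp (pa E v) \<Otimes>\<^sub>M lborel)"
          by (simp add: measurable_cong_sets[OF sets_pair_measure_cong[OF refl sets_lborel] refl])
        then have "(\<lambda>x. \<integral>\<^sup>+ y. ennreal (p v (x(v := y))) * indicator S y \<partial>lborel) \<in> borel_measurable
            (Xsp (pa E v))"
          by (intro lborel.borel_measurable_nn_integral) (simp add: case_prod_beta')
        then show "(\<lambda>x. emeasure (density lborel (\<lambda>y. ennreal (p v (x(v := y))))) S) \<in>
            borel_measurable (Xsp (pa E v))"
          using m1 S by (subst measurable_cong) (auto simp: emeasure_density)
      qed (use ps in \<open>auto intro: prob_space_imp_subprob_space\<close>)
    qed
    then show "density_net V E p v \<in> measurable (Xsp (pa E v)) (prob_algebra borel)"
      using v by (subst measurable_cong[where g = "\<lambda>x. density lborel (\<lambda>y. ennreal (p v (x(v := y))))"])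
        (auto simp: density_net_def)
  qed
  then have "density_net V E p \<in> bayes_nets V E"
    unfolding bayes_nets_def by (intro PiE_I) (auto simp: density_net_def)
  then show ?thesis
    unfolding eqb_bayes_nets_def using bound modulus by (auto simp: density_net_def intro!: exI[of _
        "p _"])
qed

section \<open>Distance of networks and of their joint densities\<close>

lemma ennreal_le_add_diff: "(a :: ennreal) \<le> b + (a - b)"
proof (cases "b \<le> a")
  case True
  then show ?thesis by (simp add: add_diff_inverse_ennreal)
next
  case False
  then have "a \<le> b + 0" by simp
  also have "\<dots> \<le> b + (a - b)" by (intro add_left_mono) simp
  finally show ?thesis .
qed

text \<open>The event \<open>{g < f}\<close> witnesses the bound.\<close>

lemma nn_integral_diff_tv:
  assumes [measurable]: "f \<in> borel_measurable \<nu>" "g \<in> borel_measurable \<nu>"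
    and f: "density \<nu> f \<in> space (prob_algebra N)" and g: "density \<nu> g \<in> space (prob_algebra N)"
  shows "(\<integral>\<^sup>+ y. f y - g y \<partial>\<nu>) \<le> ennreal (tv_dist (density \<nu> f) (density \<nu> g))"
proof -
  interpret f: prob_space "density \<nu> f" using f by (simp add: space_prob_algebra)
  interpret g: prob_space "density \<nu> g" using g by (simp add: space_prob_algebra)
  have N: "sets \<nu> = sets N" using f by (simp add: space_prob_algebra)
  define S where "S = {y \<in> space \<nu>. g y < f y}"
  have S [measurable]: "S \<in> sets \<nu>" unfolding S_def by measurable
  have mS: "emeasure (density \<nu> h) S = (\<integral>\<^sup>+ y. h y * indicator S y \<partial>\<nu>)" if "h \<in> borel_measurable \<nu>" for h
    using that S by (rule emeasure_density)
  have "(\<integral>\<^sup>+ y. f y - g y \<partial>\<nu>) = (\<integral>\<^sup>+ y. f y * indicator S y - g y * indicator S y \<partial>\<nu>)"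
  proof (rule nn_integral_cong_AE)
    have "(\<integral>\<^sup>+ y. f y \<partial>\<nu>) = 1"
      using f.emeasure_space_1 by (simp add: emeasure_density cong: nn_integral_cong)
    then have "AE y in \<nu>. f y \<noteq> \<infinity>" by (intro nn_integral_noteq_infinite) simp_all
    then show "AE y in \<nu>. f y - g y = f y * indicator S y - g y * indicator S y"
      using AE_space
    proof eventually_elim
      case (elim y)
      then show ?case
        by (cases "y \<in> S") (auto simp: S_def diff_eq_0_iff_ennreal less_top)
    qed
  qed
  also have "\<dots> = emeasure (density \<nu> f) S - emeasure (density \<nu> g) S"
    unfolding mS[OF assms(1)] mS[OF assms(2)]
  proof (rule nn_integral_diff)
    show "(\<integral>\<^sup>+ y. g y * indicator S y \<partial>\<nu>) \<noteq> \<infinity>"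
      using g.emeasure_finite[of S] mS[OF assms(2)] by simp
  qed (auto simp: S_def indicator_def)
  also have "\<dots> = ennreal (measure (density \<nu> f) S - measure (density \<nu> g) S)"
    by (simp add: f.emeasure_eq_measure g.emeasure_eq_measure ennreal_minus)
  also have "\<dots> \<le> ennreal (tv_dist (density \<nu> f) (density \<nu> g))"
    using tv_dist_upper[OF f g, of S] S N by (intro ennreal_leI) auto
  finally show ?thesis .
qed

lemma tv_dist_le_SUP:
  assumes "m \<in> bayes_nets V E" "m' \<in> bayes_nets V E" "v \<in> V" "x \<in> space (Xsp (pa E v))"
  shows "tv_dist (m v x) (m' v x) \<le> (SUP x\<in>space (Xsp (pa E v)). tv_dist (m v x) (m' v x))"
  using assms by (intro cSUP_upper kernel_tv_bdd)

context factorized_density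
begin

text \<open>The kernels are replaced one after the other, a vertex without children first: replacing its kernel costs
the \<open>L\<^sup>1\<close> distance of the two conditional densities, averaged over a probability density, and passing
from the remaining factors to the full product does not change their distance.\<close>

lemma joint_close:
  assumes r': "factorized_density \<nu> V E r'"
    and m: "m \<in> bayes_nets V E" "m' \<in> bayes_nets V E"
    and kernel: "\<And>v x. v \<in> V \<Longrightarrow> x \<in> space (Xsp (pa E v)) \<Longrightarrow> m v x = density \<nu> (\<lambda>y. r v (x(v := y)))"
      "\<And>v x. v \<in> V \<Longrightarrow> x \<in> space (Xsp (pa E v)) \<Longrightarrow> m' v x = density \<nu> (\<lambda>y. r' v (x(v := y)))"
  shows "\<exists>e. e \<in> borel_measurable M \<and> (\<integral>\<^sup>+ x. e x \<partial>M) \<le> ennreal (2 * bn_dist V E m m') \<and>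
    (\<forall>x\<in>space M. joint V x \<le> factorized_density.joint E r' V x + e x \<and>
      factorized_density.joint E r' V x \<le> joint V x + e x)"
proof -
  interpret r': factorized_density \<nu> V E r' by (rule r')
  define s where "s v = (SUP x\<in>space (Xsp (pa E v)). tv_dist (m v x) (m' v x))" for v
  have s0: "0 \<le> s v" if "v \<in> V" for v
  proof -
    obtain x where x: "x \<in> space (Xsp (pa E v))" using Xsp_space_nonempty by blast
    have "0 \<le> tv_dist (m v x) (m' v x)"
      by (rule tv_dist_nonneg[OF bayes_nets_kernel[OF m(1) that x] bayes_nets_kernel[OF m(2) that x]])
    also have "\<dots> \<le> s v" unfolding s_def by (rule tv_dist_le_SUP[OF m that x])
    finally show ?thesis .
  qed
  have "\<exists>e. e \<in> borel_measurable M \<and> ignores (V - W) e \<and>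
      (\<integral>\<^sup>+ x. e x \<partial>M) \<le> ennreal (2 * (\<Sum>v\<in>W. s v)) \<and>
      (\<forall>x\<in>space M. joint W x \<le> r'.joint W x + e x \<and> r'.joint W x \<le> joint W x + e x)"
    if "ancestral W" for W
    using that
  proof (induction "card W" arbitrary: W)
    case 0
    then have "finite W" using finite_V by (auto simp: ancestral_def intro: finite_subset)
    with 0 have "W = {}" by simp
    then show ?case by (intro exI[of _ "\<lambda>_. 0"]) (simp add: joint_def r'.joint_def ignores_const)
  next
    case (Suc k)
    then have WV: "W \<subseteq> V" by (simp add: ancestral_def)
    then have fin: "finite W" using finite_V by (rule finite_subset)
    from Suc have "W \<noteq> {}" by auto
    then obtain v where v: "v \<in> W" "\<And>w. w \<in> W \<Longrightarrow> (v, w) \<notin> E"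
      using sink_exists[of W] WV by blast
    then have vV: "v \<in> V" using WV by blast
    define W' where "W' = W - {v}"
    have W': "ancestral W'" "W' \<subseteq> V"
      using Suc.prems v by (auto simp: ancestral_def W'_def pa_def)
    have "k = card W'" using Suc.hyps(2) v fin by (simp add: W'_def)
    from Suc.hyps(1)[OF this W'(1)] obtain e where e [measurable]: "e \<in> borel_measurable M"
      and e_ig: "ignores (V - W') e" and e_int: "(\<integral>\<^sup>+ x. e x \<partial>M) \<le> ennreal (2 * (\<Sum>v\<in>W'. s v))"
      and e_le: "\<And>x. x \<in> space M \<Longrightarrow> joint W' x \<le> r'.joint W' x + e x"
        "\<And>x. x \<in> space M \<Longrightarrow> r'.joint W' x \<le> joint W' x + e x" by blast
    have ev: "ignores {v} e" by (rule ignores_mono[OF e_ig]) (use vV in \<open>auto simp: W'_def\<close>)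
    have jv: "ignores {v} (r'.joint W')"
      using W' v by (intro r'.ignores_joint) (auto simp: W'_def pa_def)
    define d0 where "d0 z = (r v z - r' v z) + (r' v z - r v z)" for z
    have [measurable]: "r v \<in> borel_measurable (Xsp (family E v))" "r' v \<in> borel_measurable (Xsp
        (family E v))"
      using measurable_r[OF vV] r'.measurable_r[OF vV] .
    have d0 [measurable]: "d0 \<in> borel_measurable (Xsp (family E v))" unfolding d0_def by measurable
    define d where "d x = d0 (restrict x (family E v))" for x
    have d_meas [measurable]: "d \<in> borel_measurable M"
      unfolding d_def using vV pa_subset
      by (intro measurable_compose[OF restrict_measurable_M d0]) auto
    have d_avg: "avg {v} d x \<le> ennreal (2 * s v)" if x: "x \<in> space M" for x
    proof -
      let ?x = "restrict x (pa E v)"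
      have px: "?x \<in> space (Xsp (pa E v))" by (simp add: space_Xsp)
      have up: "(\<lambda>t. ?x(v := t)) \<in> \<nu> \<rightarrow>\<^sub>M Xsp (family E v)"
        using measurable_compose[OF measurable_Pair1'[OF px, of borel] measurable_add_dim[of v "pa E
            v" "\<lambda>_. borel"]]
        by (simp add: measurable_cong_sets[OF sets_nu refl])
      have mr: "(\<lambda>t. r v (?x(v := t))) \<in> borel_measurable \<nu>" "(\<lambda>t. r' v (?x(v := t))) \<in>
          borel_measurable \<nu>"
        using measurable_compose[OF up measurable_r[OF vV]] measurable_compose[OF up
            r'.measurable_r[OF vV]] .
      note [measurable] = mr
      have pr: "density \<nu> (\<lambda>t. r v (?x(v := t))) \<in> space (prob_algebra borel)"
        "density \<nu> (\<lambda>t. r' v (?x(v := t))) \<in> space (prob_algebra borel)"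
        using bayes_nets_kernel[OF m(1) vV px] bayes_nets_kernel[OF m(2) vV px] by (simp_all add:
            kernel vV px)
      have "avg {v} d x = (\<integral>\<^sup>+ t. d0 (?x(v := t)) \<partial>\<nu>)"
        unfolding d_def[abs_def] by (rule avg_local[OF vV x d0])
      also have "\<dots> = (\<integral>\<^sup>+ t. r v (?x(v := t)) - r' v (?x(v := t)) \<partial>\<nu>) +
          (\<integral>\<^sup>+ t. r' v (?x(v := t)) - r v (?x(v := t)) \<partial>\<nu>)"
        unfolding d0_def by (intro nn_integral_add) measurable
      also have "\<dots> \<le> ennreal (tv_dist (m v ?x) (m' v ?x)) + ennreal (tv_dist (m' v ?x) (m v ?x))"
        unfolding kernel(1)[OF vV px] kernel(2)[OF vV px]
        by (intro add_mono nn_integral_diff_tv[OF mr pr] nn_integral_diff_tv[OF mr(2,1) pr(2,1)])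
      also have "tv_dist (m' v ?x) (m v ?x) = tv_dist (m v ?x) (m' v ?x)"
        by (rule tv_dist_commute[OF bayes_nets_kernel[OF m(2) vV px] bayes_nets_kernel[OF m(1) vV px]])
      also have "ennreal (tv_dist (m v ?x) (m' v ?x)) + ennreal (tv_dist (m v ?x) (m' v ?x)) \<le> ennreal
          (s v) + ennreal (s v)"
        using tv_dist_le_SUP[OF m vV px] unfolding s_def by (intro add_mono ennreal_leI)
      also have "\<dots> = ennreal (2 * s v)" using s0[OF vV] by (simp add: ennreal_plus[symmetric] del:
          ennreal_plus)
      finally show ?thesis .
    qed
    have split: "joint W x = joint W' x * factor v x" "r'.joint W x = r'.joint W' x * r'.factor v x" for x
      using fin v by (auto simp: joint_def r'.joint_def W'_def prod.remove[of W v] mult.commute)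
    have fd: "factor v x \<le> r'.factor v x + d x" "r'.factor v x \<le> factor v x + d x" for x
      unfolding factor_def r'.factor_def d_def d0_def
      by (rule order_trans[OF ennreal_le_add_diff add_left_mono], simp)+
    let ?e = "\<lambda>x. e x * factor v x + r'.joint W' x * d x"
    have [measurable]: "factor v \<in> borel_measurable M" "r'.joint W' \<in> borel_measurable M"
      using vV W' by auto
    show ?case
    proof (intro exI[of _ ?e] conjI ballI)
      show "?e \<in> borel_measurable M" by measurable
      have "ignores (V - W) d"
        unfolding d_def using vV pa_subset v Suc.prems by (intro ignores_restrict) (auto simp:
            ancestral_def)
      moreover have "ignores (V - W) e" using e_ig by (rule ignores_mono) (auto simp: W'_def)
      moreover have "ignores (V - W) (factor v)"
        using v Suc.prems vV by (intro ignores_factor) (auto simp: ancestral_def)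
      moreover have "ignores (V - W) (r'.joint W')"
        using W' by (intro r'.ignores_joint) (auto simp: ancestral_def W'_def)
      ultimately show "ignores (V - W) ?e" by (simp add: ignores_def)
      have "(\<integral>\<^sup>+ x. e x * factor v x \<partial>M) = (\<integral>\<^sup>+ x. avg {v} (\<lambda>x. e x * factor v x) x \<partial>M)"
        by (rule nn_integral_avg[symmetric]) measurable
      also have "\<dots> = (\<integral>\<^sup>+ x. e x * avg {v} (factor v) x \<partial>M)"
        by (intro nn_integral_cong avg_pull ev) auto
      also have "\<dots> = (\<integral>\<^sup>+ x. e x \<partial>M)"
        by (intro nn_integral_cong) (simp add: avg_factor[OF vV])
      finally have i1: "(\<integral>\<^sup>+ x. e x * factor v x \<partial>M) = (\<integral>\<^sup>+ x. e x \<partial>M)" .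
      have "(\<integral>\<^sup>+ x. r'.joint W' x * d x \<partial>M) = (\<integral>\<^sup>+ x. avg {v} (\<lambda>x. r'.joint W' x * d x) x \<partial>M)"
        by (rule nn_integral_avg[symmetric]) measurable
      also have "\<dots> = (\<integral>\<^sup>+ x. r'.joint W' x * avg {v} d x \<partial>M)"
        by (intro nn_integral_cong avg_pull jv) auto
      also have "\<dots> \<le> (\<integral>\<^sup>+ x. r'.joint W' x * ennreal (2 * s v) \<partial>M)"
        by (intro nn_integral_mono mult_left_mono d_avg) auto
      also have "\<dots> = ennreal (2 * s v)"
        using r'.nn_integral_joint[OF W'(1)] by (subst nn_integral_multc) auto
      finally have i2: "(\<integral>\<^sup>+ x. r'.joint W' x * d x \<partial>M) \<le> ennreal (2 * s v)" .
      have "(\<integral>\<^sup>+ x. ?e x \<partial>M) = (\<integral>\<^sup>+ x. e x * factor v x \<partial>M) + (\<integral>\<^sup>+ x. r'.joint W' x * d x \<partial>M)"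
        by (intro nn_integral_add) measurable
      also have "\<dots> \<le> ennreal (2 * (\<Sum>v\<in>W'. s v)) + ennreal (2 * s v)"
        unfolding i1 by (intro add_mono e_int i2)
      also have "\<dots> = ennreal (2 * (\<Sum>v\<in>W. s v))"
        using s0 W' vV fin v by (subst ennreal_plus[symmetric])
          (auto simp: W'_def sum.remove[of W v] algebra_simps intro!: sum_nonneg)
      finally show "(\<integral>\<^sup>+ x. ?e x \<partial>M) \<le> ennreal (2 * (\<Sum>v\<in>W. s v))" .
      fix x assume x: "x \<in> space M"
      have "joint W x \<le> (r'.joint W' x + e x) * factor v x"
        unfolding split by (intro mult_right_mono e_le x) auto
      also have "\<dots> = r'.joint W' x * factor v x + e x * factor v x" by (simp add: distrib_right)
      also have "\<dots> \<le> r'.joint W' x * (r'.factor v x + d x) + e x * factor v x"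
        by (intro add_mono mult_left_mono fd) auto
      finally show "joint W x \<le> r'.joint W x + ?e x" unfolding split by (simp add: distrib_left add_ac)
      have "r'.joint W x \<le> r'.joint W' x * (factor v x + d x)"
        unfolding split by (intro mult_left_mono fd) auto
      also have "\<dots> = r'.joint W' x * factor v x + r'.joint W' x * d x" by (simp add: distrib_left)
      also have "\<dots> \<le> (joint W' x + e x) * factor v x + r'.joint W' x * d x"
        by (intro add_mono mult_right_mono e_le x) auto
      finally show "r'.joint W x \<le> joint W x + ?e x" unfolding split by (simp add: distrib_right add_ac)
    qed
  qed
  from this[OF ancestral_V] show ?thesis using m by (auto simp: bn_dist_def s_def)
qed

end

section \<open>Dependence is an open and dense condition\<close>

abbreviation gauss :: "real measure" where
  "gauss \<equiv> density lborel std_normal_density"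

text \<open>Dividing by the positive Gaussian density trades Lebesgue measure for a probability measure.\<close>

definition gauss_factor :: "('v \<Rightarrow> ('v \<Rightarrow> real) \<Rightarrow> real) \<Rightarrow> 'v \<Rightarrow> ('v \<Rightarrow> real) \<Rightarrow> ennreal" where
  "gauss_factor p v z = ennreal (p v z / std_normal_density (z v))"

lemma product_reference_gauss: "finite V \<Longrightarrow> product_reference gauss V"
proof -
  assume V: "finite V"
  interpret prob_space gauss by (rule prob_space_normal_density) simp
  show ?thesis by unfold_locales (simp_all add: V)
qed

lemma measurable_update:
  assumes "x \<in> space (Xsp A)" shows "(\<lambda>y. x(v := y)) \<in> borel \<rightarrow>\<^sub>M Xsp (insert v A)"
  using measurable_compose[OF measurable_Pair1'[OF assms, of borel] measurable_add_dim[of v A "\<lambda>_.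
      borel"]]
  by simp

lemma
  assumes dag: "dag V E"
    and meas: "\<And>v. v \<in> V \<Longrightarrow> p v \<in> borel_measurable (Xsp (family E v))"
    and one: "\<And>v x. v \<in> V \<Longrightarrow> x \<in> space (Xsp (pa E v)) \<Longrightarrow> (\<integral>\<^sup>+ y. ennreal (p v (x(v := y))) \<partial>lborel) = 1"
  shows factorized_density_gauss: "factorized_density gauss V E (gauss_factor p)"
    and density_gauss_factor: "\<And>v x. v \<in> V \<Longrightarrow> x \<in> space (Xsp (pa E v)) \<Longrightarrow>
      density lborel (\<lambda>y. ennreal (p v (x(v := y)))) = density gauss (\<lambda>y. gauss_factor p v (x(v := y)))"
proof -
  have r: "gauss_factor p v \<in> borel_measurable (Xsp (family E v))" if v: "v \<in> V" for v
  proof -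
    note [measurable] = meas[OF v]
    have [measurable]: "(\<lambda>z. z v) \<in> borel_measurable (Xsp (family E v))" by simp
    show ?thesis unfolding gauss_factor_def[abs_def] by measurable
  qed
  have r': "(\<lambda>y. gauss_factor p v (x(v := y))) \<in> borel_measurable borel" if v: "v \<in> V" "x \<in> space (Xsp
      (pa E v))" for v x
    using measurable_compose[OF measurable_update[OF v(2)] r[OF v(1)]] .
  have eq: "ennreal (std_normal_density y) * gauss_factor p v (x(v := y)) = ennreal (p v (x(v := y)))"
      for v y and x :: "'a \<Rightarrow> real"
    by (simp add: gauss_factor_def ennreal_mult'[symmetric] normal_density_def)
  show kernel: "density lborel (\<lambda>y. ennreal (p v (x(v := y)))) = density gauss (\<lambda>y. gauss_factor p v
      (x(v := y)))"
    if "v \<in> V" "x \<in> space (Xsp (pa E v))" for v x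
    using r'[OF that] by (subst density_density_eq) (simp_all add: eq)
  interpret product_reference gauss V
    using dag by (intro product_reference_gauss) (simp add: dag_def)
  show "factorized_density gauss V E (gauss_factor p)"
  proof
    fix v x assume v: "v \<in> V" "x \<in> space (Xsp (pa E v))"
    show "(\<integral>\<^sup>+ y. gauss_factor p v (x(v := y)) \<partial>gauss) = 1"
      using r'[OF v] one[OF v] by (subst nn_integral_density) (simp_all add: eq)
  qed (use dag r in auto)
qed

definition eqb_densities ::
    "'v set \<Rightarrow> ('v \<times> 'v) set \<Rightarrow> real \<Rightarrow> (real \<Rightarrow> real) \<Rightarrow> 'v bayes_net \<Rightarrow> ('v \<Rightarrow> ('v \<Rightarrow> real) \<Rightarrow> real) \<Rightarrow> bool"
  where
  "eqb_densities V E K \<omega> m p \<longleftrightarrow> (\<forall>v\<in>V.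
     (\<forall>x\<in>space (Xsp (pa E v)). m v x = density lborel (\<lambda>y. ennreal (p v (x(v := y))))) \<and>
     (\<forall>z\<in>space (Xsp (family E v)). 0 \<le> p v z \<and> p v z \<le> K) \<and>
     admits_modulus (family E v) \<omega> (p v))"

lemma eqb_densities_exist: "m \<in> eqb_bayes_nets V E K \<omega> \<Longrightarrow> \<exists>p. eqb_densities V E K \<omega> m p"
  unfolding eqb_bayes_nets_def eqb_densities_def by (intro bchoice) blast

lemma eqb_densities:
  assumes "dag V E" "concave_modulus \<omega>" "m \<in> eqb_bayes_nets V E K \<omega>" and p: "eqb_densities V E K \<omega> m p"
  shows "\<And>v x. v \<in> V \<Longrightarrow> x \<in> space (Xsp (pa E v)) \<Longrightarrow> m v x = density lborel (\<lambda>y. ennreal (p v (x(v := y))))"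
    and "\<And>v z. v \<in> V \<Longrightarrow> z \<in> space (Xsp (family E v)) \<Longrightarrow> 0 \<le> p v z \<and> p v z \<le> K"
    and "\<And>v. v \<in> V \<Longrightarrow> admits_modulus (family E v) \<omega> (p v)"
    and "\<And>v. v \<in> V \<Longrightarrow> p v \<in> borel_measurable (Xsp (family E v))"
    and "\<And>v x. v \<in> V \<Longrightarrow> x \<in> space (Xsp (pa E v)) \<Longrightarrow> (\<integral>\<^sup>+ y. ennreal (p v (x(v := y))) \<partial>lborel) = 1"
proof -
  have net: "m \<in> bayes_nets V E" using assms(3) by (simp add: eqb_bayes_nets_def)
  show meas: "p v \<in> borel_measurable (Xsp (family E v))" if "v \<in> V" for v
    using p that unfolding eqb_densities_def
    by (intro admits_modulus_measurable[OF pa_finite[OF assms(1)] assms(2)]) blast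
  show eq: "m v x = density lborel (\<lambda>y. ennreal (p v (x(v := y))))" if "v \<in> V" "x \<in> space (Xsp (pa E
      v))" for v x
    using p that unfolding eqb_densities_def by blast
  show "(\<integral>\<^sup>+ y. ennreal (p v (x(v := y))) \<partial>lborel) = 1" if v: "v \<in> V" and x: "x \<in> space (Xsp (pa E
      v))" for v x
  proof -
    have "prob_space (m v x)" using bayes_nets_kernel[OF net v x] by (simp add: space_prob_algebra)
    then have "emeasure (m v x) (space (m v x)) = 1" by (rule prob_space.emeasure_space_1)
    then show ?thesis
      using measurable_compose[OF measurable_compose[OF measurable_update[OF x] meas[OF v]]
          measurable_ennreal]
      by (simp add: eq[OF v x] emeasure_density cong: nn_integral_cong)
  qed
qed (use p in \<open>auto simp: eqb_densities_def\<close>)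

lemma eqb_factorized:
  assumes "dag V E" "concave_modulus \<omega>" "m \<in> eqb_bayes_nets V E K \<omega>"
  obtains r where "factorized_density gauss V E r"
    "\<And>v x. v \<in> V \<Longrightarrow> x \<in> space (Xsp (pa E v)) \<Longrightarrow> m v x = density gauss (\<lambda>y. r v (x(v := y)))"
proof -
  obtain p where "eqb_densities V E K \<omega> m p" using eqb_densities_exist[OF assms(3)] by blast
  note p = eqb_densities[OF assms this]
  show ?thesis
  proof (rule that)
    show "factorized_density gauss V E (gauss_factor p)"
      by (rule factorized_density_gauss[OF assms(1) p(4,5)])
    show "m v x = density gauss (\<lambda>y. gauss_factor p v (x(v := y)))"
      if "v \<in> V" "x \<in> space (Xsp (pa E v))" for v x
      unfolding p(1)[OF that] by (rule density_gauss_factor[OF assms(1) p(4,5) that])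
  qed
qed

lemma eqb_subset: "m \<in> eqb_bayes_nets V E K \<omega> \<Longrightarrow> m \<in> bayes_nets V E"
  by (simp add: eqb_bayes_nets_def)

lemma bn_distribution_markov:
  assumes dag: "dag V E" and \<omega>: "concave_modulus \<omega>" and m: "m \<in> eqb_bayes_nets V E K \<omega>"
  shows "bn_distribution V E m \<in> markov_measures V E"
proof -
  obtain r where r: "factorized_density gauss V E r"
    "\<And>v x. v \<in> V \<Longrightarrow> x \<in> space (Xsp (pa E v)) \<Longrightarrow> m v x = density gauss (\<lambda>y. r v (x(v := y)))"
    using that by (rule eqb_factorized[OF assms])
  interpret factorized_density gauss V E r by (rule r(1))
  have D: "bn_distribution V E m = density M (joint V)"
    using eqb_subset[OF m] r(2) by (rule bn_distribution_density)
  have "prob_space (density M (joint V))"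
    by (intro prob_density nn_integral_joint ancestral_V measurable_joint order_refl)
  then have "density M (joint V) \<in> space (prob_algebra (Xsp V))"
    by (simp add: space_prob_algebra sets_M)
  then show ?thesis
    unfolding markov_measures_def D using joint_markov by blast
qed

text \<open>Otherwise independent networks would converge to the dependent one, and so would their joint densities
in \<open>L\<^sup>1\<close>, which preserves independence.\<close>

lemma dependence_open:
  assumes dag: "dag V E" and \<omega>: "concave_modulus \<omega>" and m: "m \<in> eqb_bayes_nets V E K \<omega>"
    and sub: "A \<subseteq> V" "B \<subseteq> V" "C \<subseteq> V" and dep: "\<not> cond_indep (bn_distribution V E m) A B C"
  shows "\<exists>\<delta>>0. \<forall>m'\<in>eqb_bayes_nets V E K \<omega>. bn_dist V E m m' < \<delta> \<longrightarrow> \<not> cond_indep (bn_distribution V E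
      m') A B C"
proof (rule ccontr)
  assume "\<not> ?thesis"
  then have "\<exists>m'. m' \<in> eqb_bayes_nets V E K \<omega> \<and> bn_dist V E m m' < inverse (real (Suc n)) \<and>
      cond_indep (bn_distribution V E m') A B C" for n
    by (auto dest!: spec[of _ "inverse (real (Suc n))"])
  then obtain m' where m': "\<And>n. m' n \<in> eqb_bayes_nets V E K \<omega>"
    "\<And>n. bn_dist V E m (m' n) < inverse (real (Suc n))"
    "\<And>n. cond_indep (bn_distribution V E (m' n)) A B C" by metis
  obtain r where r: "factorized_density gauss V E r"
    "\<And>v x. v \<in> V \<Longrightarrow> x \<in> space (Xsp (pa E v)) \<Longrightarrow> m v x = density gauss (\<lambda>y. r v (x(v := y)))"
    using that by (rule eqb_factorized[OF dag \<omega> m])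
  have "\<exists>r'. factorized_density gauss V E r' \<and>
    (\<forall>v x. v \<in> V \<longrightarrow> x \<in> space (Xsp (pa E v)) \<longrightarrow> m' n v x = density gauss (\<lambda>y. r' v (x(v := y))))" for n
    by (rule eqb_factorized[OF dag \<omega> m'(1)[of n]]) blast
  then obtain r' where r': "\<And>n. factorized_density gauss V E (r' n)"
    "\<And>n v x. v \<in> V \<Longrightarrow> x \<in> space (Xsp (pa E v)) \<Longrightarrow> m' n v x = density gauss (\<lambda>y. r' n v (x(v := y)))"
    by metis
  interpret factorized_density gauss V E r by (rule r(1))
  interpret r': factorized_density gauss V E "r' n" for n by (rule r'(1))
  have D: "bn_distribution V E m = density M (joint V)"
    using eqb_subset[OF m] r(2) by (rule bn_distribution_density)
  have D': "bn_distribution V E (m' n) = density M (r'.joint n V)" for n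
    using eqb_subset[OF m'(1)] r'(2) by (rule r'.bn_distribution_density)
  have "\<exists>e. e \<in> borel_measurable M \<and> (\<integral>\<^sup>+ x. e x \<partial>M) \<le> ennreal (2 * bn_dist V E m (m' n)) \<and>
    (\<forall>x\<in>space M. joint V x \<le> r'.joint n V x + e x \<and> r'.joint n V x \<le> joint V x + e x)" for n
    using r(2) r'(2) by (intro joint_close r' eqb_subset[OF m] eqb_subset[OF m'(1)]) auto
  then obtain e where e: "\<And>n. e n \<in> borel_measurable M"
    "\<And>n. (\<integral>\<^sup>+ x. e n x \<partial>M) \<le> ennreal (2 * bn_dist V E m (m' n))"
    "\<And>n x. x \<in> space M \<Longrightarrow> joint V x \<le> r'.joint n V x + e n x"
    "\<And>n x. x \<in> space M \<Longrightarrow> r'.joint n V x \<le> joint V x + e n x" by metis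
  have e_le: "(\<integral>\<^sup>+ x. e n x \<partial>M) \<le> ennreal (2 * inverse (real (Suc n)))" for n
    using e(2)[of n] m'(2)[of n] by (intro order_trans[OF e(2)] ennreal_leI) simp
  have "(\<lambda>n. ennreal (2 * inverse (real (Suc n)))) \<longlonglongrightarrow> ennreal (2 * 0)"
    by (intro tendsto_ennrealI tendsto_intros LIMSEQ_inverse_real_of_nat)
  then have null: "(\<lambda>n. ennreal (2 * inverse (real (Suc n)))) \<longlonglongrightarrow> 0"
    by (simp only: mult_zero_right ennreal_0)
  have lim: "(\<lambda>n. \<integral>\<^sup>+ x. e n x \<partial>M) \<longlonglongrightarrow> 0"
    by (rule tendsto_sandwich[OF always_eventually always_eventually tendsto_const null])
      (intro allI zero_le e_le)+
  have "AE x in M. ci_eq (joint V) C {x \<in> space M. restrict x A \<in> EA} {x \<in> space M. restrict x B \<in> EB} x"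
    if E: "EA \<in> sets (Xsp A)" "EB \<in> sets (Xsp B)" for EA EB
  proof (rule ci_eq_closed[where g = "\<lambda>n. r'.joint n V" and e = e])
    show "(\<integral>\<^sup>+ x. e n x \<partial>M) < \<infinity>" for n
      using e_le[of n] by (rule order_le_less_trans) simp
    show "AE x in M. ci_eq (r'.joint n V) C {x \<in> space M. restrict x A \<in> EA} {x \<in> space M. restrict x
        B \<in> EB} x" for n
    proof -
      have "cond_indep (density M (r'.joint n V)) A B C" using m'(3)[of n] by (simp only: D')
      then show ?thesis using E sub by (simp add: cond_indep_iff_ci_eq r'.nn_integral_joint ancestral_V)
    qed
  qed (use e lim E sub in \<open>auto intro: nn_integral_joint ancestral_V proj_event_sets\<close>)
  then have "cond_indep (density M (joint V)) A B C"
    using sub by (simp add: cond_indep_iff_ci_eq nn_integral_joint ancestral_V)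
  with dep show False by (simp add: D)
qed

lemma bn_dist_le:
  assumes "finite V" "m \<in> bayes_nets V E" "m' \<in> bayes_nets V E"
    and "\<And>v x. v \<in> V \<Longrightarrow> x \<in> space (Xsp (pa E v)) \<Longrightarrow> tv_dist (m v x) (m' v x) \<le> t"
  shows "bn_dist V E m m' \<le> real (card V) * t"
proof -
  have "bn_dist V E m m' = (\<Sum>v\<in>V. SUP x\<in>space (Xsp (pa E v)). tv_dist (m v x) (m' v x))"
    using assms by (simp add: bn_dist_def)
  also have "\<dots> \<le> (\<Sum>v\<in>V. t)"
    using assms(4) by (intro sum_mono cSUP_least Xsp_space_nonempty) auto
  finally show ?thesis by simp
qed

definition interpolate ::
    "('v \<Rightarrow> ('v \<Rightarrow> real) \<Rightarrow> real) \<Rightarrow> ('v \<Rightarrow> ('v \<Rightarrow> real) \<Rightarrow> real) \<Rightarrow> real \<Rightarrow> 'v \<Rightarrow> ('v \<Rightarrow> real) \<Rightarrow> real"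
  where "interpolate p q t v z = (1 - t) * p v z + t * q v z"

text \<open>The kernels of \<open>m\<close> and \<open>m1\<close> are interpolated linearly. Expanding the product of the interpolated factors
over the sets \<open>W\<close> of vertices that use the kernel of \<open>m\<close> shows that the joint density is a polynomial
whose coefficients are joint densities again; it cannot satisfy independence for all small parameters.\<close>

lemma dependence_dense:
  assumes dag: "dag V E" and \<omega>: "concave_modulus \<omega>" and m: "m \<in> eqb_bayes_nets V E K \<omega>"
    and m1: "m1 \<in> eqb_bayes_nets V E K \<omega>" and \<epsilon>: "0 < \<epsilon>"
    and sub: "A \<subseteq> V" "B \<subseteq> V" "C \<subseteq> V" and dep: "\<not> cond_indep (bn_distribution V E m1) A B C"
  shows "\<exists>m'\<in>eqb_bayes_nets V E K \<omega>. bn_dist V E m m' < \<epsilon> \<and> \<not> cond_indep (bn_distribution V E m') A B C"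
proof -
  have V: "finite V" using dag by (simp add: dag_def)
  obtain p where "eqb_densities V E K \<omega> m p" using eqb_densities_exist[OF m] by blast
  note p = eqb_densities[OF dag \<omega> m this]
  obtain q where "eqb_densities V E K \<omega> m1 q" using eqb_densities_exist[OF m1] by blast
  note q = eqb_densities[OF dag \<omega> m1 this]
  let ?pt = "interpolate p q"
  have mix_ennreal: "ennreal (?pt t v z) = ennreal (1 - t) * ennreal (p v z) + ennreal t * ennreal (q
      v z)"
    if "0 \<le> t" "t \<le> 1" "v \<in> V" "z \<in> space (Xsp (family E v))" for t v z
    using p(2)[OF that(3,4)] q(2)[OF that(3,4)] that
    by (simp add: interpolate_def ennreal_mult)
  have meas_up: "(\<lambda>y. ennreal (k (x(v := y)))) \<in> borel_measurable borel"
    if "v \<in> V" "x \<in> space (Xsp (pa E v))" "k \<in> borel_measurable (Xsp (family E v))"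
    for v x and k :: "('a \<Rightarrow> real) \<Rightarrow> real"
    using measurable_compose[OF measurable_compose[OF measurable_update[OF that(2)] that(3)]
        measurable_ennreal] .
  have integral_mix: "(\<integral>\<^sup>+ y. ennreal (?pt t v (x(v := y))) * indicator S y \<partial>lborel) =
      ennreal (1 - t) * (\<integral>\<^sup>+ y. ennreal (p v (x(v := y))) * indicator S y \<partial>lborel) +
      ennreal t * (\<integral>\<^sup>+ y. ennreal (q v (x(v := y))) * indicator S y \<partial>lborel)"
    if t: "0 \<le> t" "t \<le> 1" and v: "v \<in> V" "x \<in> space (Xsp (pa E v))" and S [measurable]: "S \<in> sets
        borel" for t v x S
  proof -
    note [measurable] = meas_up[OF v p(4)[OF v(1)]] meas_up[OF v q(4)[OF v(1)]]
    have "(\<integral>\<^sup>+ y. ennreal (?pt t v (x(v := y))) * indicator S y \<partial>lborel) =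
        (\<integral>\<^sup>+ y. ennreal (1 - t) * (ennreal (p v (x(v := y))) * indicator S y) +
          ennreal t * (ennreal (q v (x(v := y))) * indicator S y) \<partial>lborel)"
      by (intro nn_integral_cong) (simp add: mix_ennreal[OF t v(1) update_in_Xsp[OF v(2)]]
          distrib_right mult.assoc)
    then show ?thesis by (simp add: nn_integral_add nn_integral_cmult)
  qed
  have one: "(\<integral>\<^sup>+ y. ennreal (?pt t v (x(v := y))) \<partial>lborel) = 1"
    if "0 \<le> t" "t \<le> 1" "v \<in> V" "x \<in> space (Xsp (pa E v))" for t v x
    using integral_mix[OF that, of UNIV] p(5)[OF that(3,4)] q(5)[OF that(3,4)] that
    by (simp add: ennreal_plus[symmetric] del: ennreal_plus)
  have meas: "?pt t v \<in> borel_measurable (Xsp (family E v))" if "v \<in> V" for t v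
    using p(4)[OF that] q(4)[OF that] unfolding interpolate_def[abs_def] by measurable
  define net where "net t = density_net V E (?pt t)" for t
  have net: "net t \<in> eqb_bayes_nets V E K \<omega>" if t: "0 \<le> t" "t \<le> 1" for t
    unfolding net_def
  proof (rule density_net_eqb[OF dag \<omega>])
    fix v z assume v: "v \<in> V" "z \<in> space (Xsp (family E v))"
    have "(1 - t) * p v z + t * q v z \<le> (1 - t) * K + t * K"
      using p(2)[OF v] q(2)[OF v] t by (intro add_mono mult_left_mono) auto
    moreover have "0 \<le> (1 - t) * p v z + t * q v z" using p(2)[OF v] q(2)[OF v] t by simp
    ultimately show "0 \<le> ?pt t v z \<and> ?pt t v z \<le> K" by (simp add: interpolate_def algebra_simps)
  next
    fix v assume v: "v \<in> V"
    show "admits_modulus (family E v) \<omega> (?pt t v)"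
      unfolding admits_modulus_def
    proof (intro ballI)
      fix z z' assume z: "z \<in> space (Xsp (family E v))" "z' \<in> space (Xsp (family E v))"
      let ?w = "\<omega> (euclid_dist (family E v) z z')"
      have pq: "\<bar>p v z - p v z'\<bar> \<le> ?w" "\<bar>q v z - q v z'\<bar> \<le> ?w"
        using p(3)[OF v] q(3)[OF v] z unfolding admits_modulus_def by blast+
      have "?pt t v z - ?pt t v z' = (1 - t) * (p v z - p v z') + t * (q v z - q v z')"
        by (simp add: interpolate_def algebra_simps)
      also have "\<bar>\<dots>\<bar> \<le> (1 - t) * \<bar>p v z - p v z'\<bar> + t * \<bar>q v z - q v z'\<bar>"
        using t by (intro order_trans[OF abs_triangle_ineq]) (simp add: abs_mult)
      also have "\<dots> \<le> (1 - t) * ?w + t * ?w"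
        using pq t by (intro add_mono mult_left_mono) auto
      finally show "\<bar>?pt t v z - ?pt t v z'\<bar> \<le> ?w" by (simp add: algebra_simps)
    qed
  next
    show "(\<integral>\<^sup>+ y. ennreal (?pt t v (x(v := y))) \<partial>lborel) = 1" if "v \<in> V" "x \<in> space (Xsp (pa E v))"
        for v x
      using one t that by blast
  qed
  have net_kernel: "net t v x = density lborel (\<lambda>y. ennreal (?pt t v (x(v := y))))"
    if "v \<in> V" "x \<in> space (Xsp (pa E v))" for t v x
    using that by (simp add: net_def density_net_def)
  have dist: "bn_dist V E m (net t) \<le> real (card V) * t" if t: "0 \<le> t" "t \<le> 1" for t
  proof (rule bn_dist_le[OF V eqb_subset[OF m] eqb_subset[OF net[OF t]]])
    fix v x assume v: "v \<in> V" "x \<in> space (Xsp (pa E v))"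
    note pr = bayes_nets_kernel[OF eqb_subset[OF m] v] bayes_nets_kernel[OF eqb_subset[OF m1] v]
      bayes_nets_kernel[OF eqb_subset[OF net[OF t]] v]
    interpret m: prob_space "m v x" using pr(1) by (simp add: space_prob_algebra)
    interpret m1: prob_space "m1 v x" using pr(2) by (simp add: space_prob_algebra)
    interpret mt: prob_space "net t v x" using pr(3) by (simp add: space_prob_algebra)
    have "\<bar>measure (m v x) S - measure (net t v x) S\<bar> \<le> t" if "S \<in> sets (m v x)" for S
    proof -
      have S: "S \<in> sets borel" using that pr(1) by (simp add: space_prob_algebra)
      have em: "emeasure (density lborel (\<lambda>y. ennreal (k (x(v := y))))) S =
          (\<integral>\<^sup>+ y. ennreal (k (x(v := y))) * indicator S y \<partial>lborel)"
        if "k \<in> borel_measurable (Xsp (family E v))" for k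
        using meas_up[OF v that] S by (simp add: emeasure_density)
      have "emeasure (net t v x) S = ennreal (1 - t) * emeasure (m v x) S + ennreal t * emeasure (m1 v
          x) S"
        unfolding net_kernel[OF v] p(1)[OF v] q(1)[OF v] em[OF p(4)[OF v(1)]] em[OF q(4)[OF v(1)]]
          em[OF meas[OF v(1)]]
        by (rule integral_mix[OF t v S])
      then have "ennreal (measure (net t v x) S) = ennreal ((1 - t) * measure (m v x) S + t * measure
          (m1 v x) S)"
        using t by (simp add: m.emeasure_eq_measure m1.emeasure_eq_measure mt.emeasure_eq_measure
            ennreal_mult)
      then have "measure (net t v x) S = (1 - t) * measure (m v x) S + t * measure (m1 v x) S"
        using t by (subst (asm) ennreal_inj) auto
      then have "measure (m v x) S - measure (net t v x) S = t * (measure (m v x) S - measure (m1 v x) S)"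
        by (simp add: algebra_simps)
      also have "\<bar>\<dots>\<bar> \<le> t * 1"
      proof -
        have "\<bar>measure (m v x) S - measure (m1 v x) S\<bar> \<le> 1"
          using m.prob_le_1[of S] m1.prob_le_1[of S]
            measure_nonneg[of "m v x" S] measure_nonneg[of "m1 v x" S] by linarith
        then show ?thesis unfolding abs_mult using t by (intro mult_mono) auto
      qed
      finally show ?thesis by simp
    qed
    then show "tv_dist (m v x) (net t v x) \<le> t"
      unfolding tv_dist_def by (intro cSUP_least) auto
  qed
  interpret product_reference gauss V by (rule product_reference_gauss[OF V])
  define f where "f t = factorized_density.joint E (gauss_factor (?pt t)) V" for t
  have fd: "factorized_density gauss V E (gauss_factor (?pt t))" if "0 \<le> t" "t \<le> 1" for t
    by (rule factorized_density_gauss[OF dag meas one[OF that]])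
  have D: "bn_distribution V E m' = density M (f t)"
    if t: "0 \<le> t" "t \<le> 1" and m': "m' \<in> eqb_bayes_nets V E K \<omega>"
      "\<And>v x. v \<in> V \<Longrightarrow> x \<in> space (Xsp (pa E v)) \<Longrightarrow> m' v x = density lborel (\<lambda>y. ennreal (?pt t v (x(v :=
          y))))"
    for t m'
    unfolding f_def
  proof (rule factorized_density.bn_distribution_density[OF fd[OF t] eqb_subset[OF m'(1)]])
    fix v x assume v: "v \<in> V" "x \<in> space (Xsp (pa E v))"
    show "m' v x = density gauss (\<lambda>y. gauss_factor (?pt t) v (x(v := y)))"
      unfolding m'(2)[OF v] by (rule density_gauss_factor[OF dag meas one[OF t] v])
  qed
  have f_meas: "f t \<in> borel_measurable M" and f_int: "(\<integral>\<^sup>+ x. f t x \<partial>M) = 1" if t: "0 \<le> t" "t \<le> 1" for t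
  proof -
    interpret t: factorized_density gauss V E "gauss_factor (?pt t)" by (rule fd[OF t])
    show "f t \<in> borel_measurable M" "(\<integral>\<^sup>+ x. f t x \<partial>M) = 1"
      unfolding f_def using t.nn_integral_joint[OF t.ancestral_V] by auto
  qed
  define choice where "choice W v = (if v \<in> W then gauss_factor p v else gauss_factor q v)" for W v
  have fdp: "factorized_density gauss V E (gauss_factor p)"
    by (rule factorized_density_gauss[OF dag p(4,5)])
  have fdq: "factorized_density gauss V E (gauss_factor q)"
    by (rule factorized_density_gauss[OF dag q(4,5)])
  have choice: "factorized_density gauss V E (choice W)" for W
  proof -
    interpret p: factorized_density gauss V E "gauss_factor p" by (rule fdp)
    interpret q: factorized_density gauss V E "gauss_factor q" by (rule fdq)
    show ?thesis
      by unfold_locales (auto simp: choice_def dag p.measurable_r q.measurable_r p.r_one q.r_one)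
  qed
  define F where "F W = factorized_density.joint E (choice W) V" for W
  define P :: "'a set \<Rightarrow> real poly" where "P W = [:1, -1:] ^ card W * [:0, 1:] ^ card (V - W)" for W
  have expand: "f t x = (\<Sum>W\<in>Pow V. ennreal (poly (P W) t) * F W x)"
    if t: "0 \<le> t" "t \<le> 1" and x: "x \<in> space M" for t x
  proof -
    interpret fp: factorized_density gauss V E "gauss_factor p" by (rule fdp)
    interpret fq: factorized_density gauss V E "gauss_factor q" by (rule fdq)
    have "factorized_density.factor E (gauss_factor (?pt t)) v x =
        ennreal (1 - t) * fp.factor v x + ennreal t * fq.factor v x" if v: "v \<in> V" for v
    proof -
      interpret ft: factorized_density gauss V E "gauss_factor (?pt t)" by (rule fd[OF t])
      let ?z = "restrict x (family E v)"
      have z: "?z \<in> space (Xsp (family E v))" by (simp add: space_Xsp)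
      have "ennreal (?pt t v ?z / std_normal_density (?z v)) =
          ennreal (1 - t) * ennreal (p v ?z / std_normal_density (?z v)) + ennreal t * ennreal (q v ?z
              / std_normal_density (?z v))"
        using p(2)[OF v z] q(2)[OF v z] t
        by (simp add: interpolate_def add_divide_distrib ennreal_plus[symmetric]
            ennreal_mult[symmetric] del: ennreal_plus)
      then show ?thesis
        by (simp only: ft.factor_def fp.factor_def fq.factor_def gauss_factor_def)
    qed
    then have "f t x = (\<Prod>v\<in>V. ennreal (1 - t) * fp.factor v x + ennreal t * fq.factor v x)"
      by (simp add: f_def factorized_density.joint_def[OF fd[OF t]])
    also have "\<dots> = (\<Sum>W\<in>Pow V. (\<Prod>v\<in>W. ennreal (1 - t) * fp.factor v x) * (\<Prod>v\<in>V - W. ennreal t *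
        fq.factor v x))"
      by (rule prod_add[OF V])
    also have "\<dots> = (\<Sum>W\<in>Pow V. ennreal (poly (P W) t) * F W x)"
    proof (rule sum.cong[OF refl])
      fix W assume "W \<in> Pow V"
      then have W: "W \<subseteq> V" by simp
      interpret c: factorized_density gauss V E "choice W" by (rule choice)
      have cf: "c.factor v x = (if v \<in> W then fp.factor v x else fq.factor v x)" for v
        by (simp add: c.factor_def fp.factor_def fq.factor_def choice_def)
      have "F W x = (\<Prod>v\<in>W. c.factor v x) * (\<Prod>v\<in>V - W. c.factor v x)"
        using prod.subset_diff[OF W V, of "\<lambda>v. c.factor v x"] by (simp add: F_def c.joint_def
            mult.commute)
      then have F: "F W x = (\<Prod>v\<in>W. fp.factor v x) * (\<Prod>v\<in>V - W. fq.factor v x)"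
        by (simp add: cf)
      have "ennreal (poly (P W) t) = ennreal (1 - t) ^ card W * ennreal t ^ card (V - W)"
        using t by (simp add: P_def poly_power ennreal_mult ennreal_power)
      then show "(\<Prod>v\<in>W. ennreal (1 - t) * fp.factor v x) * (\<Prod>v\<in>V - W. ennreal t * fq.factor v x) =
          ennreal (poly (P W) t) * F W x"
        by (simp add: F prod.distrib mult_ac)
    qed
    finally show ?thesis .
  qed
  obtain N where N: "real (card V) / \<epsilon> < real N" using reals_Archimedean2 by blast
  \<comment> \<open>infinitely many parameters, all within the allowed distance of \<open>m\<close>\<close>
  define t where "t k = 1 / real (k + N + 1)" for k
  have t01: "0 \<le> t k \<and> t k \<le> 1" for k by (simp add: t_def)
  have "inj t" by (auto simp: inj_on_def t_def)
  have small: "real (card V) * t k < \<epsilon>" for k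
  proof -
    have "real (card V) < \<epsilon> * real N" using N \<epsilon> by (simp add: field_simps)
    also have "\<dots> \<le> \<epsilon> * real (k + N + 1)" using \<epsilon> by simp
    finally show ?thesis by (simp add: t_def field_simps)
  qed
  show ?thesis
  proof (rule ccontr)
    assume "\<not> ?thesis"
    then have ci: "cond_indep (bn_distribution V E (net (t k))) A B C" for k
      using net[of "t k"] dist[of "t k"] small[of k] t01[of k] by force
    have "AE x in M. ci_eq (f 1) C {x \<in> space M. restrict x A \<in> EA} {x \<in> space M. restrict x B \<in> EB} x"
      if E: "EA \<in> sets (Xsp A)" "EB \<in> sets (Xsp B)" for EA EB
    proof -
      let ?S = "{x \<in> space M. restrict x A \<in> EA}" and ?T = "{x \<in> space M. restrict x B \<in> EB}"
      have ST: "?S \<in> sets M" "?T \<in> sets M" using E sub by (auto intro: proj_event_sets)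
      have Fm: "F W \<in> borel_measurable M" and F1: "(\<integral>\<^sup>+ x. F W x \<partial>M) = 1" for W
      proof -
        interpret c: factorized_density gauss V E "choice W" by (rule choice)
        show "F W \<in> borel_measurable M" "(\<integral>\<^sup>+ x. F W x \<partial>M) = 1"
          unfolding F_def using c.nn_integral_joint[OF c.ancestral_V] by auto
      qed
      have cit: "AE x in M. ci_eq (f (t k)) C ?S ?T x" for k
      proof -
        have "cond_indep (density M (f (t k))) A B C"
          using ci[of k] D[of "t k" "net (t k)"] net[of "t k"] net_kernel t01[of k] by simp
        then show ?thesis
          using E f_meas[of "t k"] f_int[of "t k"] t01[of k] sub by (simp add: cond_indep_iff_ci_eq)
      qed
      \<comment> \<open>the sum over subsets is the joint density only for parameters between 0 and 1\<close>
      define g where "g s x = (\<Sum>W\<in>Pow V. ennreal (poly (P W) s) * F W x)" for s x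
      have fg: "ci_eq (f s) C ?S ?T x \<longleftrightarrow> ci_eq (g s) C ?S ?T x" if "0 \<le> s" "s \<le> 1" for s x
      proof -
        have "avg D (\<lambda>x. f s x * u x) x = avg D (\<lambda>x. g s x * u x) x" for D u
          by (intro avg_cong) (simp add: expand[OF that] g_def)
        from this[of _ "indicator _"] this[of _ "\<lambda>_. 1"] show ?thesis by (simp add: ci_eq_def)
      qed
      have "AE x in M. ci_eq (g 1) C ?S ?T x"
      proof (rule ci_eq_polynomial[where J = "Pow V" and F = F and p = P and f = g and t = t and s = 1])
        show "0 \<le> poly (P W) s" if "0 \<le> s" "s \<le> 1" for W s
          using that by (simp add: P_def poly_power)
        show "AE x in M. ci_eq (g (t k)) C ?S ?T x" for k using cit[of k] fg[of "t k"] t01[of k] by simp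
      qed (use V Fm F1 ST t01 \<open>inj t\<close> in \<open>auto simp: g_def\<close>)
      then show ?thesis using fg[of 1] by simp
    qed
    then have "cond_indep (density M (f 1)) A B C"
      using f_meas[of 1] f_int[of 1] by (subst cond_indep_iff_ci_eq) (auto simp: sub)
    moreover have "bn_distribution V E m1 = density M (f 1)"
      using q(1) by (intro D m1) (simp_all add: interpolate_def)
    ultimately show False using dep by simp
  qed
qed

section \<open>Parity networks\<close>

locale parity_network = product_reference \<nu> V for \<nu> and V :: "'v set" +
  fixes E :: "('v \<times> 'v) set" and S :: "'v \<Rightarrow> 'v set" and s :: "real \<Rightarrow> real"
  assumes dag_E: "dag V E" and S_pa: "S v \<subseteq> pa E v"
    and s_measurable: "s \<in> borel_measurable borel"
    and s_odd: "s (- x) = - s x" and s_bound: "\<bar>s x\<bar> \<le> 1"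
    and symmetric: "distr \<nu> \<nu> uminus = \<nu>"
    and s_sgn: "AE x in \<nu>. x \<noteq> 0 \<and> s x = sgn x"
begin

text \<open>On the support of \<open>\<nu>\<close>, where \<open>s\<close> is the sign, the factor \<open>1 + weight v z\<close> is 2 if the signs of \<open>v\<close> and of
\<open>S v\<close> multiply to 1 and 0 otherwise. A continuous \<open>s\<close> extends it to a continuous conditional density.\<close>

definition weight :: "'v \<Rightarrow> ('v \<Rightarrow> real) \<Rightarrow> real" where
  "weight v z = (if S v = {} then 0 else \<Prod>w\<in>insert v (S v). s (z w))"

definition parity_factor :: "'v \<Rightarrow> ('v \<Rightarrow> real) \<Rightarrow> ennreal" where
  "parity_factor v z = ennreal (1 + weight v z)"

lemma finite_S: "finite (S v)"
  using S_pa[of v] pa_finite[OF dag_E, of v] by (meson finite_insert finite_subset)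

lemma not_in_S: "v \<notin> S v"
  using S_pa[of v] dag_E by (auto simp: pa_def dag_def acyclic_def)

lemma abs_prod_le_1: "\<bar>\<Prod>w\<in>T. s (z w)\<bar> \<le> 1"
  unfolding abs_prod using s_bound by (intro prod_le_1) auto

lemma abs_weight_le_1: "\<bar>weight v z\<bar> \<le> 1"
  by (cases "S v = {}") (simp_all add: weight_def abs_prod_le_1 del: prod.insert)

sublocale factorized_density \<nu> V E parity_factor
proof
  show "dag V E" by (rule dag_E)
  fix v assume v: "v \<in> V"
  have "(\<lambda>z. s (z w)) \<in> borel_measurable (Xsp (family E v))" if "w \<in> insert v (S v)" for w
    using that S_pa[of v] by (intro measurable_compose[OF _ s_measurable]
        measurable_component_singleton) auto
  then have "(\<lambda>z. \<Prod>w\<in>insert v (S v). s (z w)) \<in> borel_measurable (Xsp (family E v))"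
    by (rule borel_measurable_prod)
  then show "parity_factor v \<in> borel_measurable (Xsp (family E v))"
    unfolding parity_factor_def[abs_def] weight_def by (cases "S v = {}") auto
  fix x assume x: "x \<in> space (Xsp (pa E v))"
  show "(\<integral>\<^sup>+ y. parity_factor v (x(v := y)) \<partial>\<nu>) = 1"
  proof (cases "S v = {}")
    case True
    then show ?thesis by (simp add: parity_factor_def weight_def)
  next
    case False
    define c where "c = (\<Prod>w\<in>S v. s (x w))"
    have w: "weight v (x(v := y)) = s y * c" for y
    proof -
      have "(\<Prod>w\<in>S v. s ((x(v := y)) w)) = c"
        unfolding c_def using not_in_S[of v] by (intro prod.cong) auto
      then show ?thesis using False not_in_S[of v] finite_S[of v] by (simp add: weight_def)
    qed
    have [measurable]: "s \<in> borel_measurable \<nu>" using s_measurable by (simp add: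
        measurable_cong_sets[OF sets_nu refl])
    have u [measurable]: "uminus \<in> \<nu> \<rightarrow>\<^sub>M \<nu>" by (simp add: measurable_cong_sets[OF sets_nu sets_nu])
    have sc: "\<bar>s y * c\<bar> \<le> 1" for y
      using mult_mono[OF s_bound[of y] abs_prod_le_1[of x "S v"]] by (simp add: abs_mult c_def)
    define J where "J = (\<integral>\<^sup>+ y. ennreal (1 + s y * c) \<partial>\<nu>)"
    have "J = (\<integral>\<^sup>+ y. ennreal (1 + s y * c) \<partial>distr \<nu> \<nu> uminus)" by (simp add: J_def symmetric)
    also have "\<dots> = (\<integral>\<^sup>+ y. ennreal (1 - s y * c) \<partial>\<nu>)"
      by (subst nn_integral_distr) (auto simp: s_odd)
    finally have "J + J = (\<integral>\<^sup>+ y. ennreal (1 + s y * c) \<partial>\<nu>) + (\<integral>\<^sup>+ y. ennreal (1 - s y * c) \<partial>\<nu>)"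
      by (simp add: J_def)
    also have "\<dots> = (\<integral>\<^sup>+ y. ennreal (1 + s y * c) + ennreal (1 - s y * c) \<partial>\<nu>)"
      by (rule nn_integral_add[symmetric]) measurable
    also have "\<dots> = (\<integral>\<^sup>+ y. 2 \<partial>\<nu>)"
    proof (rule nn_integral_cong)
      fix y
      have "0 \<le> 1 + s y * c" "0 \<le> 1 - s y * c" using sc[of y] by linarith+
      then show "ennreal (1 + s y * c) + ennreal (1 - s y * c) = 2"
        by (simp add: ennreal_plus[symmetric] del: ennreal_plus)
    qed
    finally have "J + J = 2" by simp
    then have "J = 1" by (cases J) (simp_all add: ennreal_plus[symmetric] ennreal_numeral[symmetric]
        del: ennreal_plus ennreal_numeral)
    then show ?thesis by (simp add: parity_factor_def w J_def)
  qed
qed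

definition flip :: "'v set \<Rightarrow> ('v \<Rightarrow> real) \<Rightarrow> 'v \<Rightarrow> real" where
  "flip F x = (\<lambda>i\<in>V. if i \<in> F then - x i else x i)"

lemma flip_in [simp]: "flip F x \<in> space M"
  by (simp add: flip_def space_M)

lemma measurable_flip [measurable]: "flip F \<in> M \<rightarrow>\<^sub>M M"
proof -
  have "(\<lambda>x. if i \<in> F then - x i else x i) \<in> M \<rightarrow>\<^sub>M \<nu>" if "i \<in> V" for i
    using that by (cases "i \<in> F") (simp_all add: measurable_cong_sets[OF refl sets_nu])
  then show ?thesis unfolding flip_def M_def by (intro measurable_restrict) auto
qed

lemma distr_flip: "distr M M (flip F) = M"
proof -
  have "distr M M (flip F) = (\<Pi>\<^sub>M i\<in>V. \<nu>)"
  proof (rule PiM_eqI)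
    show "sets (distr M M (flip F)) = sets (\<Pi>\<^sub>M i\<in>V. \<nu>)" by (simp add: M_def)
    fix A :: "'v \<Rightarrow> real set" assume A: "\<And>i. i \<in> V \<Longrightarrow> A i \<in> sets \<nu>"
    let ?A = "\<lambda>i. if i \<in> F then uminus -` A i else A i"
    have u: "uminus \<in> \<nu> \<rightarrow>\<^sub>M \<nu>" by (simp add: measurable_cong_sets[OF sets_nu sets_nu])
    have A': "?A i \<in> sets \<nu>" if "i \<in> V" for i
      using A[OF that] measurable_sets[OF u A[OF that]] by simp
    have em: "emeasure \<nu> (?A i) = emeasure \<nu> (A i)" if "i \<in> V" for i
      using emeasure_distr[OF u A[OF that]] by (simp add: symmetric)
    have "flip F -` Pi\<^sub>E V A \<inter> space M = Pi\<^sub>E V ?A"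
      by (auto simp: flip_def space_M PiE_iff extensional_def split: if_splits)
    moreover have "Pi\<^sub>E V A \<in> sets M"
      unfolding M_def using A finite_V by (intro sets_PiM_I_finite) auto
    ultimately have "emeasure (distr M M (flip F)) (Pi\<^sub>E V A) = emeasure M (Pi\<^sub>E V ?A)"
      by (simp add: emeasure_distr)
    also have "\<dots> = (\<Prod>i\<in>V. emeasure \<nu> (?A i))"
      unfolding M_def using A' finite_V by (intro emeasure_PiM) auto
    also have "\<dots> = (\<Prod>i\<in>V. emeasure \<nu> (A i))" using em by (intro prod.cong) auto
    finally show "emeasure (distr M M (flip F)) (Pi\<^sub>E V A) = (\<Prod>i\<in>V. emeasure \<nu> (A i))" .
  qed (fact finite_V)
  then show ?thesis by (simp add: M_def)
qed

text \<open>Flipping an even number of signs preserves their product.\<close>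

lemma joint_flip:
  assumes even: "\<And>v. S v \<noteq> {} \<Longrightarrow> even (card (F \<inter> insert v (S v)))"
  shows "joint V (flip F x) = joint V x"
proof -
  have "factor v (flip F x) = factor v x" if v: "v \<in> V" for v
  proof -
    let ?T = "insert v (S v)"
    have T: "?T \<subseteq> family E v" "?T \<subseteq> V" using S_pa[of v] pa_subset[of v] v by blast+
    have "weight v (restrict (flip F x) (family E v)) = weight v (restrict x (family E v))"
    proof (cases "S v = {}")
      case False
      have "(\<Prod>w\<in>?T. s (restrict (flip F x) (family E v) w)) = (\<Prod>w\<in>?T. (if w \<in> F then -1 else 1) * s (x
          w))"
        using T by (intro prod.cong) (auto simp: flip_def s_odd)
      also have "\<dots> = (-1) ^ card (F \<inter> ?T) * (\<Prod>w\<in>?T. s (x w))"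
        using finite_S[of v] by (simp add: prod.distrib prod.If_cases Int_commute del: prod.insert)
      also have "\<dots> = (\<Prod>w\<in>?T. s (x w))" using even[OF False] by simp
      also have "\<dots> = (\<Prod>w\<in>?T. s (restrict x (family E v) w))"
        using T by (intro prod.cong) auto
      finally show ?thesis using False by (simp only: weight_def if_False)
    qed (simp add: weight_def)
    then show ?thesis by (simp add: factor_def parity_factor_def)
  qed
  then show ?thesis by (simp add: joint_def)
qed

definition regular :: "('v \<Rightarrow> real) \<Rightarrow> bool" where
  "regular x \<longleftrightarrow> x \<in> space M \<and> (\<forall>i\<in>V. x i \<noteq> 0 \<and> s (x i) = sgn (x i))"

lemma AE_regular: "AE x in M. regular x"
proof -
  have "AE x in M. x i \<noteq> 0 \<and> s (x i) = sgn (x i)" if "i \<in> V" for i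
  proof -
    have "prob_space \<nu>" by unfold_locales
    then show ?thesis unfolding M_def using that s_sgn by (intro AE_PiM_component) auto
  qed
  then have "AE x in M. \<forall>i\<in>V. x i \<noteq> 0 \<and> s (x i) = sgn (x i)"
    using finite_V by (simp add: AE_finite_all)
  with AE_space show ?thesis by eventually_elim (simp add: regular_def)
qed

lemma regular_mix: "regular x \<Longrightarrow> regular y \<Longrightarrow> regular (mix D x y)"
  by (auto simp: regular_def) (auto simp: mix_def split: if_splits)

text \<open>Where the density is positive, all parity relations hold. In their product the sign of \<open>w\<close> occurs as often
as there are relations containing \<open>w\<close>, so outside \<open>C\<close> only the signs of \<open>a\<close> and \<open>b\<close> survive.\<close>

lemma parity_sgn:
  assumes x: "regular x" and pos: "joint V x \<noteq> 0" and a: "a \<in> V" and b: "b \<in> V" and C: "C \<subseteq> V"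
    and degree: "\<And>w. w \<in> V - C \<Longrightarrow> even (of_bool (S w \<noteq> {}) + card {v \<in> V. w \<in> S v} +
      of_bool (w = a) + of_bool (w = b) :: nat)"
  shows "sgn (x a) * sgn (x b) = (\<Prod>w\<in>C. sgn (x w) ^ (of_bool (S w \<noteq> {}) + card {v \<in> V. w \<in> S v} +
      of_bool (w = a) + of_bool (w = b)))"
proof -
  define active where "active = {v \<in> V. S v \<noteq> {}}"
  have SV: "insert v (S v) \<subseteq> V" if "v \<in> V" for v using S_pa[of v] pa_subset[of v] that by blast
  have sq: "sgn (x w) * sgn (x w) = 1" if "w \<in> V" for w
    using x that by (auto simp: regular_def sgn_real_def)
  have one: "(\<Prod>w\<in>insert v (S v). sgn (x w)) = 1" if v: "v \<in> active" for v
  proof -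
    have vV: "v \<in> V" "S v \<noteq> {}" using v by (auto simp: active_def)
    have "(\<Prod>w\<in>insert v (S v). s (restrict x (family E v) w)) = (\<Prod>w\<in>insert v (S v). sgn (x w))"
      using SV[OF vV(1)] S_pa[of v] x by (intro prod.cong) (auto simp: regular_def)
    then have w: "weight v (restrict x (family E v)) = (\<Prod>w\<in>insert v (S v). sgn (x w))"
      using vV by (simp only: weight_def if_False)
    have "factor v x \<noteq> 0" using pos vV finite_V by (simp add: joint_def)
    then have "(\<Prod>w\<in>insert v (S v). sgn (x w)) \<noteq> -1"
      by (auto simp: factor_def parity_factor_def w simp del: prod.insert)
    moreover have "\<bar>\<Prod>w\<in>insert v (S v). sgn (x w)\<bar> = 1"
      unfolding abs_prod using SV[OF vV(1)] x by (intro prod.neutral) (auto simp: regular_def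
          sgn_real_def)
    ultimately show ?thesis by linarith
  qed
  have "(\<Prod>v\<in>active. \<Prod>w\<in>insert v (S v). sgn (x w)) = 1"
    using one by (intro prod.neutral) blast
  moreover have "(\<Prod>v\<in>active. \<Prod>w\<in>insert v (S v). sgn (x w)) =
      (\<Prod>v\<in>active. \<Prod>w\<in>V. if w \<in> insert v (S v) then sgn (x w) else 1)"
  proof (rule prod.cong[OF refl])
    fix v assume "v \<in> active"
    then have "insert v (S v) \<subseteq> V" using SV by (simp add: active_def)
    then have "V \<inter> insert v (S v) = insert v (S v)" by blast
    then show "(\<Prod>w\<in>insert v (S v). sgn (x w)) = (\<Prod>w\<in>V. if w \<in> insert v (S v) then sgn (x w) else 1)"
      using prod.inter_restrict[OF finite_V, of "\<lambda>w. sgn (x w)" "insert v (S v)"] by simp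
  qed
  moreover have "\<dots> = (\<Prod>w\<in>V. \<Prod>v\<in>active. if w \<in> insert v (S v) then sgn (x w) else 1)"
    by (rule prod.swap)
  moreover have "\<dots> = (\<Prod>w\<in>V. sgn (x w) ^ (of_bool (S w \<noteq> {}) + card {v \<in> V. w \<in> S v}))"
  proof (rule prod.cong[OF refl])
    fix w assume w: "w \<in> V"
    have fin: "finite active" using finite_V by (simp add: active_def)
    have "{v \<in> active. w \<in> insert v (S v)} = (if S w \<noteq> {} then {w} else {}) \<union> {v \<in> V. w \<in> S v}"
      using w by (auto simp: active_def)
    moreover have "w \<notin> {v \<in> V. w \<in> S v}" using not_in_S by blast
    ultimately have card: "card {v \<in> active. w \<in> insert v (S v)} = of_bool (S w \<noteq> {}) + card {v \<in> V. w
        \<in> S v}"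
      using finite_V by simp
    have "(\<Prod>v\<in>active. if w \<in> insert v (S v) then sgn (x w) else 1) = sgn (x w) ^ card {v \<in> active. w \<in>
        insert v (S v)}"
      using fin by (simp add: prod.If_cases Int_def)
    then show "(\<Prod>v\<in>active. if w \<in> insert v (S v) then sgn (x w) else 1) =
        sgn (x w) ^ (of_bool (S w \<noteq> {}) + card {v \<in> V. w \<in> S v})" by (simp only: card)
  qed
  ultimately have all: "(\<Prod>w\<in>V. sgn (x w) ^ (of_bool (S w \<noteq> {}) + card {v \<in> V. w \<in> S v})) = 1" by simp
  have delta: "sgn (x c) = (\<Prod>w\<in>V. sgn (x w) ^ of_bool (w = c))" if "c \<in> V" for c
  proof -
    have "(\<Prod>w\<in>V. sgn (x w) ^ of_bool (w = c)) = (\<Prod>w\<in>V. if w = c then sgn (x w) else 1)"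
      by (intro prod.cong) auto
    then show ?thesis using that finite_V by simp
  qed
  let ?N = "\<lambda>w. of_bool (S w \<noteq> {}) + card {v \<in> V. w \<in> S v} + of_bool (w = a) + of_bool (w = b) :: nat"
  have "sgn (x a) * sgn (x b) = (\<Prod>w\<in>V. sgn (x w) ^ ?N w)"
    unfolding delta[OF a] delta[OF b] power_add prod.distrib using all by (simp add: power_add
        prod.distrib)
  also have "\<dots> = (\<Prod>w\<in>C. sgn (x w) ^ ?N w)"
  proof (rule prod.mono_neutral_right[OF finite_V C], rule ballI)
    fix w assume w: "w \<in> V - C"
    then obtain k where k: "?N w = 2 * k" using degree by (meson evenE)
    show "sgn (x w) ^ ?N w = 1" unfolding k power_mult power2_eq_square using sq[of w] w by simp
  qed
  finally show ?thesis .
qed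

text \<open>Given \<open>X\<^sub>C\<close>, the sign of \<open>X\<^sub>a\<close> is a fair coin by the flip symmetry, and it equals the sign of \<open>X\<^sub>b\<close> or its
opposite, depending on \<open>X\<^sub>C\<close>. So the conditional probability that both are positive is 1/2 or 0, while
independence would require 1/4.\<close>

lemma parity_dependent:
  assumes sub: "A \<subseteq> V" "B \<subseteq> V" "C \<subseteq> V" and ab: "a \<in> A" "b \<in> B"
    and F: "a \<in> F" "F \<inter> C = {}"
    and even: "\<And>v. S v \<noteq> {} \<Longrightarrow> even (card (F \<inter> insert v (S v)))"
    and degree: "\<And>w. w \<in> V - C \<Longrightarrow> even (of_bool (S w \<noteq> {}) + card {v \<in> V. w \<in> S v} +
      of_bool (w = a) + of_bool (w = b) :: nat)"
  shows "\<not> cond_indep (density M (joint V)) A B C"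
proof
  assume ci: "cond_indep (density M (joint V)) A B C"
  have abV: "a \<in> V" "b \<in> V" using ab sub by auto
  let ?D = "V - C" and ?f = "joint V"
  define P where "P = {x \<in> space M. 0 < x a}"
  define P' where "P' = {x \<in> space M. x a < 0}"
  define Q where "Q = {x \<in> space M. 0 < x b}"
  have [measurable]: "P \<in> sets M" "P' \<in> sets M" "Q \<in> sets M"
    unfolding P_def P'_def Q_def using abV by measurable
  have half: "{y \<in> space (Xsp Y). 0 < y c} \<in> sets (Xsp Y)" if "c \<in> Y" for c and Y :: "'v set"
    using that by measurable
  have PQ: "P = {x \<in> space M. restrict x A \<in> {y \<in> space (Xsp A). 0 < y a}}"
    "Q = {x \<in> space M. restrict x B \<in> {y \<in> space (Xsp B). 0 < y b}}"
    using ab by (auto simp: P_def Q_def space_Xsp)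
  have "\<forall>EA\<in>sets (Xsp A). \<forall>EB\<in>sets (Xsp B). AE x in M. ci_eq ?f C
      {x \<in> space M. restrict x A \<in> EA} {x \<in> space M. restrict x B \<in> EB} x"
    using ci sub by (simp add: cond_indep_iff_ci_eq nn_integral_joint ancestral_V)
  from bspec[OF bspec[OF this half[OF ab(1)]] half[OF ab(2)]]
  have eq: "AE x in M. ci_eq ?f C P Q x" by (simp only: PQ[symmetric])
  define g where "g U x = avg ?D (\<lambda>x. ?f x * indicator U x) x" for U x
  have flipped: "g P x = g P' x" if x: "x \<in> space M" for x
  proof -
    have mf: "mix ?D x (flip F y) = flip F (mix ?D x y)" for y
      using F(2) by (auto simp: mix_def flip_def fun_eq_iff)
    have ind: "indicator P (flip F z) = (indicator P' z :: ennreal)" if "z \<in> space M" for z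
    proof -
      have "flip F z a = - z a" using F(1) abV by (simp add: flip_def)
      then show ?thesis using that by (simp add: P_def P'_def indicator_def)
    qed
    have m: "(\<lambda>y. ?f (mix ?D x y) * indicator P (mix ?D x y)) \<in> borel_measurable M"
      using measurable_compose[OF measurable_mix1[OF x] measurable_joint[OF order_refl]]
        measurable_compose[OF measurable_mix1[OF x] borel_measurable_indicator[OF \<open>P \<in> sets M\<close>]]
      by (rule borel_measurable_times_ennreal)
    have "g P x = (\<integral>\<^sup>+ y. ?f (mix ?D x y) * indicator P (mix ?D x y) \<partial>distr M M (flip F))"
      by (simp add: g_def avg_def distr_flip)
    also have "\<dots> = (\<integral>\<^sup>+ y. ?f (mix ?D x (flip F y)) * indicator P (mix ?D x (flip F y)) \<partial>M)"
      by (rule nn_integral_distr[OF measurable_flip]) (use m in simp)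
    also have "\<dots> = g P' x"
    proof -
      have "?f (flip F z) = ?f z" for z by (rule joint_flip) (rule even)
      then show ?thesis unfolding g_def avg_def mf by (simp add: ind)
    qed
    finally show ?thesis .
  qed
  have cong: "g U x = g U' x"
    if "regular x" "\<And>z. regular z \<Longrightarrow> (\<forall>w\<in>C. z w = x w) \<Longrightarrow> ?f z \<noteq> 0 \<Longrightarrow> z \<in> U \<longleftrightarrow> z \<in> U'" for U U' x
    unfolding g_def avg_def
  proof (rule nn_integral_cong_AE, use AE_regular in eventually_elim)
    case (elim y)
    have "regular (mix ?D x y)" using that(1) elim by (rule regular_mix)
    moreover have "\<forall>w\<in>C. mix ?D x y w = x w" using sub by (auto simp: mix_def)
    ultimately show ?case using that(2)[of "mix ?D x y"] by (cases "?f (mix ?D x y) = 0") (auto simp: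
        indicator_def)
  qed
  have fin: "AE x in M. avg ?D ?f x < \<infinity>"
    by (rule avg_finite) (simp_all add: nn_integral_joint ancestral_V)
  have "AE x in M. avg ?D ?f x = 0"
    using eq AE_regular fin
  proof eventually_elim
    case (elim x)
    have x: "x \<in> space M" using elim(2) by (simp add: regular_def)
    have total: "avg ?D ?f x = g P x + g P' x"
    proof -
      have "g P x + g P' x = g (P \<union> P') x"
      proof -
        have "(\<lambda>y. ?f (mix ?D x y) * indicator U (mix ?D x y)) \<in> borel_measurable M" if "U \<in> sets M" for U
          using measurable_compose[OF measurable_mix1[OF x] measurable_joint[OF order_refl]]
            measurable_compose[OF measurable_mix1[OF x] borel_measurable_indicator[OF that]]
          by (rule borel_measurable_times_ennreal)
        then have "g P x + g P' x = (\<integral>\<^sup>+ y. ?f (mix ?D x y) * indicator P (mix ?D x y) +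
            ?f (mix ?D x y) * indicator P' (mix ?D x y) \<partial>M)"
          unfolding g_def avg_def by (intro nn_integral_add[symmetric]) auto
        also have "\<dots> = g (P \<union> P') x"
          unfolding g_def avg_def by (intro nn_integral_cong) (auto simp: indicator_def P_def P'_def)
        finally show ?thesis .
      qed
      also have "\<dots> = g UNIV x"
        using elim(2) abV by (intro cong) (auto simp: regular_def P_def P'_def)
      also have "\<dots> = avg ?D ?f x" by (simp add: g_def)
      finally show ?thesis by simp
    qed
    have ci': "g (P \<inter> Q) x * avg ?D ?f x = g P x * g Q x"
      using elim(1) by (simp add: ci_eq_def g_def)
    define h where "h z = (\<Prod>w\<in>C. sgn (z w) ^ (of_bool (S w \<noteq> {}) + card {v \<in> V. w \<in> S v} +
      of_bool (w = a) + of_bool (w = b)))" for z :: "'v \<Rightarrow> real"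
    have parity: "sgn (z a) * sgn (z b) = h x" if z: "regular z" "\<forall>w\<in>C. z w = x w" "?f z \<noteq> 0" for z
    proof -
      have "h z = h x" unfolding h_def using z(2) by (intro prod.cong) auto
      then show ?thesis using parity_sgn[OF z(1,3) abV sub(3) degree] by (simp add: h_def)
    qed
    have fin': "g P x < \<infinity>" using elim(3) total by (simp add: ennreal_add_less_top)
    have nz: "z a \<noteq> 0" "z b \<noteq> 0" if "regular z" for z using that abV by (auto simp: regular_def)
    have zM: "z \<in> space M" if "regular z" for z using that by (simp add: regular_def)
    have "g P x = 0"
    proof (cases "h x = 1")
      case True
      have same: "0 < z a \<longleftrightarrow> 0 < z b" if "regular z" "\<forall>w\<in>C. z w = x w" "?f z \<noteq> 0" for z
        using parity[OF that] True nz[OF that(1)] by (auto simp: sgn_real_def split: if_splits)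
      have "g (P \<inter> Q) x = g P x" "g Q x = g P x"
        using same zM by (intro cong[OF elim(2)]; auto simp: P_def Q_def)+
      with ci' total flipped[OF x] have "g P x * (g P x + g P x) = g P x * g P x" by simp
      with fin' show ?thesis
        by (cases "g P x") (auto simp: ennreal_mult[symmetric] ennreal_plus[symmetric] simp del:
            ennreal_plus)
    next
      case False
      have opposite: "0 < z a \<longleftrightarrow> z b < 0" if "regular z" "\<forall>w\<in>C. z w = x w" "?f z \<noteq> 0" for z
        using parity[OF that] False nz[OF that(1)] by (auto simp: sgn_real_def split: if_splits)
      have "g (P \<inter> Q) x = g {} x"
        using opposite by (intro cong[OF elim(2)]) (auto simp: P_def Q_def dest: less_asym)
      moreover have "g Q x = g P' x"
      proof (rule cong[OF elim(2)])
        fix z assume z: "regular z" "\<forall>w\<in>C. z w = x w" "?f z \<noteq> 0"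
        then show "z \<in> Q \<longleftrightarrow> z \<in> P'" using opposite[OF z] nz[OF z(1)] zM[OF z(1)]
          by (auto simp: Q_def P'_def)
      qed
      ultimately have "g P x * g P x = 0" using ci' flipped[OF x] by (simp add: g_def avg_def)
      then show ?thesis by simp
    qed
    with total flipped[OF x] show ?case by simp
  qed
  then have "(\<integral>\<^sup>+ x. avg ?D ?f x \<partial>M) = 0"
    by (simp add: nn_integral_0_iff_AE)
  then show False using nn_integral_joint[OF ancestral_V] by (simp add: nn_integral_avg)
qed

end

text \<open>The density \<open>coin h\<close> is even and supported where \<open>1 \<le> h |y| \<le> 3\<close>, so that the clamped function
\<open>soft_sign h\<close> equals the sign there; for small \<open>h\<close> both have small Lipschitz constants.\<close>

definition bump :: "real \<Rightarrow> real" where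
  "bump x = max 0 (1 - \<bar>x\<bar>)"

definition coin :: "real \<Rightarrow> real \<Rightarrow> real" where
  "coin h y = h / 2 * (bump (h * y - 2) + bump (h * y + 2))"

definition soft_sign :: "real \<Rightarrow> real \<Rightarrow> real" where
  "soft_sign h y = max (- 1) (min 1 (h * y))"

lemma measurable_bump [measurable]: "bump \<in> borel_measurable borel"
  unfolding bump_def[abs_def] by measurable

lemma measurable_coin [measurable]: "coin h \<in> borel_measurable borel"
  unfolding coin_def[abs_def] by measurable

lemma bump_bounds: "0 \<le> bump x" "bump x \<le> 1" "\<bar>bump x - bump y\<bar> \<le> \<bar>x - y\<bar>"
  unfolding bump_def by linarith+

lemma ennreal_half_plus_half: "ennreal (1 / 2) + ennreal (1 / 2) = 1"
  by (subst ennreal_plus[symmetric]) simp_all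

lemma nn_integral_bump: "(\<integral>\<^sup>+ x. ennreal (bump x) \<partial>lborel) = 1"
proof -
  have l: "(\<integral>\<^sup>+ x. ennreal (1 + x) * indicator {-1..0} x \<partial>lborel) = ennreal ((0 + 0\<^sup>2 / 2) - (-1 +
      (-1)\<^sup>2 / 2 :: real))"
    by (rule nn_integral_FTC_Icc) (auto intro!: derivative_eq_intros)
  have r: "(\<integral>\<^sup>+ x. ennreal (1 - x) * indicator {0..1} x \<partial>lborel) = ennreal ((1 - 1\<^sup>2 / 2) - (0 - 0\<^sup>2 /
      2 :: real))"
    by (rule nn_integral_FTC_Icc) (auto intro!: derivative_eq_intros)
  have "(\<integral>\<^sup>+ x. ennreal (bump x) \<partial>lborel) =
      (\<integral>\<^sup>+ x. ennreal (1 + x) * indicator {-1..0} x + ennreal (1 - x) * indicator {0..1} x \<partial>lborel)"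
  proof (rule nn_integral_cong_AE, use AE_lborel_singleton[of 0] in eventually_elim)
    case (elim x)
    then show ?case by (auto simp: bump_def indicator_def max_def)
  qed
  also have "\<dots> = ennreal (1 / 2) + ennreal (1 / 2)"
    by (subst nn_integral_add) (simp_all add: l r)
  finally show ?thesis unfolding ennreal_half_plus_half .
qed

lemma nn_integral_coin:
  assumes h: "0 < h"
  shows "(\<integral>\<^sup>+ y. ennreal (coin h y) \<partial>lborel) = 1"
proof -
  have shift: "ennreal h * (\<integral>\<^sup>+ y. ennreal (bump (h * y + c)) \<partial>lborel) = 1" for c
    using nn_integral_real_affine[of "\<lambda>x. ennreal (bump x)" h c] h nn_integral_bump
    by (simp add: add.commute)
  have split: "ennreal (coin h y) = ennreal (1 / 2) * (ennreal h * ennreal (bump (h * y + (-2)))) +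
      ennreal (1 / 2) * (ennreal h * ennreal (bump (h * y + 2)))" for y
  proof -
    have m: "ennreal (1 / 2 * (h * b)) = ennreal (1 / 2) * (ennreal h * ennreal b)" if "0 \<le> b" for b
      using ennreal_mult[of "1 / 2" "h * b"] ennreal_mult[of h b] h that by simp
    have "coin h y = 1 / 2 * (h * bump (h * y + (-2))) + 1 / 2 * (h * bump (h * y + 2))"
      by (simp add: coin_def algebra_simps)
    then have "ennreal (coin h y) = ennreal (1 / 2 * (h * bump (h * y + (-2)))) + ennreal (1 / 2 * (h
        * bump (h * y + 2)))"
      using h bump_bounds(1) by (simp only: ennreal_plus mult_nonneg_nonneg less_imp_le zero_le_one
          zero_le_divide_1_iff zero_le_numeral)
    then show ?thesis by (simp only: m[OF bump_bounds(1)])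
  qed
  have "(\<integral>\<^sup>+ y. ennreal (coin h y) \<partial>lborel) =
      ennreal (1 / 2) * (ennreal h * (\<integral>\<^sup>+ y. ennreal (bump (h * y + (-2))) \<partial>lborel)) +
      ennreal (1 / 2) * (ennreal h * (\<integral>\<^sup>+ y. ennreal (bump (h * y + 2)) \<partial>lborel))"
    unfolding split by (subst nn_integral_add) (simp_all add: nn_integral_cmult)
  then show ?thesis unfolding shift mult_1_right ennreal_half_plus_half .
qed

lemma coin_bounds:
  assumes "0 < h"
  shows "0 \<le> coin h y" "coin h y \<le> h" "\<bar>coin h y - coin h y'\<bar> \<le> h * (h * \<bar>y - y'\<bar>)"
proof -
  show "0 \<le> coin h y" using assms bump_bounds(1) by (simp add: coin_def)
  have "bump (h * y - 2) + bump (h * y + 2) \<le> 2"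
    using bump_bounds(2)[of "h * y - 2"] bump_bounds(2)[of "h * y + 2"] by linarith
  then have "h / 2 * (bump (h * y - 2) + bump (h * y + 2)) \<le> h / 2 * 2"
    using assms by (intro mult_left_mono) auto
  then show "coin h y \<le> h" by (simp add: coin_def)
  have "\<bar>(bump (h * y - 2) + bump (h * y + 2)) - (bump (h * y' - 2) + bump (h * y' + 2))\<bar> \<le> 2 * \<bar>h * y
      - h * y'\<bar>"
  proof -
    have "\<bar>bump (h * y - 2) - bump (h * y' - 2)\<bar> \<le> \<bar>h * y - h * y'\<bar>"
      "\<bar>bump (h * y + 2) - bump (h * y' + 2)\<bar> \<le> \<bar>h * y - h * y'\<bar>"
      using bump_bounds(3)[of "h * y - 2" "h * y' - 2"] bump_bounds(3)[of "h * y + 2" "h * y' + 2"] by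
          simp_all
    moreover have "\<bar>(a + b) - (a' + b')\<bar> \<le> 2 * e" if "\<bar>a - a'\<bar> \<le> e" "\<bar>b - b'\<bar> \<le> e" for a a' b b' e :: real
      using that by linarith
    ultimately show ?thesis by blast
  qed
  also have "\<bar>h * y - h * y'\<bar> = h * \<bar>y - y'\<bar>"
    using assms by (simp add: right_diff_distrib[symmetric] abs_mult)
  finally have "h / 2 * \<bar>(bump (h * y - 2) + bump (h * y + 2)) - (bump (h * y' - 2) + bump (h * y' +
      2))\<bar> \<le>
      h / 2 * (2 * (h * \<bar>y - y'\<bar>))"
    using assms by (intro mult_left_mono) auto
  moreover have "\<bar>coin h y - coin h y'\<bar> =
      h / 2 * \<bar>(bump (h * y - 2) + bump (h * y + 2)) - (bump (h * y' - 2) + bump (h * y' + 2))\<bar>"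
    unfolding coin_def right_diff_distrib[symmetric] abs_mult using assms by simp
  ultimately show "\<bar>coin h y - coin h y'\<bar> \<le> h * (h * \<bar>y - y'\<bar>)" by simp
qed

lemma coin_even: "coin h (- y) = coin h y"
proof -
  have "bump (- x) = bump x" for x by (simp add: bump_def)
  from this[of "h * y + 2"] this[of "h * y - 2"] show ?thesis by (simp add: coin_def add.commute)
qed

lemma coin_soft_sign:
  assumes "0 < h" "coin h y \<noteq> 0"
  shows "y \<noteq> 0 \<and> soft_sign h y = sgn y"
proof -
  have "bump (h * y - 2) \<noteq> 0 \<or> bump (h * y + 2) \<noteq> 0" using assms by (auto simp: coin_def)
  then have "1 < h * y \<or> h * y < -1" unfolding bump_def by linarith
  then show ?thesis
  proof
    assume "1 < h * y"
    moreover from this have "0 < h * y" by linarith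
    then have "0 < y" using assms(1) by (simp add: zero_less_mult_iff)
    ultimately show ?thesis by (simp add: soft_sign_def)
  next
    assume "h * y < -1"
    moreover from this have "h * y < 0" by linarith
    then have "y < 0" using assms(1) by (simp add: mult_less_0_iff)
    ultimately show ?thesis by (simp add: soft_sign_def)
  qed
qed

lemma soft_sign_bounds:
  assumes "0 < h"
  shows "\<bar>soft_sign h y\<bar> \<le> 1" "soft_sign h (- y) = - soft_sign h y"
    "\<bar>soft_sign h y - soft_sign h y'\<bar> \<le> h * \<bar>y - y'\<bar>"
proof -
  have "\<bar>soft_sign h y - soft_sign h y'\<bar> \<le> \<bar>h * y - h * y'\<bar>" unfolding soft_sign_def by linarith
  also have "\<dots> = h * \<bar>y - y'\<bar>" using assms by (simp add: right_diff_distrib[symmetric] abs_mult)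
  finally show "\<bar>soft_sign h y - soft_sign h y'\<bar> \<le> h * \<bar>y - y'\<bar>" .
qed (auto simp: soft_sign_def)

lemma parity_network_coin:
  assumes dag: "dag V E" and S: "\<And>v. S v \<subseteq> pa E v" and h: "0 < h"
  shows "parity_network (density lborel (\<lambda>y. ennreal (coin h y))) V E S (soft_sign h)"
proof -
  let ?\<nu> = "density lborel (\<lambda>y. ennreal (coin h y))"
  interpret prob_space ?\<nu>
    using nn_integral_coin[OF h] by (intro prob_spaceI) (simp add: emeasure_density cong:
        nn_integral_cong)
  show ?thesis
  proof
    show "finite V" using dag by (simp add: dag_def)
    show "sets ?\<nu> = sets borel" by simp
    show "dag V E" "S v \<subseteq> pa E v" for v using dag S by auto
    show "soft_sign h \<in> borel_measurable borel" unfolding soft_sign_def[abs_def] by measurable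
    show "soft_sign h (- x) = - soft_sign h x" "\<bar>soft_sign h x\<bar> \<le> 1" for x
      using soft_sign_bounds[OF h] by auto
    show "distr ?\<nu> ?\<nu> uminus = ?\<nu>"
    proof (rule measure_eqI)
      fix A assume "A \<in> sets (distr ?\<nu> ?\<nu> uminus)"
      then have A [measurable]: "A \<in> sets borel" by simp
      have u: "uminus -` A \<in> sets borel" using measurable_sets[of uminus borel borel A] A by simp
      have "emeasure (distr ?\<nu> ?\<nu> uminus) A = emeasure ?\<nu> (uminus -` A)"
        using emeasure_distr[of uminus ?\<nu> ?\<nu> A] measurable_cong_sets[of ?\<nu> borel ?\<nu> borel] A by simp
      also have "\<dots> = (\<integral>\<^sup>+ y. ennreal (coin h y) * indicator (uminus -` A) y \<partial>lborel)"
        using u by (simp add: emeasure_density)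
      also have "\<dots> = (\<integral>\<^sup>+ y. ennreal (coin h (0 + (-1) * y)) * indicator A (0 + (-1) * y) \<partial>lborel)"
        by (intro nn_integral_cong) (simp add: coin_even indicator_def)
      also have "\<dots> = (\<integral>\<^sup>+ y. ennreal (coin h y) * indicator A y \<partial>lborel)"
        using nn_integral_real_affine[of "\<lambda>y. ennreal (coin h y) * indicator A y" "-1" 0] by simp
      also have "\<dots> = emeasure ?\<nu> A" by (simp add: emeasure_density)
      finally show "emeasure (distr ?\<nu> ?\<nu> uminus) A = emeasure ?\<nu> A" .
    qed simp
    show "AE x in ?\<nu>. x \<noteq> 0 \<and> soft_sign h x = sgn x"
      using coin_soft_sign[OF h] by (subst AE_density) (auto simp: order_less_le ennreal_eq_0_iff
          coin_bounds(1)[OF h])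
  qed
qed

text \<open>The conditional densities of the parity network are bounded by \<open>2 h\<close> and have a Lipschitz constant of
order \<open>h\<^sup>2\<close>, so a small \<open>h\<close> meets the bound and the modulus.\<close>

lemma dependent_net_exists:
  assumes dag: "dag V E" and K: "0 < K" and \<omega>: "concave_modulus \<omega>"
    and sub: "A \<subseteq> V" "B \<subseteq> V" "C \<subseteq> V" and nsep: "\<not> d_separated V E A B C"
  shows "\<exists>m\<in>eqb_bayes_nets V E K \<omega>. \<not> cond_indep (bn_distribution V E m) A B C"
proof -
  have V: "finite V" using dag by (simp add: dag_def)
  obtain a b S F where ps: "a \<in> A" "b \<in> B" "a \<in> F" "F \<inter> C = {}" "\<And>v. S v \<subseteq> pa E v"
    "\<And>v. S v \<noteq> {} \<Longrightarrow> even (card (F \<inter> insert v (S v)))"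
    "\<And>w. w \<in> V - C \<Longrightarrow> even (of_bool (S w \<noteq> {}) + card {v \<in> V. w \<in> S v} +
      of_bool (w = a) + of_bool (w = b) :: nat)"
    using that by (rule parity_structure[OF dag nsep])
  obtain b0 L where bL: "0 < b0" "0 < L" "\<And>t. 0 \<le> t \<Longrightarrow> min b0 (L * t) \<le> \<omega> t"
    using that by (rule modulus_lower_bound[OF \<omega>])
  define n where "n = real (card V)"
  define h where "h = min (min (K / 2) (b0 / 2)) (min 1 (L / (2 + n)))"
  have n: "0 \<le> n" by (simp add: n_def)
  have h: "0 < h" "2 * h \<le> K" "2 * h \<le> b0" "h \<le> 1" "h * (2 + n) \<le> L"
  proof -
    have "h \<le> K / 2" "h \<le> b0 / 2" "h \<le> 1" "h \<le> L / (2 + n)"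
      unfolding h_def by (simp_all only: min_le_iff_disj order_refl simp_thms)
    then show "2 * h \<le> K" "2 * h \<le> b0" "h \<le> 1" "h * (2 + n) \<le> L" using n by (simp_all add:
        pos_le_divide_eq)
    show "0 < h" using K bL n by (simp add: h_def)
  qed
  interpret parity_network "density lborel (\<lambda>y. ennreal (coin h y))" V E S "soft_sign h"
    by (rule parity_network_coin[OF dag ps(5) h(1)])
  define p where "p v z = coin h (z v) * (1 + weight v z)" for v z
  have w: "0 \<le> 1 + weight v z" "1 + weight v z \<le> 2" for v z
    using abs_weight_le_1[of v z] by linarith+
  have bound: "0 \<le> p v z \<and> p v z \<le> 2 * h" for v z
    using coin_bounds[OF h(1), of "z v"] w[of v z] mult_mono[of "coin h (z v)" h "1 + weight v z" 2] h(1)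
    by (simp add: p_def)
  have modulus: "admits_modulus (family E v) \<omega> (p v)" if v: "v \<in> V" for v
    unfolding admits_modulus_def
  proof (intro ballI)
    fix z z' :: "'a \<Rightarrow> real"
    let ?T = "family E v"
    define d where "d = euclid_dist ?T z z'"
    have d0: "0 \<le> d" by (simp add: d_def euclid_dist_def)
    have comp: "\<bar>z w - z' w\<bar> \<le> d" if "w \<in> ?T" for w
      unfolding d_def using pa_finite[OF dag] that by (rule euclid_dist_component)
    have weight: "\<bar>weight v z - weight v z'\<bar> \<le> n * (h * d)"
    proof (cases "S v = {}")
      case True
      then show ?thesis using n h d0 by (simp add: weight_def)
    next
      case False
      have "norm ((\<Prod>w\<in>insert v (S v). soft_sign h (z w)) - (\<Prod>w\<in>insert v (S v). soft_sign h (z' w))) \<le>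
          (\<Sum>w\<in>insert v (S v). norm (soft_sign h (z w) - soft_sign h (z' w)))"
        using soft_sign_bounds(1)[OF h(1)] by (intro norm_prod_diff) auto
      also have "\<dots> \<le> (\<Sum>w\<in>insert v (S v). h * d)"
      proof (rule sum_mono)
        fix w assume "w \<in> insert v (S v)"
        then have "w \<in> ?T" using ps(5) by blast
        then have "h * \<bar>z w - z' w\<bar> \<le> h * d" using comp h(1) by (intro mult_left_mono) auto
        with soft_sign_bounds(3)[OF h(1)] show "norm (soft_sign h (z w) - soft_sign h (z' w)) \<le> h * d"
          unfolding real_norm_def by (rule order_trans)
      qed
      also have "\<dots> = real (card (insert v (S v))) * (h * d)" by simp
      also have "\<dots> \<le> n * (h * d)"
      proof -
        have "insert v (S v) \<subseteq> V" using ps(5)[of v] pa_subset[of v] v by blast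
        then have "card (insert v (S v)) \<le> card V" using V by (rule card_mono[rotated])
        then show ?thesis using h(1) d0 unfolding n_def by (intro mult_right_mono) auto
      qed
      finally show ?thesis using False by (simp only: weight_def if_False real_norm_def)
    qed
    have diff: "p v z - p v z' = (coin h (z v) - coin h (z' v)) * (1 + weight v z) + coin h (z' v) *
        (weight v z - weight v z')"
      by (simp add: p_def algebra_simps)
    have "\<bar>p v z - p v z'\<bar> \<le> \<bar>coin h (z v) - coin h (z' v)\<bar> * (1 + weight v z) + coin h (z' v) *
        \<bar>weight v z - weight v z'\<bar>"
      unfolding diff using w[of v z] coin_bounds(1)[OF h(1), of "z' v"]
      by (intro order_trans[OF abs_triangle_ineq]) (simp add: abs_mult)
    also have "\<dots> \<le> (h * (h * d)) * 2 + h * (n * (h * d))"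
    proof (rule add_mono)
      have "h * \<bar>z v - z' v\<bar> \<le> h * d" using comp[of v] h(1) by (intro mult_left_mono) auto
      then have "h * (h * \<bar>z v - z' v\<bar>) \<le> h * (h * d)" using h(1) by (intro mult_left_mono) auto
      with coin_bounds(3)[OF h(1), of "z v" "z' v"]
      have "\<bar>coin h (z v) - coin h (z' v)\<bar> \<le> h * (h * d)" by (rule order_trans)
      then show "\<bar>coin h (z v) - coin h (z' v)\<bar> * (1 + weight v z) \<le> (h * (h * d)) * 2"
        using w[of v z] h(1) d0 by (intro mult_mono mult_nonneg_nonneg) simp_all
      show "coin h (z' v) * \<bar>weight v z - weight v z'\<bar> \<le> h * (n * (h * d))"
        using coin_bounds(2)[OF h(1), of "z' v"] weight h(1) by (intro mult_mono) simp_all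
    qed
    also have "\<dots> = h * (h * (2 + n)) * d" by (simp add: algebra_simps)
    also have "\<dots> \<le> 1 * L * d"
      using h n d0 by (intro mult_right_mono mult_mono) auto
    finally have "\<bar>p v z - p v z'\<bar> \<le> L * d" by simp
    moreover have "\<bar>p v z - p v z'\<bar> \<le> b0" using bound[of v z] bound[of v z'] h(3) by linarith
    ultimately show "\<bar>p v z - p v z'\<bar> \<le> \<omega> (euclid_dist ?T z z')"
      using bL(3)[OF d0] by (simp add: d_def)
  qed
  have meas: "p v \<in> borel_measurable (Xsp (family E v))" if "v \<in> V" for v
    using pa_finite[OF dag] \<omega> modulus[OF that] by (rule admits_modulus_measurable)
  have kernel: "ennreal (p v (x(v := y))) = ennreal (coin h y) * parity_factor v (x(v := y))" for v y
      and x :: "'a \<Rightarrow> real"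
    using coin_bounds(1)[OF h(1)] w by (simp add: p_def parity_factor_def ennreal_mult)
  have r_meas: "(\<lambda>y. parity_factor v (x(v := y))) \<in> borel_measurable borel"
    if "v \<in> V" "x \<in> space (Xsp (pa E v))" for v x
    using measurable_compose[OF measurable_update[OF that(2)] measurable_r[OF that(1)]] .
  have one: "(\<integral>\<^sup>+ y. ennreal (p v (x(v := y))) \<partial>lborel) = 1" if v: "v \<in> V" "x \<in> space (Xsp (pa E v))"
      for v x
    using r_one[OF v] r_meas[OF v] by (simp add: kernel nn_integral_density)
  define m where "m = density_net V E p"
  have m: "m \<in> eqb_bayes_nets V E K \<omega>"
    unfolding m_def
  proof (rule density_net_eqb[OF dag \<omega> _ modulus one])
    show "0 \<le> p v z \<and> p v z \<le> K" for v z using bound[of v z] h(2) by linarith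
  qed
  have "bn_distribution V E m = density M (joint V)"
  proof (rule bn_distribution_density[OF eqb_subset[OF m]])
    fix v x assume v: "v \<in> V" "x \<in> space (Xsp (pa E v))"
    show "m v x = density (density lborel (\<lambda>y. ennreal (coin h y))) (\<lambda>y. parity_factor v (x(v := y)))"
      using r_meas[OF v] v by (simp add: m_def density_net_def density_density_eq kernel)
  qed
  with parity_dependent[OF sub ps(1-4,6,7)] m show ?thesis by (intro bexI[of _ m]) simp_all
qed

section \<open>Faithful networks\<close>

theorem mainTheorem6:
  fixes V :: "'v set" and E :: "('v \<times> 'v) set" and K :: real and \<omega> :: "real \<Rightarrow> real"
  assumes "dag V E"
    and "K > 0"
    and "concave_modulus \<omega>"
  shows "let BN = eqb_bayes_nets V E K \<omega>;
             T = Metric_space.mtopology BN (bn_dist V E);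
             S = {m \<in> BN. bn_distribution V E m \<in> faithful_measures V E}
         in openin T S \<and> T closure_of S = BN"
proof -
  define BN where "BN = eqb_bayes_nets V E K \<omega>"
  have V: "finite V" using assms(1) by (simp add: dag_def)
  interpret Metric_space BN "bn_dist V E"
    unfolding BN_def by (rule eqb_Metric_space[OF V])
  define triples where "triples = {(A, B, C). A \<subseteq> V \<and> B \<subseteq> V \<and> C \<subseteq> V \<and> \<not> d_separated V E A B C}"
  define U where "U = (\<lambda>(A, B, C). {m \<in> BN. \<not> cond_indep (bn_distribution V E m) A B C})"
  have "triples \<subseteq> Pow V \<times> Pow V \<times> Pow V" by (auto simp: triples_def)
  then have fin: "finite triples" using V by (meson finite_Pow_iff finite_SigmaI finite_subset)
  have U_sub: "U t \<subseteq> BN" for t by (auto simp: U_def split: prod.splits)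
  have U_open: "openin mtopology (U t)" if t: "t \<in> triples" for t
    unfolding openin_mtopology
  proof (intro conjI U_sub allI impI)
    fix m assume "m \<in> U t"
    obtain A B C where tt: "t = (A, B, C)" by (cases t)
    have sub: "A \<subseteq> V" "B \<subseteq> V" "C \<subseteq> V" using t by (auto simp: triples_def tt)
    have m: "m \<in> eqb_bayes_nets V E K \<omega>" "\<not> cond_indep (bn_distribution V E m) A B C"
      using \<open>m \<in> U t\<close> by (auto simp: U_def tt BN_def)
    from dependence_open[OF assms(1,3) m(1) sub m(2)] obtain \<delta> where
      "\<delta> > 0" "\<forall>m'\<in>BN. bn_dist V E m m' < \<delta> \<longrightarrow> \<not> cond_indep (bn_distribution V E m') A B C"
      unfolding BN_def by blast
    then show "\<exists>r>0. mball m r \<subseteq> U t" by (intro exI[of _ \<delta>]) (auto simp: U_def tt)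
  qed
  have U_dense: "mtopology closure_of U t = BN" if t: "t \<in> triples" for t
  proof
    show "mtopology closure_of U t \<subseteq> BN" using closure_of_subset_topspace[of mtopology "U t"] by simp
    obtain A B C where tt: "t = (A, B, C)" by (cases t)
    have sub: "A \<subseteq> V" "B \<subseteq> V" "C \<subseteq> V" "\<not> d_separated V E A B C" using t by (auto simp: triples_def tt)
    obtain m1 where m1: "m1 \<in> eqb_bayes_nets V E K \<omega>" "\<not> cond_indep (bn_distribution V E m1) A B C"
      using dependent_net_exists[OF assms sub] by blast
    show "BN \<subseteq> mtopology closure_of U t"
    proof
      fix m assume m: "m \<in> BN"
      have "\<exists>y\<in>U t. y \<in> mball m r" if r: "0 < r" for r
      proof -
        obtain m' where "m' \<in> BN" "bn_dist V E m m' < r" "\<not> cond_indep (bn_distribution V E m') A B C"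
          using dependence_dense[OF assms(1,3) m[unfolded BN_def] m1(1) r sub(1-3) m1(2)]
          unfolding BN_def by blast
        with m show ?thesis by (intro bexI[of _ m']) (simp_all add: U_def tt)
      qed
      with m show "m \<in> mtopology closure_of U t" by (simp add: metric_closure_of)
    qed
  qed
  have inter: "openin mtopology (BN \<inter> \<Inter>(U ` T)) \<and> mtopology closure_of (BN \<inter> \<Inter>(U ` T)) = BN"
    if "finite T" "T \<subseteq> triples" for T
    using that
  proof (induction T)
    case empty
    then show ?case using openin_topspace[of mtopology] closure_of_topspace[of mtopology] by simp
  next
    case (insert t T)
    let ?W = "BN \<inter> \<Inter>(U ` T)"
    have IH: "openin mtopology ?W" "mtopology closure_of ?W = BN" using insert by auto
    have t: "t \<in> triples" using insert by simp
    have eq: "BN \<inter> \<Inter>(U ` insert t T) = U t \<inter> ?W" using U_sub[of t] by auto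
    have "mtopology closure_of (U t \<inter> ?W) = mtopology closure_of (U t \<inter> mtopology closure_of ?W)"
      by (rule closure_of_openin_Int_closure_of[OF U_open[OF t], symmetric])
    also have "U t \<inter> mtopology closure_of ?W = U t" using U_sub[of t] IH(2) by auto
    finally show ?case unfolding eq using U_dense[OF t] U_open[OF t] IH(1) by (simp add: openin_Int)
  qed
  have "{m \<in> BN. bn_distribution V E m \<in> faithful_measures V E} = BN \<inter> \<Inter>(U ` triples)"
    using bn_distribution_markov[OF assms(1,3)]
    by (auto simp: faithful_measures_def triples_def U_def BN_def)
  with inter[OF fin order_refl] show ?thesis by (simp add: BN_def[symmetric] Let_def)
qed

end
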